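(* Let $m\ge 3$, let $n>0$ be divisible by $4$, let $\mathcal{C}_m,\mathcal{C}_m'$ be $m$-gon categories, let $\Gamma\subseteq\mathsf{D}_m$ be a reversal-closed subset for $\delta^{\mathcal{C}_m'}$, and let $\phi\colon\bigstar\to\Lambda^\Gamma$ be a degree $n$ $\Gamma$-reflection scheme over $\mathcal{C}_m$. Let $T$ be a reflective directed $\{m,n\}$ tiling on $\mathcal{C}_m$ of $S_{m,n}$, let $x_0\in T_2$ be a tile, and let $\sigma\in\Gamma$. Then there exists a unique $\phi$-generated edge-reversal $\tau\colon T\to\Lambda_{\mathcal{C}_m'}$ with $\tau(x_0)=\delta^{\mathcal{C}_m}\cdot\sigma(\delta^{\mathcal{C}_m'})$.
   Context: **The space $S_{m,n}$.** $S_{m,n}$ is the sphere if $\{m,n\}$ is one of the symbols $\{3,3\},\{3,4\},\{4,3\},\{3,5\},\{5,3\}$; the Euclidean plane if it is one of $\{3,6\},\{4,4\},\{6,3\}$; and the hyperbolic plane otherwise (symbols are ordered pairs). **$m$-gon categories.** For $m\ge 3$, an $m$-gon category $\mathcal{C}_m$ has three objects $0,1,2$ and exactly the following (distinct) non-identity morphisms: $s,t\colon 0\to 1$; $d^1,\dots,d^m\colon 1\to 2$; $v^1,\dots,v^m\colon 0\to 2$; with composition satisfying $\{d^i\circ s,\,d^i\circ t\}=\{v^i,v^{i+1}\}$ for $i=1,\dots,m$ (indices mod $m$). The tuple $\delta^{\mathcal{C}_m}\in\{1,-1\}^m$ has $\delta^{\mathcal{C}_m}_i=1$ if $d^i\circ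 s=v^i$ and $-1$ if $d^i\circ t=v^i$. **Directed tilings.** A presheaf $T$ on $\mathcal{C}_m$ has sets $T_0$ (vertices), $T_1$ (edges), $T_2$ (tiles) and structure maps $s,t\colon T_1\to T_0$, $d_1,\dots,d_m\colon T_2\to T_1$, $v_1,\dots,v_m\colon T_2\to T_0$. With $y(i)=\mathrm{Hom}(-,i)$, and $|T|$ the geometric realization with respect to the functor $\mathcal{C}_m\to\mathsf{Top}$ sending $0,1,2$ to a point, an interval and a filled $m$-gon, and $s,t$, $d^1,\dots,d^m$ to the endpoint and successive edge inclusions, a directed $\{m,n\}$ tiling on $\mathcal{C}_m$ of a space $X$ is a presheaf $T$ such that: (1) for each $x\in T_i$ the corresponding map $y(i)\to T$ is levelwise injective; (2) any two distinct tiles have at most one edge in common; (3) each vertex $v$ has exactly $n$ edges $e$ with $s(e)=v$ or $t(e)=v$; (4) $|T|\cong X$. It is reflective if for every edge $e$ lying between two adjacent (distinct) tiles $x_1,x_2$ there is $i$ with $e=d_i(x_1)=d_i(x_2)$. **Dihedral action.** The dihedral group $\mathsf{D}_m$ of order $2m$, generated by a rotation $r$ and a reflection $f$, acts on $\{1,-1\}^m$ by $r(\delta_1,\dots,\delta_m)=(\delta_2,\dots,\delta_m,\delta_1)$ and $f(\delta_1,\dots,\delta_m)=(-\delta_m,\dots,-\delta_1)$. Products of tuples are componentwise. A subset $\Gamma\subseteq\mathsf{D}_m$ is reversal-closed for $\delta\in\{1,-1\}^m$ if for all $\sigma_1,\sigma_2\in\Gamma$ there is $\sigma_3\in\Gamma$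 with $\delta\cdot\sigma_1(\delta)\cdot\sigma_2(\delta)=\sigma_3(\delta)$. **Direction presheaves.** $\Lambda$ is the presheaf on $\mathcal{C}_m$ with $\Lambda_0=\{*\}$, $\Lambda_1=\{1,-1\}$, $\Lambda_2=\{1,-1\}^m$, $d_i=\pi_i$ the $i$-th projection; it is an abelian group object under componentwise multiplication. $\Lambda_{\mathcal{C}_m'}$ and $\Lambda^\Gamma$ are its sub-presheaves with the same $0$- and $1$-components and with $(\Lambda_{\mathcal{C}_m'})_2=\{\delta^{\mathcal{C}_m}\cdot\sigma(\delta^{\mathcal{C}_m'}):\sigma\in\mathsf{D}_m\}$, $\Lambda^\Gamma_2=\{\delta^{\mathcal{C}_m'}\cdot\sigma(\delta^{\mathcal{C}_m'}):\sigma\in\Gamma\}$. An edge-reversal is a map of presheaves from $T$ to $\Lambda$ (or to a sub-presheaf of it). **Reflection schemes.** $\bigstar$ is the presheaf on $\mathcal{C}_m$ consisting of a central tile $s_0$ and $m$ further tiles $s_1,\dots,s_m$, glued only by $d_i(s_i)=d_i(s_0)$ for $i=1,\dots,m$. For $n>0$ divisible by $4$, a degree $n$ $\Gamma$-reflection scheme over $\mathcal{C}_m$ is a map of presheaves $\phi\colon\bigstar\to\Lambda^\Gamma$ with $\phi(s_0)=(1,\dots,1)$. (In particular the $i$-th component of $\phi(s_i)$ is $1$.) **$\phi$-generated.** For a tile $x$ of a reflective tiling $T$, $\bar x\colon\bigstar\to T$ is the map with $\bar x(s_0)=x$ and $\bar x(s_i)$ the tile adjacent to $x$ across the edge $d_i(x)$.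 For $\lambda\in\Lambda_2$, $\bar\lambda\colon\bigstar\to\Lambda$ is the map with $\bar\lambda(s_i)=\lambda$ for all $i=0,\dots,m$. An edge-reversal $\tau$ on $T$ is $\phi$-generated if $\tau\circ\bar x=\phi\cdot\overline{\tau(x)}$ for every $x\in T_2$; that is, $\tau(\bar x(s_i))=\phi(s_i)\cdot\tau(x)$ for all $x\in T_2$ and $i=1,\dots,m$. *)

theory Defs
  imports "HOL-Analysis.Analysis" "HOL-Algebra.Generated_Groups"
begin

text \<open>Indices of sides and corners run over 0, \<dots>, m - 1 instead of 1, \<dots>, m, and tuples in
  \<open>{1, -1}\<^sup>m\<close> are lists of length \<open>m\<close> indexed accordingly.\<close>

section \<open>\<open>m\<close>-gon categories\<close>

datatype gon_ob = Ob0 | Ob1 | Ob2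

text \<open>\<open>Src\<close>, \<open>Tgt\<close>, \<open>Side i\<close>, \<open>Corner i\<close> are the morphisms $s$, $t$, $d^{i+1}$, $v^{i+1}$.\<close>

datatype gon_arr = Idn gon_ob | Src | Tgt | Side nat | Corner nat

fun gdom :: "gon_arr \<Rightarrow> gon_ob" where
  "gdom (Idn j) = j"
| "gdom Src = Ob0"
| "gdom Tgt = Ob0"
| "gdom (Side i) = Ob1"
| "gdom (Corner i) = Ob0"

fun gcod :: "gon_arr \<Rightarrow> gon_ob" where
  "gcod (Idn j) = j"
| "gcod Src = Ob1"
| "gcod Tgt = Ob1"
| "gcod (Side i) = Ob2"
| "gcod (Corner i) = Ob2"

definition gon_arrows :: "nat \<Rightarrow> gon_arr set" where
  "gon_arrows m = range Idn \<union> {Src, Tgt} \<union> Side ` {..<m} \<union> Corner ` {..<m}"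

definition ghom :: "nat \<Rightarrow> gon_ob \<Rightarrow> gon_ob \<Rightarrow> gon_arr set" where
  "ghom m i j = {f \<in> gon_arrows m. gdom f = i \<and> gcod f = j}"

text \<open>Objects and morphisms being the same for all \<open>m\<close>-gon categories, such a category is given
  by its composition law: \<open>c g f\<close> is \<open>g \<circ> f\<close>, and is irrelevant if \<open>g\<close> and \<open>f\<close> are not
  composable.\<close>

type_synonym gon_comp = "gon_arr \<Rightarrow> gon_arr \<Rightarrow> gon_arr"

definition mgon_category :: "nat \<Rightarrow> gon_comp \<Rightarrow> bool" where
  "mgon_category m c \<longleftrightarrow>
     (\<forall>i j k. \<forall>f \<in> ghom m i j. \<forall>g \<in> ghom m j k. c g f \<in> ghom m i k) \<and>
     (\<forall>i j k l. \<forall>f \<in> ghom m i j. \<forall>g \<in> ghom m j k. \<forall>h \<in> ghom m k l.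
        c h (c g f) = c (c h g) f) \<and>
     (\<forall>i j. \<forall>f \<in> ghom m i j. c f (Idn i) = f \<and> c (Idn j) f = f) \<and>
     (\<forall>i<m. {c (Side i) Src, c (Side i) Tgt} = {Corner i, Corner (Suc i mod m)})"

definition gon_dirs :: "nat \<Rightarrow> gon_comp \<Rightarrow> int list" where
  "gon_dirs m c = map (\<lambda>i. if c (Side i) Src = Corner i then 1 else -1) [0..<m]"

lemma gon_dirs_nth:
  assumes "2 \<le> m" "mgon_category m c" "i < m"
  shows "gon_dirs m c ! i = 1 \<longleftrightarrow> c (Side i) Src = Corner i"
    and "gon_dirs m c ! i = -1 \<longleftrightarrow> c (Side i) Tgt = Corner i"
proof -
  have eq: "{c (Side i) Src, c (Side i) Tgt} = {Corner i, Corner (Suc i mod m)}"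
    using assms unfolding mgon_category_def by blast
  have "Suc i mod m \<noteq> i"
    using assms by (cases "Suc i = m") auto
  then have ne: "Corner i \<noteq> Corner (Suc i mod m)" by simp
  show "gon_dirs m c ! i = 1 \<longleftrightarrow> c (Side i) Src = Corner i"
    using assms by (simp add: gon_dirs_def)
  have "c (Side i) Src = Corner i \<longleftrightarrow> c (Side i) Tgt \<noteq> Corner i"
    using eq ne unfolding doubleton_eq_iff by metis
  then show "gon_dirs m c ! i = -1 \<longleftrightarrow> c (Side i) Tgt = Corner i"
    using assms by (simp add: gon_dirs_def)
qed

definition corner_index :: "gon_arr \<Rightarrow> nat" where
  "corner_index f = (case f of Corner i \<Rightarrow> i | _ \<Rightarrow> undefined)"

lemma ghom_simps:
  "ghom m Ob0 Ob1 = {Src, Tgt}" "ghom m Ob1 Ob2 = Side ` {..<m}" "ghom m Ob0 Ob2 = Corner ` {..<m}"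
  "ghom m j j = {Idn j}" "ghom m Ob1 Ob0 = {}" "ghom m Ob2 Ob0 = {}" "ghom m Ob2 Ob1 = {}"
  by (auto simp: ghom_def gon_arrows_def)

lemma all_gon_ob: "(\<forall>j. Q j) \<longleftrightarrow> Q Ob0 \<and> Q Ob1 \<and> Q Ob2"
  by (metis gon_ob.exhaust)

lemma mgon_ends:
  assumes "mgon_category m c" "i < m"
  shows "c (Side i) Src = Corner i \<and> c (Side i) Tgt = Corner (Suc i mod m) \<or>
    c (Side i) Src = Corner (Suc i mod m) \<and> c (Side i) Tgt = Corner i"
  using assms unfolding mgon_category_def doubleton_eq_iff by blast

lemma mgon_category_ex:
  assumes "length d = m" "set d \<subseteq> {1,-1}" "3 \<le> m"
  shows "\<exists>c. mgon_category m c \<and> gon_dirs m c = d"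
proof -
  define c where "c g f = (case (g,f) of (Idn _, f) \<Rightarrow> f | (g, Idn _) \<Rightarrow> g
    | (Side i, Src) \<Rightarrow> if d ! i = 1 then Corner i else Corner (Suc i mod m)
    | (Side i, Tgt) \<Rightarrow> if d ! i = 1 then Corner (Suc i mod m) else Corner i | _ \<Rightarrow> undefined)" for g f
  have *: "Suc i mod m \<noteq> i" if "i < m" for i using that assms by (cases "Suc i = m") auto
  have **: "Suc i mod m < m" for i using assms by simp
  have "mgon_category m c"
    unfolding mgon_category_def all_gon_ob using *
    by (auto simp: ghom_simps c_def ** )
  moreover have "gon_dirs m c = d"
    using assms by (intro nth_equalityI) (auto simp: gon_dirs_def c_def * dest: nth_mem)
  ultimately show ?thesis by blast
qed


section \<open>Presheaves\<close>

record ('v, 'e, 't) gon_presheaf =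
  verts :: "'v set"
  edges :: "'e set"
  tiles :: "'t set"
  src :: "'e \<Rightarrow> 'v"
  tgt :: "'e \<Rightarrow> 'v"
  side :: "nat \<Rightarrow> 't \<Rightarrow> 'e"
  corner :: "nat \<Rightarrow> 't \<Rightarrow> 'v"

datatype ('v, 'e, 't) cell = VCell 'v | ECell 'e | TCell 't

fun cells :: "('v, 'e, 't) gon_presheaf \<Rightarrow> gon_ob \<Rightarrow> ('v, 'e, 't) cell set" where
  "cells P Ob0 = VCell ` verts P"
| "cells P Ob1 = ECell ` edges P"
| "cells P Ob2 = TCell ` tiles P"

text \<open>\<open>restr P f a\<close> is the image of \<open>a\<close> under the structure map \<open>P(f)\<close>.\<close>

fun restr :: "('v, 'e, 't) gon_presheaf \<Rightarrow> gon_arr \<Rightarrow> ('v, 'e, 't) cell \<Rightarrow> ('v, 'e, 't) cell" where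
  "restr P (Idn j) a = a"
| "restr P Src (ECell e) = VCell (src P e)"
| "restr P Tgt (ECell e) = VCell (tgt P e)"
| "restr P (Side i) (TCell x) = ECell (side P i x)"
| "restr P (Corner i) (TCell x) = VCell (corner P i x)"
| "restr P _ _ = undefined"

definition gon_presheaf :: "nat \<Rightarrow> gon_comp \<Rightarrow> ('v, 'e, 't) gon_presheaf \<Rightarrow> bool" where
  "gon_presheaf m c P \<longleftrightarrow>
     (\<forall>i j. \<forall>f \<in> ghom m i j. \<forall>a \<in> cells P j. restr P f a \<in> cells P i) \<and>
     (\<forall>i j k. \<forall>f \<in> ghom m i j. \<forall>g \<in> ghom m j k. \<forall>a \<in> cells P k.
        restr P (c g f) a = restr P f (restr P g a))"

lemma presheaf_iff:
  assumes "mgon_category m c"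
  shows "gon_presheaf m c P \<longleftrightarrow>
    src P ` edges P \<subseteq> verts P \<and> tgt P ` edges P \<subseteq> verts P \<and>
    (\<forall>i<m. side P i ` tiles P \<subseteq> edges P \<and> corner P i ` tiles P \<subseteq> verts P) \<and>
    (\<forall>i<m. \<forall>x\<in>tiles P. src P (side P i x) = corner P (corner_index (c (Side i) Src)) x \<and>
       tgt P (side P i x) = corner P (corner_index (c (Side i) Tgt)) x)"
proof -
  have id: "c f (Idn i) = f \<and> c (Idn j) f = f" if "f \<in> ghom m i j" for f i j
    using assms that unfolding mgon_category_def by blast
  have id': "c (Idn j) (Idn j) = Idn j" for j using id[of "Idn j" j j] by (simp add: ghom_simps)
  have id1: "c Src (Idn Ob0) = Src" "c Tgt (Idn Ob0) = Tgt" "c (Idn Ob1) Src = Src" "c (Idn Ob1) Tgt = Tgt"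
    using id[of Src Ob0 Ob1] id[of Tgt Ob0 Ob1] by (auto simp: ghom_simps)
  have id2: "c (Side i) (Idn Ob1) = Side i" "c (Idn Ob2) (Side i) = Side i"
     "c (Corner i) (Idn Ob0) = Corner i" "c (Idn Ob2) (Corner i) = Corner i" if "i < m" for i
    using that id[of "Side i" Ob1 Ob2] id[of "Corner i" Ob0 Ob2] by (auto simp: ghom_simps)
  have C: "\<exists>k l. c (Side i) Src = Corner k \<and> c (Side i) Tgt = Corner l" if "i < m" for i
    using mgon_ends[OF assms that] by blast
  have C': "restr P (c (Side i) Src) (TCell x) = VCell (corner P (corner_index (c (Side i) Src)) x)"
    "restr P (c (Side i) Tgt) (TCell x) = VCell (corner P (corner_index (c (Side i) Tgt)) x)" if "i < m" for i x
    using C[OF that] by (auto simp: corner_index_def)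
  show ?thesis
    unfolding gon_presheaf_def all_gon_ob
    by (auto simp: ghom_simps id' id1 id2 C' image_subset_iff)
qed

text \<open>A map of presheaves is the triple of its components. These are taken to be extensional, i.e.\
  \<open>undefined\<close> outside the respective carrier, so that equality of such triples is
  equality of maps of presheaves.\<close>

type_synonym ('v, 'e, 't, 'v1, 'e1, 't1) gon_map = "('v \<Rightarrow> 'v1) \<times> ('e \<Rightarrow> 'e1) \<times> ('t \<Rightarrow> 't1)"

abbreviation on_verts :: "('v, 'e, 't, 'v1, 'e1, 't1) gon_map \<Rightarrow> 'v \<Rightarrow> 'v1" where
  "on_verts h \<equiv> fst h"
abbreviation on_edges :: "('v, 'e, 't, 'v1, 'e1, 't1) gon_map \<Rightarrow> 'e \<Rightarrow> 'e1" where
  "on_edges h \<equiv> fst (snd h)"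
abbreviation on_tiles :: "('v, 'e, 't, 'v1, 'e1, 't1) gon_map \<Rightarrow> 't \<Rightarrow> 't1" where
  "on_tiles h \<equiv> snd (snd h)"

definition gon_maps ::
  "nat \<Rightarrow> ('v, 'e, 't) gon_presheaf \<Rightarrow> ('v1, 'e1, 't1) gon_presheaf \<Rightarrow>
   ('v, 'e, 't, 'v1, 'e1, 't1) gon_map set" where
  "gon_maps m P Q = {h.
     on_verts h \<in> verts P \<rightarrow>\<^sub>E verts Q \<and> on_edges h \<in> edges P \<rightarrow>\<^sub>E edges Q \<and>
     on_tiles h \<in> tiles P \<rightarrow>\<^sub>E tiles Q \<and>
     (\<forall>i j. \<forall>f \<in> ghom m i j. \<forall>a \<in> cells P j.
        map_cell (on_verts h) (on_edges h) (on_tiles h) (restr P f a) =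
        restr Q f (map_cell (on_verts h) (on_edges h) (on_tiles h) a))}"

definition gon_map_comp ::
  "('v, 'e, 't) gon_presheaf \<Rightarrow> ('v1, 'e1, 't1, 'v2, 'e2, 't2) gon_map \<Rightarrow>
   ('v, 'e, 't, 'v1, 'e1, 't1) gon_map \<Rightarrow> ('v, 'e, 't, 'v2, 'e2, 't2) gon_map" where
  "gon_map_comp P h g =
     (compose (verts P) (on_verts h) (on_verts g),
      compose (edges P) (on_edges h) (on_edges g),
      compose (tiles P) (on_tiles h) (on_tiles g))"


section \<open>Geometric realization\<close>

text \<open>The quotient of \<open>X\<close> by the equivalence relation \<open>r\<close>.\<close>

definition quotient_topology :: "'a topology \<Rightarrow> 'a rel \<Rightarrow> 'a set topology" where
  "quotient_topology X r =
     topology (\<lambda>U. U \<subseteq> topspace X // r \<and> openin X {x \<in> topspace X. r `` {x} \<in> U})"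

lemma openin_quotient_topology:
  "openin (quotient_topology X r) U \<longleftrightarrow>
     U \<subseteq> topspace X // r \<and> openin X {x \<in> topspace X. r `` {x} \<in> U}"
proof -
  have 1: "{x \<in> topspace X. r `` {x} \<in> S \<inter> T} =
      {x \<in> topspace X. r `` {x} \<in> S} \<inter> {x \<in> topspace X. r `` {x} \<in> T}" for S T
    by auto
  have 2: "{x \<in> topspace X. r `` {x} \<in> \<Union>\<K>} = (\<Union>K\<in>\<K>. {x \<in> topspace X. r `` {x} \<in> K})" for \<K>
    by auto
  have "istopology (\<lambda>U. U \<subseteq> topspace X // r \<and> openin X {x \<in> topspace X. r `` {x} \<in> U})"
    unfolding istopology_def 1 2 by blast
  then show ?thesis
    by (simp add: quotient_topology_def)
qed

lemma topspace_quotient_topology: "topspace (quotient_topology X r) = topspace X // r"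
proof
  show "topspace (quotient_topology X r) \<subseteq> topspace X // r"
    using openin_quotient_topology openin_topspace by blast
  have "{x \<in> topspace X. r `` {x} \<in> topspace X // r} = topspace X"
    by (auto simp: quotient_def)
  then have "openin (quotient_topology X r) (topspace X // r)"
    by (simp add: openin_quotient_topology)
  then show "topspace X // r \<subseteq> topspace (quotient_topology X r)"
    by (rule openin_subset)
qed

lemma quotient_map_quotient_topology:
  "quotient_map X (quotient_topology X r) (\<lambda>x. r `` {x})"
  unfolding quotient_map_def topspace_quotient_topology openin_quotient_topology
  by (auto simp: quotient_def)

text \<open>The functor to topological spaces used for realization: the point is \<open>{0}\<close>, the interval
  \<open>[0, 1]\<close> and the filled \<open>m\<close>-gon the convex hull of the \<open>m\<close>-th roots of unity, all in the
  complex plane; \<open>Side i\<close> goes to the affine map onto the \<open>i\<close>-th side of the polygon, directed so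
  as to be compatible with the composition \<open>c\<close>.\<close>

definition polygon_corner :: "nat \<Rightarrow> nat \<Rightarrow> complex" where
  "polygon_corner m i = cis (2 * pi * real i / real m)"

fun model_space :: "nat \<Rightarrow> gon_ob \<Rightarrow> complex set" where
  "model_space m Ob0 = {0}"
| "model_space m Ob1 = closed_segment 0 1"
| "model_space m Ob2 = convex hull (polygon_corner m ` {..<m})"

definition side_end :: "nat \<Rightarrow> gon_arr \<Rightarrow> complex" where
  "side_end m f = (case f of Corner i \<Rightarrow> polygon_corner m i | _ \<Rightarrow> undefined)"

fun model_map :: "nat \<Rightarrow> gon_comp \<Rightarrow> gon_arr \<Rightarrow> complex \<Rightarrow> complex" where
  "model_map m c (Idn j) p = p"
| "model_map m c Src p = 0"
| "model_map m c Tgt p = 1"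
| "model_map m c (Corner i) p = polygon_corner m i"
| "model_map m c (Side i) p =
     (1 - p) * side_end m (c (Side i) Src) + p * side_end m (c (Side i) Tgt)"

lemma model_map_comp:
  assumes "mgon_category m c" "f \<in> ghom m i j" "g \<in> ghom m j k" "p \<in> model_space m i"
  shows "model_map m c (c g f) p = model_map m c g (model_map m c f p)"
    and "model_map m c f p \<in> model_space m j"
proof -
  have id: "c f (Idn i) = f \<and> c (Idn j) f = f" if "f \<in> ghom m i j" for f i j
    using assms that unfolding mgon_category_def by blast
  show "model_map m c (c g f) p = model_map m c g (model_map m c f p)"
    using assms(2-4) id[OF assms(2)] id[OF assms(3)] mgon_ends[OF assms(1)]
    by (cases i; cases j; cases k) (fastforce simp: ghom_simps side_end_def)+
  have *: "(1 - p) * a + p * b \<in> convex hull S"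
    if "p \<in> closed_segment 0 1" "a \<in> S" "b \<in> S" for a b :: complex and S
  proof -
    obtain u where u: "0 \<le> u" "u \<le> 1" "p = complex_of_real u"
      using \<open>p \<in> closed_segment 0 1\<close> by (auto simp: in_segment scaleR_conv_of_real)
    have "(1 - u) *\<^sub>R a + u *\<^sub>R b \<in> convex hull S"
      using u that by (intro convexD_alt convex_convex_hull) (auto intro: hull_inc)
    then show ?thesis by (simp add: u scaleR_conv_of_real)
  qed
  have ends: "side_end m (c (Side l) Src) \<in> polygon_corner m ` {..<m}"
    "side_end m (c (Side l) Tgt) \<in> polygon_corner m ` {..<m}" if "l < m" for l
    using mgon_ends[OF assms(1) that] that by (auto simp: side_end_def)
  show "model_map m c f p \<in> model_space m j"
    using assms(2,4) by (cases i; cases j) (auto simp: ghom_simps intro!: * ends intro: hull_inc)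
qed

definition realization_glue ::
  "nat \<Rightarrow> gon_comp \<Rightarrow> ('v, 'e, 't) gon_presheaf \<Rightarrow> (('v, 'e, 't) cell \<times> complex) rel" where
  "realization_glue m c P =
     {((restr P f a, p), (a, model_map m c f p)) | i j f a p.
        f \<in> ghom m i j \<and> a \<in> cells P j \<and> p \<in> model_space m i}"

definition cell_space :: "nat \<Rightarrow> ('v, 'e, 't) cell \<Rightarrow> complex set" where
  "cell_space m a = model_space m (case a of VCell _ \<Rightarrow> Ob0 | ECell _ \<Rightarrow> Ob1 | TCell _ \<Rightarrow> Ob2)"

definition realization ::
  "nat \<Rightarrow> gon_comp \<Rightarrow> ('v, 'e, 't) gon_presheaf \<Rightarrow> (('v, 'e, 't) cell \<times> complex) set topology" where
  "realization m c P =
     quotient_topology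
       (sum_topology (\<lambda>a. top_of_set (cell_space m a)) (\<Union>j. cells P j))
       ((realization_glue m c P \<union> (realization_glue m c P)\<inverse>)\<^sup>*)"


section \<open>Directed tilings\<close>

text \<open>As a map \<open>y(j) \<rightarrow> T\<close>, an element \<open>x\<close> of \<open>T\<^sub>j\<close> sends \<open>f \<in> Hom(i, j)\<close> to \<open>T(f)(x)\<close>.\<close>

definition directed_tiling ::
  "nat \<Rightarrow> nat \<Rightarrow> gon_comp \<Rightarrow> 'a topology \<Rightarrow> ('v, 'e, 't) gon_presheaf \<Rightarrow> bool" where
  "directed_tiling m n c X T \<longleftrightarrow>
     gon_presheaf m c T \<and>
     (\<forall>j. \<forall>x \<in> cells T j. \<forall>i. inj_on (\<lambda>f. restr T f x) (ghom m i j)) \<and>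
     (\<forall>x \<in> tiles T. \<forall>y \<in> tiles T. x \<noteq> y \<longrightarrow>
        card ((\<lambda>i. side T i x) ` {..<m} \<inter> (\<lambda>i. side T i y) ` {..<m}) \<le> 1) \<and>
     (\<forall>v \<in> verts T. finite {e \<in> edges T. src T e = v \<or> tgt T e = v} \<and>
        card {e \<in> edges T. src T e = v \<or> tgt T e = v} = n) \<and>
     realization m c T homeomorphic_space X"

definition reflective :: "nat \<Rightarrow> ('v, 'e, 't) gon_presheaf \<Rightarrow> bool" where
  "reflective m T \<longleftrightarrow>
     (\<forall>x \<in> tiles T. \<forall>y \<in> tiles T. \<forall>e. x \<noteq> y \<longrightarrow>
        e \<in> (\<lambda>i. side T i x) ` {..<m} \<longrightarrow> e \<in> (\<lambda>i. side T i y) ` {..<m} \<longrightarrow>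
        (\<exists>i<m. e = side T i x \<and> e = side T i y))"

text \<open>Only the topology of $S_{m,n}$ is relevant. All three spaces are realized in
  three-dimensional Euclidean space, the hyperbolic plane as the Poincare disc.\<close>

definition tiling_space :: "nat \<Rightarrow> nat \<Rightarrow> (real ^ 3) topology" where
  "tiling_space m n =
     (if (m, n) \<in> {(3, 3), (3, 4), (4, 3), (3, 5), (5, 3)} then top_of_set (sphere 0 1)
      else if (m, n) \<in> {(3, 6), (4, 4), (6, 3)} then top_of_set {x. x $ 3 = 0}
      else top_of_set {x. x $ 3 = 0 \<and> norm x < 1})"


section \<open>The dihedral action\<close>

text \<open>\<open>(k, b)\<close> stands for \<open>r\<^sup>k\<close> if \<open>b\<close> is false, and for \<open>r\<^sup>k f\<close> if \<open>b\<close> is true.\<close>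

definition dihedral :: "nat \<Rightarrow> (nat \<times> bool) monoid" where
  "dihedral m =
     \<lparr>carrier = {..<m} \<times> UNIV,
      mult = (\<lambda>(k, a) (l, b). (if a then (k + (m - l)) mod m else (k + l) mod m, a \<noteq> b)),
      one = (0, False)\<rparr>"

definition dihedral_act :: "nat \<times> bool \<Rightarrow> int list \<Rightarrow> int list" where
  "dihedral_act \<sigma> \<delta> = rotate (fst \<sigma>) (if snd \<sigma> then map uminus (rev \<delta>) else \<delta>)"

lemma dihedral_group:
  assumes "0 < m" shows "group (dihedral m)"
proof (rule groupI)
  fix x y z assume *: "x \<in> carrier (dihedral m)" "y \<in> carrier (dihedral m)" "z \<in> carrier (dihedral m)"
  obtain k a l b i d where [simp]: "x = (k, a)" "y = (l, b)" "z = (i, d)" by (metis surj_pair)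
  have km: "k < m" "l < m" "i < m" using * by (auto simp: dihedral_def)
  show "x \<otimes>\<^bsub>dihedral m\<^esub> y \<in> carrier (dihedral m)" using assms by (auto simp: dihedral_def)
  define D where "D k l = (k + (m - l)) mod m" for k l
  define F where "F k l = (k + l) mod m" for k l
  have D: "int (D k l) = (int k - int l) mod int m" if "l < m" for k l
    using that unfolding D_def
    by (simp add: zmod_int of_nat_diff) (metis add_diff_eq add.commute mod_add_self1 diff_add_eq)
  have F: "int (F k l) = (int k + int l) mod int m" for k l by (simp add: F_def zmod_int)
  have lt: "D k l < m" "F k l < m" for k l using assms by (simp_all add: D_def F_def)
  have mult: "(k, a) \<otimes>\<^bsub>dihedral m\<^esub> (l, b) = (if a then D k l else F k l, a \<noteq> b)" for k a l b
    by (simp add: dihedral_def D_def F_def)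
  have eqI: "p = q" if "int p = int q" for p q using that by simp
  have "F (F k l) i = F k (F l i)"
    by (rule eqI, simp only: F mod_simps add.assoc)
  moreover have "D (F k l) i = F k (D l i)"
    by (rule eqI, simp only: F D km lt mod_simps add_diff_eq)
  moreover have "D (D k l) i = D k (F l i)"
    by (rule eqI, simp only: F D km lt mod_simps diff_diff_eq)
  moreover have "F (D k l) i = D k (D l i)"
    by (rule eqI, simp only: F D km lt mod_simps diff_diff_eq2 diff_add_eq)
  ultimately show "x \<otimes>\<^bsub>dihedral m\<^esub> y \<otimes>\<^bsub>dihedral m\<^esub> z = x \<otimes>\<^bsub>dihedral m\<^esub> (y \<otimes>\<^bsub>dihedral m\<^esub> z)"
    by (cases a; cases b) (simp_all add: mult)
next
  show "\<one>\<^bsub>dihedral m\<^esub> \<in> carrier (dihedral m)" using assms by (simp add: dihedral_def)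
next
  fix x assume *: "x \<in> carrier (dihedral m)"
  then show "\<one>\<^bsub>dihedral m\<^esub> \<otimes>\<^bsub>dihedral m\<^esub> x = x" by (auto simp: dihedral_def)
  obtain k a where x: "x = (k, a)" "k < m" using * by (auto simp: dihedral_def)
  have "(if a then (k, a) else ((m - k) mod m, a)) \<in> carrier (dihedral m) \<and>
     (if a then (k, a) else ((m - k) mod m, a)) \<otimes>\<^bsub>dihedral m\<^esub> x = \<one>\<^bsub>dihedral m\<^esub>"
    using x by (auto simp: dihedral_def mod_simps)
  then show "\<exists>y\<in>carrier (dihedral m). y \<otimes>\<^bsub>dihedral m\<^esub> x = \<one>\<^bsub>dihedral m\<^esub>" by blast
qed

lemma order_dihedral: "order (dihedral m) = 2 * m"
  by (simp add: order_def dihedral_def card_cartesian_product)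

lemma rev_rotate_cancel:
  assumes "l < length xs"
  shows "rev (rotate l xs) = rotate (length xs - l) (rev xs)"
  using assms by (cases "l = 0") (simp_all add: rotate_rev)

lemma dihedral_act_mult:
  assumes "length \<delta> = m" "\<sigma> \<in> carrier (dihedral m)" "\<rho> \<in> carrier (dihedral m)"
  shows "dihedral_act (\<sigma> \<otimes>\<^bsub>dihedral m\<^esub> \<rho>) \<delta> = dihedral_act \<sigma> (dihedral_act \<rho> \<delta>)"
proof -
  obtain k a l b where s: "\<sigma> = (k, a)" "\<rho> = (l, b)" and km: "k < m" "l < m"
    using assms by (auto simp: dihedral_def)
  have rc: "rotate (j mod m) xs = rotate j xs" if "length xs = m" for j and xs :: "int list"
    using that by (metis rotate_conv_mod)
  show ?thesis using assms km
    by (cases a; cases b)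
      (simp_all add: s dihedral_def dihedral_act_def rc rotate_rotate rotate_map rev_map rev_rotate_cancel comp_def)
qed

lemma dihedral_generated:
  assumes "2 \<le> m"
  shows "generate (dihedral m) {(1, False), (0, True)} = carrier (dihedral m)"
proof
  interpret group "dihedral m" using assms by (intro dihedral_group) simp
  show "generate (dihedral m) {(1, False), (0, True)} \<subseteq> carrier (dihedral m)"
    using assms by (intro generate_incl) (auto simp: dihedral_def)
  have rot: "k < m \<Longrightarrow> (k, False) \<in> generate (dihedral m) {(1, False), (0, True)}" for k
  proof (induction k)
    case 0
    show ?case using generate.one[of "dihedral m"] by (simp add: dihedral_def)
  next
    case (Suc k)
    then have "(k, False) \<in> generate (dihedral m) {(1, False), (0, True)}" by simp
    moreover have "(1, False) \<in> generate (dihedral m) {(1, False), (0, True)}"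
      by (rule generate.incl) simp
    ultimately have "(1, False) \<otimes>\<^bsub>dihedral m\<^esub> (k, False) \<in> generate (dihedral m) {(1, False), (0, True)}"
      by (metis generate.eng)
    then show ?case using Suc.prems by (simp add: dihedral_def)
  qed
  show "carrier (dihedral m) \<subseteq> generate (dihedral m) {(1, False), (0, True)}"
  proof
    fix x assume "x \<in> carrier (dihedral m)"
    then obtain k b where x: "x = (k, b)" "k < m" by (auto simp: dihedral_def)
    have "(0, True) \<in> generate (dihedral m) {(1, False), (0, True)}"
      by (rule generate.incl) simp
    then have "(k, False) \<otimes>\<^bsub>dihedral m\<^esub> (0, True) \<in> generate (dihedral m) {(1, False), (0, True)}"
      using rot[OF x(2)] by (metis generate.eng)
    then show "x \<in> generate (dihedral m) {(1, False), (0, True)}"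
      using rot x by (cases b) (auto simp: dihedral_def)
  qed
qed

definition sign_tuples :: "nat \<Rightarrow> int list set" where
  "sign_tuples m = {\<delta>. length \<delta> = m \<and> set \<delta> \<subseteq> {1, -1}}"

definition tuple_mult :: "int list \<Rightarrow> int list \<Rightarrow> int list" where
  "tuple_mult \<delta> \<epsilon> = map2 (*) \<delta> \<epsilon>"

definition reversal_closed :: "nat \<Rightarrow> int list \<Rightarrow> (nat \<times> bool) set \<Rightarrow> bool" where
  "reversal_closed m \<delta> \<Gamma> \<longleftrightarrow>
     \<Gamma> \<subseteq> carrier (dihedral m) \<and>
     (\<forall>\<sigma>1 \<in> \<Gamma>. \<forall>\<sigma>2 \<in> \<Gamma>. \<exists>\<sigma>3 \<in> \<Gamma>.
        tuple_mult (tuple_mult \<delta> (dihedral_act \<sigma>1 \<delta>)) (dihedral_act \<sigma>2 \<delta>) = dihedral_act \<sigma>3 \<delta>)"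


section \<open>Direction presheaves\<close>

text \<open>\<open>dir_presheaf A\<close> is the sub-presheaf of $\Lambda$ with full 0- and 1-components and set of
  tiles \<open>A\<close>.\<close>

definition dir_presheaf :: "int list set \<Rightarrow> (unit, int, int list) gon_presheaf" where
  "dir_presheaf A =
     \<lparr>verts = {()}, edges = {1, -1}, tiles = A,
      src = (\<lambda>_. ()), tgt = (\<lambda>_. ()), side = (\<lambda>i \<delta>. \<delta> ! i), corner = (\<lambda>_ _. ())\<rparr>"

definition Lam :: "nat \<Rightarrow> (unit, int, int list) gon_presheaf" where
  "Lam m = dir_presheaf (sign_tuples m)"

definition Lam_cat :: "nat \<Rightarrow> gon_comp \<Rightarrow> gon_comp \<Rightarrow> (unit, int, int list) gon_presheaf" where
  "Lam_cat m c c' = dir_presheaf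
     {tuple_mult (gon_dirs m c) (dihedral_act \<sigma> (gon_dirs m c')) | \<sigma>. \<sigma> \<in> carrier (dihedral m)}"

definition Lam_sub ::
  "nat \<Rightarrow> gon_comp \<Rightarrow> (nat \<times> bool) set \<Rightarrow> (unit, int, int list) gon_presheaf" where
  "Lam_sub m c' \<Gamma> = dir_presheaf
     {tuple_mult (gon_dirs m c') (dihedral_act \<sigma> (gon_dirs m c')) | \<sigma>. \<sigma> \<in> \<Gamma>}"

text \<open>The product of two maps from \<open>P\<close> to the abelian group object $\Lambda$.\<close>

definition dir_map_mult ::
  "('v, 'e, 't) gon_presheaf \<Rightarrow> ('v, 'e, 't, unit, int, int list) gon_map \<Rightarrow>
   ('v, 'e, 't, unit, int, int list) gon_map \<Rightarrow> ('v, 'e, 't, unit, int, int list) gon_map" where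
  "dir_map_mult P h g =
     (\<lambda>v \<in> verts P. (), \<lambda>e \<in> edges P. on_edges h e * on_edges g e,
      \<lambda>x \<in> tiles P. tuple_mult (on_tiles h x) (on_tiles g x))"


section \<open>The star and reflection schemes\<close>

text \<open>\<open>Centre\<close> is $s_0$ and \<open>Outer i\<close> is $s_{i+1}$. The pair \<open>(s, j)\<close> names the \<open>j\<close>-th side or corner
  of the tile \<open>s\<close>. Gluing side \<open>i\<close> of \<open>Outer i\<close> to side \<open>i\<close> of \<open>Centre\<close> also identifies the
  corners \<open>i\<close> and \<open>i + 1\<close> of these tiles; sides and corners shared with \<open>Centre\<close> are named after
  \<open>Centre\<close>.\<close>

datatype star_tile = Centre | Outer nat

definition star_side :: "nat \<Rightarrow> star_tile \<Rightarrow> star_tile \<times> nat" where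
  "star_side j s = (if s = Outer j then (Centre, j) else (s, j))"

definition star_corner :: "nat \<Rightarrow> nat \<Rightarrow> star_tile \<Rightarrow> star_tile \<times> nat" where
  "star_corner m j s = (if \<exists>i. s = Outer i \<and> (j = i \<or> j = Suc i mod m) then (Centre, j) else (s, j))"

definition star_tiles :: "nat \<Rightarrow> star_tile set" where
  "star_tiles m = insert Centre (Outer ` {..<m})"

definition star :: "nat \<Rightarrow> gon_comp \<Rightarrow> (star_tile \<times> nat, star_tile \<times> nat, star_tile) gon_presheaf" where
  "star m c =
     \<lparr>verts = {star_corner m j s | j s. j < m \<and> s \<in> star_tiles m},
      edges = {star_side j s | j s. j < m \<and> s \<in> star_tiles m},
      tiles = star_tiles m,
      src = (\<lambda>(s, j). star_corner m (corner_index (c (Side j) Src)) s),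
      tgt = (\<lambda>(s, j). star_corner m (corner_index (c (Side j) Tgt)) s),
      side = star_side,
      corner = star_corner m\<rparr>"

lemma star_presheaf:
  assumes "mgon_category m c"
  shows "gon_presheaf m c (star m c)"
proof -
  have ci: "corner_index (c (Side j) Src) < m" "corner_index (c (Side j) Tgt) < m" if "j < m" for j
    using mgon_ends[OF assms that] that by (auto simp: corner_index_def)
  show ?thesis
    unfolding presheaf_iff[OF assms]
  proof (intro conjI ballI allI impI)
    have ed: "s \<in> star_tiles m \<and> j < m" if "(s, j) \<in> edges (star m c)" for s j
      using that by (auto simp: star_def star_side_def star_tiles_def split: if_splits)
    have vt: "star_corner m (corner_index (c (Side j) Src)) s \<in> verts (star m c)"
      "star_corner m (corner_index (c (Side j) Tgt)) s \<in> verts (star m c)"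
      if "s \<in> star_tiles m \<and> j < m" for s j
      using that ci[of j] unfolding star_def by auto
    show "src (star m c) ` edges (star m c) \<subseteq> verts (star m c)"
      "tgt (star m c) ` edges (star m c) \<subseteq> verts (star m c)"
    proof -
      have "src (star m c) e \<in> verts (star m c) \<and> tgt (star m c) e \<in> verts (star m c)"
        if "e \<in> edges (star m c)" for e
      proof (cases e)
        case (Pair s j)
        then show ?thesis
          using vt[OF ed[of s j]] that by (simp add: star_def)
      qed
      then show "src (star m c) ` edges (star m c) \<subseteq> verts (star m c)"
        "tgt (star m c) ` edges (star m c) \<subseteq> verts (star m c)"
        by blast+
    qed
    fix i assume i: "i < m"
    show "side (star m c) i ` tiles (star m c) \<subseteq> edges (star m c)"
      "corner (star m c) i ` tiles (star m c) \<subseteq> verts (star m c)"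
      using i by (auto simp: star_def)
    fix s assume "s \<in> tiles (star m c)"
    show "src (star m c) (side (star m c) i s) =
        corner (star m c) (corner_index (c (Side i) Src)) s"
      "tgt (star m c) (side (star m c) i s) =
        corner (star m c) (corner_index (c (Side i) Tgt)) s"
      using mgon_ends[OF assms i] by (auto simp: star_def star_side_def star_corner_def corner_index_def)
  qed
qed

text \<open>The map from the star to \<open>P\<close> with prescribed values on tiles; it is a map of presheaves
  if \<open>side P i (h (Outer i)) = side P i (h Centre)\<close> for all \<open>i\<close>.\<close>

definition star_map ::
  "nat \<Rightarrow> gon_comp \<Rightarrow> ('v, 'e, 't) gon_presheaf \<Rightarrow> (star_tile \<Rightarrow> 't) \<Rightarrow>
   (star_tile \<times> nat, star_tile \<times> nat, star_tile, 'v, 'e, 't) gon_map" where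
  "star_map m c P h =
     (\<lambda>(s, j) \<in> verts (star m c). corner P j (h s),
      \<lambda>(s, j) \<in> edges (star m c). side P j (h s),
      \<lambda>s \<in> tiles (star m c). h s)"

type_synonym star_dir_map =
  "(star_tile \<times> nat, star_tile \<times> nat, star_tile, unit, int, int list) gon_map"

definition reflection_scheme ::
  "nat \<Rightarrow> nat \<Rightarrow> gon_comp \<Rightarrow> gon_comp \<Rightarrow> (nat \<times> bool) set \<Rightarrow> star_dir_map \<Rightarrow> bool" where
  "reflection_scheme m n c c' \<Gamma> \<phi> \<longleftrightarrow>
     n > 0 \<and> 4 dvd n \<and> \<phi> \<in> gon_maps m (star m c) (Lam_sub m c' \<Gamma>) \<and>
     on_tiles \<phi> Centre = replicate m 1"


section \<open>Generated edge-reversals\<close>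

text \<open>The description is proper if \<open>T\<close> tiles a surface without boundary: every edge then lies on
  exactly two tiles.\<close>

definition tile_across :: "nat \<Rightarrow> ('v, 'e, 't) gon_presheaf \<Rightarrow> nat \<Rightarrow> 't \<Rightarrow> 't" where
  "tile_across m T i x =
     (THE y. y \<in> tiles T \<and> y \<noteq> x \<and> side T i x \<in> (\<lambda>j. side T j y) ` {..<m})"

definition tile_star ::
  "nat \<Rightarrow> gon_comp \<Rightarrow> ('v, 'e, 't) gon_presheaf \<Rightarrow> 't \<Rightarrow>
   (star_tile \<times> nat, star_tile \<times> nat, star_tile, 'v, 'e, 't) gon_map" where
  "tile_star m c T x =
     star_map m c T (\<lambda>s. case s of Centre \<Rightarrow> x | Outer i \<Rightarrow> tile_across m T i x)"

definition const_star :: "nat \<Rightarrow> gon_comp \<Rightarrow> int list \<Rightarrow> star_dir_map" where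
  "const_star m c \<delta> = star_map m c (Lam m) (\<lambda>_. \<delta>)"

definition generated ::
  "nat \<Rightarrow> gon_comp \<Rightarrow> ('v, 'e, 't) gon_presheaf \<Rightarrow> star_dir_map \<Rightarrow>
   ('v, 'e, 't, unit, int, int list) gon_map \<Rightarrow> bool" where
  "generated m c T \<phi> \<tau> \<longleftrightarrow>
     (\<forall>x \<in> tiles T. gon_map_comp (star m c) \<tau> (tile_star m c T x) =
        dir_map_mult (star m c) \<phi> (const_star m c (on_tiles \<tau> x)))"

lemma gon_maps_dir_side:
  assumes "\<tau> \<in> gon_maps m P (dir_presheaf A)" "x \<in> tiles P" "i < m"
  shows "on_edges \<tau> (side P i x) = on_tiles \<tau> x ! i" "on_tiles \<tau> x \<in> A"
proof -
  have "map_cell (on_verts \<tau>) (on_edges \<tau>) (on_tiles \<tau>) (restr P (Side i) (TCell x)) =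
        restr (dir_presheaf A) (Side i) (map_cell (on_verts \<tau>) (on_edges \<tau>) (on_tiles \<tau>) (TCell x))"
    using assms unfolding gon_maps_def all_gon_ob by (auto simp: ghom_simps)
  then show "on_edges \<tau> (side P i x) = on_tiles \<tau> x ! i" by (simp add: dir_presheaf_def)
  show "on_tiles \<tau> x \<in> A" using assms by (auto simp: gon_maps_def dir_presheaf_def)
qed

lemma generated_iff:
  assumes "mgon_category m c" "gon_presheaf m c T"
    and "\<tau> \<in> gon_maps m T (dir_presheaf A)" "A \<subseteq> sign_tuples m"
    and "\<phi> \<in> gon_maps m (star m c) (dir_presheaf B)" "B \<subseteq> sign_tuples m"
    and "on_tiles \<phi> Centre = replicate m 1"
    and "\<And>x i. x \<in> tiles T \<Longrightarrow> i < m \<Longrightarrow> tile_across m T i x \<in> tiles T"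
  shows "generated m c T \<phi> \<tau> \<longleftrightarrow> (\<forall>x \<in> tiles T. \<forall>i<m.
    on_tiles \<tau> (tile_across m T i x) = tuple_mult (on_tiles \<phi> (Outer i)) (on_tiles \<tau> x))"
    (is "_ \<longleftrightarrow> ?R")
proof
  assume L: "generated m c T \<phi> \<tau>"
  show ?R
  proof (intro ballI allI impI)
    fix x i assume "x \<in> tiles T" "i < m"
    then have "on_tiles (gon_map_comp (star m c) \<tau> (tile_star m c T x)) (Outer i) =
      on_tiles (dir_map_mult (star m c) \<phi> (const_star m c (on_tiles \<tau> x))) (Outer i)"
      using L by (simp add: generated_def)
    then show "on_tiles \<tau> (tile_across m T i x) = tuple_mult (on_tiles \<phi> (Outer i)) (on_tiles \<tau> x)"
      using \<open>i < m\<close> by (simp add: gon_map_comp_def dir_map_mult_def tile_star_def const_star_def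
         star_map_def compose_def star_def star_tiles_def)
  qed
next
  assume R: ?R
  show "generated m c T \<phi> \<tau>"
    unfolding generated_def
  proof
    fix x assume x: "x \<in> tiles T"
    define h where "h = (\<lambda>s. case s of Centre \<Rightarrow> x | Outer i \<Rightarrow> tile_across m T i x)"
    have h: "h s \<in> tiles T" if "s \<in> star_tiles m" for s
      using that assms(8) x by (auto simp: h_def star_tiles_def)
    have len: "length (on_tiles \<tau> y) = m" if "y \<in> tiles T" for y
      using assms(3,4) that by (force simp: gon_maps_def dir_presheaf_def sign_tuples_def)
    have len': "length (on_tiles \<phi> s) = m" if "s \<in> star_tiles m" for s
      using assms(5,6) that by (force simp: gon_maps_def dir_presheaf_def sign_tuples_def star_def)
    have t: "on_tiles \<tau> (h s) = tuple_mult (on_tiles \<phi> s) (on_tiles \<tau> x)" if "s \<in> star_tiles m" for s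
      using that R x len[OF x] by (auto simp: h_def star_tiles_def assms(7) tuple_mult_def intro!: nth_equalityI)
    have e: "on_edges \<tau> (side T j (h s)) = on_edges \<phi> (s, j) * on_tiles \<tau> x ! j"
      if "(s, j) \<in> edges (star m c)" for s j
    proof -
      have *: "s \<in> star_tiles m" "j < m" "star_side j s = (s, j)"
        using that by (auto simp: star_def star_side_def star_tiles_def split: if_splits)
      have "on_edges \<phi> (s, j) = on_tiles \<phi> s ! j"
        using gon_maps_dir_side(1)[OF assms(5), of s j] * by (simp add: star_def)
      moreover have "on_edges \<tau> (side T j (h s)) = on_tiles \<tau> (h s) ! j"
        using gon_maps_dir_side(1)[OF assms(3) h] * by simp
      ultimately show ?thesis
        using t * len' len[OF x] by (simp add: tuple_mult_def)
    qed
    show "gon_map_comp (star m c) \<tau> (tile_star m c T x) =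
        dir_map_mult (star m c) \<phi> (const_star m c (on_tiles \<tau> x))"
      using t e
      by (auto simp: gon_map_comp_def dir_map_mult_def tile_star_def const_star_def
         star_map_def compose_def Lam_def dir_presheaf_def h_def[symmetric]
         restrict_def star_def fun_eq_iff)
  qed
qed

end

theory Submission
  imports Defs
begin

text \<open>Crossing the \<open>i\<close>-th side multiplies \<open>\<tau>\<close> by \<open>\<phi>(s\<^sub>i)\<close>, so \<open>\<tau>\<close> is determined by its value at one tile, because any
  two tiles are joined by a chain of adjacent ones. For existence one has to exclude monodromy. At a vertex,
  reflectivity makes the tiles around it cross the same two sides \<open>l\<close>, \<open>p\<close> alternately, \<open>n / 2\<close> times each; as
  \<open>n / 2\<close> is even and signs square to 1, the local monodromy is trivial. Globally the space is a plane, or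
  a sphere which becomes a plane on removing a vertex, and there local solutions
  glue over rectangles. That the tiling is a surface at the combinatorial level (every edge lies on exactly two
  tiles, the tiles at a vertex form a single cycle) comes from invariance of domain and from the
  connectedness of punctured discs. Reversal-closedness of \<open>\<Gamma>\<close> keeps the values in the required coset.\<close>

text \<open>The condition on \<open>\<tau>\<close> decouples. For fixed \<open>l\<close> the
  \<open>l\<close>-th entries form a function \<open>g\<close> from tiles to signs with
  \<open>g y = \<kappa> i * g x\<close> whenever side \<open>i\<close> separates \<open>x\<close>
  and \<open>y\<close>, where \<open>\<kappa> i\<close> is the \<open>l\<close>-th entry of
  \<open>\<phi>(s_i)\<close>. So the topological part deals with one sign per side index, and
  \<open>\<phi>\<close> enters only at the end, where \<open>m\<close> such functions are assembled.
  Their values on edges are consistent because the \<open>i\<close>-th entry of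
  \<open>\<phi>(s_i)\<close> is 1: crossing side \<open>i\<close> leaves entry \<open>i\<close>
  unchanged. No homotopy of paths is used. A solution assigns to each point of the plane signs of
  the tiles through it. Such a solution is rigid over connected sets, so two of them over closed
  sets with connected overlap can be matched by one global sign. The sphere is punctured at a vertex
  so that every edge keeps its midpoint and each tile loses at most a corner, hence stays connected;
  at the missing vertex no local solution is required.\<close>

section \<open>Gluing local sign functions in the plane\<close>

text \<open>The plane carries a tiling: \<open>At w\<close> stands for the set of tiles containing \<open>w\<close>, and \<open>adj w\<close> for
  adjacency across an edge through \<open>w\<close>.\<close>

locale plane_links =
  fixes At :: "complex \<Rightarrow> 't set" and adj :: "complex \<Rightarrow> 't \<Rightarrow> 't \<Rightarrow> bool"
  assumes At_nonempty: "At w \<noteq> {}"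
    and upper: "\<exists>N. open N \<and> w \<in> N \<and> (\<forall>u\<in>N. At u \<subseteq> At w \<and> (\<forall>x y. adj u x y \<longrightarrow> adj w x y))"
    and link: "A \<subseteq> At w \<Longrightarrow> A \<noteq> {} \<Longrightarrow> (\<And>x y. x \<in> A \<Longrightarrow> adj w x y \<Longrightarrow> y \<in> A) \<Longrightarrow> A = At w"
    and adj_At: "adj w x y \<Longrightarrow> x \<in> At w \<and> y \<in> At w"
begin

text \<open>Values of \<open>F w\<close> count only on \<open>At w\<close>, so nearby points are
  compared on their common tiles.\<close>

definition locally_const :: "complex set \<Rightarrow> (complex \<Rightarrow> 't \<Rightarrow> 'a) \<Rightarrow> bool" where
  "locally_const R F \<longleftrightarrow>
     (\<forall>w\<in>R. \<exists>N. open N \<and> w \<in> N \<and> (\<forall>u \<in> N \<inter> R. \<forall>x \<in> At u \<inter> At w. F u x = F w x))"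

text \<open>At one point \<open>link\<close> spreads \<open>Q\<close> from a tile to all tiles. Near
  \<open>a\<close> every \<open>At u\<close> is a nonempty part of \<open>At a\<close>, so a common
  tile carries \<open>Q\<close> from \<open>u\<close> to \<open>a\<close> and back; connectedness of
  \<open>R\<close> does the rest.\<close>

lemma all_tiles_if_one:
  assumes "connected R" "locally_const R Q"
    and adj: "\<And>w x y. w \<in> R \<Longrightarrow> adj w x y \<Longrightarrow> Q w x \<Longrightarrow> Q w y"
    and w0: "w0 \<in> R" "x0 \<in> At w0" "Q w0 x0"
    and w: "w \<in> R" "x \<in> At w"
  shows "Q w x"
proof -
  have all: "\<forall>y\<in>At w. Q w y" if "w \<in> R" "x \<in> At w" "Q w x" for w x
  proof -
    have "{y \<in> At w. Q w y} = At w"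
      using that adj adj_At by (intro link) blast+
    then show ?thesis by blast
  qed
  have "\<forall>y\<in>At w. Q w y"
  proof (rule connected_induction_simple[OF assms(1), where P = "\<lambda>w. \<forall>y\<in>At w. Q w y"])
    fix a assume a: "a \<in> R"
    obtain N1 where N1: "open N1" "a \<in> N1" "\<forall>u\<in>N1. At u \<subseteq> At a"
      using upper[of a] by blast
    obtain N2 where N2: "open N2" "a \<in> N2" "\<forall>u \<in> N2 \<inter> R. \<forall>x \<in> At u \<inter> At a. Q u x = Q a x"
      using assms(2) a unfolding locally_const_def by blast
    have *: "(\<forall>y\<in>At u. Q u y) \<longleftrightarrow> (\<forall>y\<in>At a. Q a y)" if u: "u \<in> R \<inter> (N1 \<inter> N2)" for u
    proof -
      obtain z where z: "z \<in> At u" using At_nonempty by blast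
      then have "Q u z = Q a z" "z \<in> At a" using u N1 N2 by blast+
      then show ?thesis using all[of u z] all[of a z] z u a by blast
    qed
    have "openin (top_of_set R) (R \<inter> (N1 \<inter> N2))" "a \<in> R \<inter> (N1 \<inter> N2)"
      using N1 N2 a by (auto intro: openin_open_Int)
    moreover have "\<forall>y\<in>At v. Q v y"
      if "u \<in> R \<inter> (N1 \<inter> N2)" "v \<in> R \<inter> (N1 \<inter> N2)" "\<forall>y\<in>At u. Q u y" for u v
      by (rule iffD2[OF *[OF that(2)] iffD1[OF *[OF that(1)] that(3)]])
    ultimately show "\<exists>T. openin (top_of_set R) T \<and> a \<in> T \<and>
        (\<forall>x\<in>T. \<forall>y\<in>T. (\<forall>z\<in>At x. Q x z) \<longrightarrow> (\<forall>z\<in>At y. Q y z))"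
      by (intro exI[of _ "R \<inter> (N1 \<inter> N2)"] conjI ballI impI) fast+
  next
    show "\<forall>y\<in>At w0. Q w0 y" by (rule all[OF w0])
  qed (use w0 w in auto)
  then show ?thesis using w by blast
qed

text \<open>Local solutions of the sign equation, in effect sections of a double covering. Asking
  for signs everywhere, even off \<open>At w\<close>, spares side conditions when signs are
  multiplied.\<close>

definition section_on :: "('t \<Rightarrow> 't \<Rightarrow> int) \<Rightarrow> complex set \<Rightarrow> (complex \<Rightarrow> 't \<Rightarrow> int) \<Rightarrow> bool" where
  "section_on s R F \<longleftrightarrow> locally_const R F \<and> (\<forall>w x. F w x \<in> {1, -1}) \<and>
     (\<forall>w\<in>R. \<forall>x y. adj w x y \<longrightarrow> F w y = s x y * F w x)"

lemma section_on_subset: "section_on s R F \<Longrightarrow> R' \<subseteq> R \<Longrightarrow> section_on s R' F"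
  unfolding section_on_def locally_const_def by (meson Int_iff subsetD)

lemma section_on_flip:
  assumes "section_on s R F" "e \<in> {1, -1}"
  shows "section_on s R (\<lambda>w x. e * F w x)"
  unfolding section_on_def
proof (intro conjI allI ballI impI)
  have "F w x \<in> {1, -1}" for w x using assms by (simp add: section_on_def)
  then show "e * F w x \<in> {1, -1}" for w x using assms(2) by fastforce
  have "locally_const R F" using assms by (simp add: section_on_def)
  then show "locally_const R (\<lambda>w x. e * F w x)"
    unfolding locally_const_def by metis
  show "e * F w y = s x y * (e * F w x)" if "w \<in> R" "adj w x y" for w x y
    using assms that by (simp add: section_on_def)
qed

text \<open>Agreement is preserved by crossing, since both solutions are multiplied by the same
  \<open>s x y\<close>.\<close>

lemma section_on_unique:
  assumes "connected R" "section_on s R F" "section_on s R F'"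
    and "w0 \<in> R" "x0 \<in> At w0" "F w0 x0 = F' w0 x0" "w \<in> R" "x \<in> At w"
  shows "F w x = F' w x"
proof (rule all_tiles_if_one[OF assms(1), where Q = "\<lambda>w x. F w x = F' w x"])
  show "locally_const R (\<lambda>w x. F w x = F' w x)"
    unfolding locally_const_def
  proof
    fix w assume w: "w \<in> R"
    obtain N1 where N1: "open N1" "w \<in> N1" "\<forall>u \<in> N1 \<inter> R. \<forall>x \<in> At u \<inter> At w. F u x = F w x"
      using assms(2) w unfolding section_on_def locally_const_def by blast
    obtain N2 where N2: "open N2" "w \<in> N2" "\<forall>u \<in> N2 \<inter> R. \<forall>x \<in> At u \<inter> At w. F' u x = F' w x"
      using assms(3) w unfolding section_on_def locally_const_def by blast
    show "\<exists>N. open N \<and> w \<in> N \<and>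
        (\<forall>u\<in>N \<inter> R. \<forall>x\<in>At u \<inter> At w. (F u x = F' u x) = (F w x = F' w x))"
      using N1 N2 by (intro exI[of _ "N1 \<inter> N2"]) auto
  qed
qed (use assms in \<open>auto simp: section_on_def\<close>)

text \<open>By uniqueness two solutions over a connected overlap differ by one global sign, which is
  removed before pasting. Closedness of both sets keeps the pasted function locally
  constant.\<close>

lemma section_on_Un:
  assumes R: "closed R1" "closed R2" "connected (R1 \<inter> R2)" "R1 \<inter> R2 \<noteq> {}"
    and F1: "section_on s R1 F1" and F2: "section_on s R2 F2"
  shows "\<exists>F. section_on s (R1 \<union> R2) F"
proof -
  obtain w0 x0 where w0: "w0 \<in> R1 \<inter> R2" "x0 \<in> At w0" using R At_nonempty by blast
  \<comment> \<open>Signs are their own inverses, so this product is the factor turning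
    \<open>F2\<close> into \<open>F1\<close> at \<open>w0\<close>.\<close>
  define e where "e = F1 w0 x0 * F2 w0 x0"
  have pm: "F1 w x \<in> {1,-1}" "F2 w x \<in> {1,-1}" for w x
    using F1 F2 by (auto simp: section_on_def)
  have e: "e \<in> {1,-1}" "e * F2 w0 x0 = F1 w0 x0"
    using pm[of w0 x0] by (auto simp: e_def)
  define G where "G w x = e * F2 w x" for w x
  have G: "section_on s R2 G"
    unfolding G_def using section_on_flip[OF F2 e(1)] .
  have eq: "F1 w x = G w x" if "w \<in> R1 \<inter> R2" "x \<in> At w" for w x
    using section_on_unique[OF R(3) section_on_subset[OF F1 Int_lower1]
        section_on_subset[OF G Int_lower2] w0 _ that] e by (simp add: G_def)
  define F where "F w x = (if w \<in> R1 then F1 w x else G w x)" for w x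
  have FG: "F w x = G w x" if "w \<in> R2" "x \<in> At w" for w x
    using eq that by (auto simp: F_def)
  have "section_on s (R1 \<union> R2) F"
    unfolding section_on_def
  proof (intro conjI allI ballI impI)
    show "F w x \<in> {1,-1}" for w x
      using pm[of w x] G by (auto simp: F_def section_on_def)
    show "F w y = s x y * F w x" if "w \<in> R1 \<union> R2" "adj w x y" for w x y
      using that F1 G FG[of w] adj_At[of w x y] by (cases "w \<in> R1") (auto simp: F_def section_on_def)
    show "locally_const (R1 \<union> R2) F"
      unfolding locally_const_def
    proof
      fix w assume w: "w \<in> R1 \<union> R2"
      have 1: "\<exists>N. open N \<and> w \<in> N \<and> (\<forall>u \<in> N \<inter> R1. \<forall>x \<in> At u \<inter> At w. F u x = F w x)"
      proof (cases "w \<in> R1")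
        case True
        then show ?thesis
          using F1 by (auto simp: section_on_def locally_const_def F_def)
      next
        case False
        \<comment> \<open>The complement of the closed set \<open>R1\<close> is a neighbourhood of
          \<open>w\<close> on which the claim is vacuous.\<close>
        then show ?thesis using R(1) by (intro exI[of _ "-R1"]) auto
      qed
      have 2: "\<exists>N. open N \<and> w \<in> N \<and> (\<forall>u \<in> N \<inter> R2. \<forall>x \<in> At u \<inter> At w. F u x = F w x)"
      proof (cases "w \<in> R2")
        case True
        then obtain N where N: "open N" "w \<in> N" "\<forall>u \<in> N \<inter> R2. \<forall>x \<in> At u \<inter> At w. G u x = G w x"
          using G unfolding section_on_def locally_const_def by blast
        have "F u x = F w x" if "u \<in> N \<inter> R2" "x \<in> At u \<inter> At w" for u x
          using N(3) that FG[of u x] FG[of w x] True by simp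
        with N show ?thesis by blast
      next
        case False
        then show ?thesis using R(2) by (intro exI[of _ "-R2"]) auto
      qed
      from 1 2 obtain N1 N2 where "open N1" "w \<in> N1" "\<forall>u \<in> N1 \<inter> R1. \<forall>x \<in> At u \<inter> At w. F u x = F w x"
        "open N2" "w \<in> N2" "\<forall>u \<in> N2 \<inter> R2. \<forall>x \<in> At u \<inter> At w. F u x = F w x" by blast
      then show "\<exists>N. open N \<and> w \<in> N \<and> (\<forall>u \<in> N \<inter> (R1 \<union> R2). \<forall>x \<in> At u \<inter> At w. F u x = F w x)"
        by (intro exI[of _ "N1 \<inter> N2"]) auto
    qed
  qed
  then show ?thesis by blast
qed

end

section \<open>Rectangles and the whole plane\<close>

definition rect :: "real \<Rightarrow> real \<Rightarrow> real \<Rightarrow> real \<Rightarrow> complex set" where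
  "rect a b c d = cbox (Complex a c) (Complex b d)"

lemma in_rect: "w \<in> rect a b c d \<longleftrightarrow> a \<le> Re w \<and> Re w \<le> b \<and> c \<le> Im w \<and> Im w \<le> d"
  by (auto simp: rect_def in_cbox_complex_iff)

lemma rect_closed_connected: "closed (rect a b c d)" "connected (rect a b c d)"
  by (auto simp: rect_def convex_connected convex_box)

context plane_links begin

text \<open>Bisection in each coordinate takes the place of a compactness argument. Rectangles are
  pasted along a common side, which is connected, so no monodromy can appear.\<close>

lemma section_on_rect:
  assumes loc: "\<And>w. \<exists>g. (\<forall>x. g x \<in> {1, -1}) \<and> (\<forall>x y. adj w x y \<longrightarrow> g y = s x y * g x)"
    and "a \<le> b" "c \<le> d"
  shows "\<exists>F. section_on s (rect a b c d) F"
proof -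
  have local: "\<exists>N F. open N \<and> w \<in> N \<and> section_on s N F" for w
  proof -
    obtain N where N: "open N" "w \<in> N" "\<forall>u\<in>N. \<forall>x y. adj u x y \<longrightarrow> adj w x y"
      using upper[of w] by blast
    obtain g where "\<forall>x. g x \<in> {1, -1}" "\<forall>x y. adj w x y \<longrightarrow> g y = s x y * g x"
      using loc by blast
    then have "section_on s N (\<lambda>_. g)"
      using N by (auto simp: section_on_def locally_const_def)
    with N show ?thesis by blast
  qed
  \<comment> \<open>Bisecting the height shows that one width \<open>\<delta>\<close> around the
    abscissa \<open>t\<close> works for the full height; afterwards the width is bisected.\<close>
  have strip: "\<exists>\<delta>>0. \<forall>a b. a \<le> t \<and> t \<le> b \<and> b - a < \<delta> \<longrightarrow> (\<exists>F. section_on s (rect a b c d) F)" for t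
    using \<open>c \<le> d\<close>
  proof (induction c d rule: Bolzano)
    case (trans p q r)
    then obtain d1 d2 where d: "d1 > 0" "d2 > 0"
      "\<And>a b. a \<le> t \<and> t \<le> b \<and> b - a < d1 \<Longrightarrow> \<exists>F. section_on s (rect a b p q) F"
      "\<And>a b. a \<le> t \<and> t \<le> b \<and> b - a < d2 \<Longrightarrow> \<exists>F. section_on s (rect a b q r) F" by metis
    show ?case
    proof (intro exI[of _ "min d1 d2"] conjI allI impI)
      fix a b assume ab: "a \<le> t \<and> t \<le> b \<and> b - a < min d1 d2"
      have "rect a b p q \<union> rect a b q r = rect a b p r" "rect a b p q \<inter> rect a b q r = rect a b q q"
        using trans by (auto simp: in_rect set_eq_iff)
      moreover have "Complex t q \<in> rect a b q q" using ab by (simp add: in_rect)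
      ultimately show "\<exists>F. section_on s (rect a b p r) F"
        using section_on_Un[of "rect a b p q" "rect a b q r" s] d(3)[of a b] d(4)[of a b] ab
          rect_closed_connected by (metis empty_iff min_less_iff_conj)
    qed (use d in auto)
  next
    case (local r)
    obtain N F where N: "open N" "Complex t r \<in> N" "section_on s N F"
      using \<open>\<And>w. \<exists>N F. open N \<and> w \<in> N \<and> section_on s N F\<close> by blast
    obtain e where e: "e > 0" "ball (Complex t r) e \<subseteq> N"
      using N open_contains_ball by blast
    \<comment> \<open>Half of \<open>e\<close> for each side, because the distance is bounded by the
      sum of the two coordinate differences.\<close>
    have sub: "rect a b p q \<subseteq> N"
      if "a \<le> t" "t \<le> b" "b - a < e/2" "p \<le> r" "r \<le> q" "q - p < e/2" for a b p q
    proof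
      fix w assume w: "w \<in> rect a b p q"
      have "cmod (Complex t r - w) \<le> \<bar>t - Re w\<bar> + \<bar>r - Im w\<bar>"
        using cmod_le[of "Complex t r - w"] by simp
      also have "\<dots> < e" using w that by (auto simp: in_rect abs_if)
      finally show "w \<in> N" using e by (auto simp: dist_norm)
    qed
    have "\<exists>\<delta>>0. \<forall>a b. a \<le> t \<and> t \<le> b \<and> b - a < \<delta> \<longrightarrow> (\<exists>F. section_on s (rect a b p q) F)"
      if pq: "p \<le> r" "r \<le> q" "q - p < e/2" for p q
    proof -
      have "\<exists>F. section_on s (rect a b p q) F" if "a \<le> t \<and> t \<le> b \<and> b - a < e/2" for a b
        using sub[of a b p q] section_on_subset[OF N(3)] that pq by blast
      then show ?thesis using e by (intro exI[of _ "e/2"]) auto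
    qed
    then show ?case using half_gt_zero[OF e(1)] by blast
  qed
  show ?thesis
    using \<open>a \<le> b\<close>
  proof (induction a b rule: Bolzano)
    case (trans p q r)
    have "rect p q c d \<union> rect q r c d = rect p r c d" "rect p q c d \<inter> rect q r c d = rect q q c d"
      using trans by (auto simp: in_rect set_eq_iff)
    moreover have "Complex q c \<in> rect q q c d" using \<open>c \<le> d\<close> by (simp add: in_rect)
    ultimately show ?case
      using section_on_Un[of "rect p q c d" "rect q r c d" s] trans
          rect_closed_connected by (metis empty_iff)
  next
    case (local t)
    then show ?case using strip by blast
  qed
qed

text \<open>Solutions normalised to 1 at \<open>x0\<close> on growing squares around
  \<open>w0\<close> agree by uniqueness and exhaust the plane. The hypothesis \<open>conn\<close>
  then removes the dependence on the point, leaving a function of tiles alone.\<close>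

lemma exists_sign_function:
  assumes loc: "\<And>w. \<exists>g. (\<forall>x. g x \<in> {1, -1}) \<and> (\<forall>x y. adj w x y \<longrightarrow> g y = s x y * g x)"
    and conn: "\<And>x. connected {w. x \<in> At w}"
    and "x0 \<in> At w0"
  shows "\<exists>g :: 't \<Rightarrow> int. (\<forall>x. g x \<in> {1, -1}) \<and> (\<forall>w x y. adj w x y \<longrightarrow> g y = s x y * g x) \<and> g x0 = 1"
proof -
  define R where "R k = rect (Re w0 - real k) (Re w0 + real k) (Im w0 - real k) (Im w0 + real k)" for k
  have R0: "w0 \<in> R k" for k by (simp add: R_def in_rect)
  have Rmono: "R k \<subseteq> R l" if "k \<le> l" for k l
    using that by (auto simp: R_def in_rect)
  have Rconn: "connected (R k)" for k by (simp add: R_def rect_closed_connected)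
  have Rint: "\<exists>k. cball w e \<subseteq> R k" for w e
  proof -
    obtain k where k: "real k \<ge> cmod (w - w0) + e" using real_arch_simple by blast
    have "v \<in> R k" if "v \<in> cball w e" for v
    proof -
      have "cmod (v - w0) \<le> real k"
        using norm_triangle_ineq[of "v - w" "w - w0"] that k by (simp add: dist_norm norm_minus_commute)
      then show ?thesis
        using abs_Re_le_cmod[of "v - w0"] abs_Im_le_cmod[of "v - w0"] by (auto simp: R_def in_rect abs_if split: if_splits)
    qed
    then show ?thesis by blast
  qed
  have "\<exists>F. section_on s (R k) F \<and> F w0 x0 = 1" for k
  proof -
    have "Re w0 - real k \<le> Re w0 + real k" "Im w0 - real k \<le> Im w0 + real k" by auto
    then obtain F where F: "section_on s (R k) F"
      using section_on_rect[OF loc] unfolding R_def by blast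
    then have "F w0 x0 \<in> {1,-1}" by (simp add: section_on_def)
    then show ?thesis
      using section_on_flip[OF F, of "F w0 x0"] by (intro exI[of _ "\<lambda>w x. F w0 x0 * F w x"]) auto
  qed
  then obtain F where F: "\<And>k. section_on s (R k) (F k)" "\<And>k. F k w0 x0 = 1" by metis
  have agree: "F k w x = F l w x" if "w \<in> R k" "w \<in> R l" "x \<in> At w" for k l w x
  proof -
    have "F k w x = F l w x" if "k \<le> l" "w \<in> R k" "w \<in> R l" "x \<in> At w" for k l
      using section_on_unique[OF Rconn F(1) section_on_subset[OF F(1) Rmono[OF that(1)]] R0 \<open>x0 \<in> At w0\<close>
        _ that(2,4)] F(2) by simp
    then show ?thesis using that by (metis nle_le)
  qed
  define K where "K w = (SOME k. w \<in> R k)" for w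
  have K: "w \<in> R (K w)" for w
    unfolding K_def using Rint[of w 0] by (intro someI_ex[of "\<lambda>k. w \<in> R k"]) auto
  define G where "G w = F (K w) w" for w
  have GF: "G w x = F k w x" if "w \<in> R k" "x \<in> At w" for k w x
    using agree[OF K that] by (simp add: G_def)
  have lc: "locally_const UNIV G"
    unfolding locally_const_def
  proof
    fix w
    obtain k where k: "cball w 1 \<subseteq> R k" using Rint by blast
    then have wk: "w \<in> R k" by auto
    then obtain N where N: "open N" "w \<in> N" "\<forall>u \<in> N \<inter> R k. \<forall>x \<in> At u \<inter> At w. F k u x = F k w x"
      using F(1)[of k] unfolding section_on_def locally_const_def by blast
    show "\<exists>N. open N \<and> w \<in> N \<and> (\<forall>u\<in>N \<inter> UNIV. \<forall>x\<in>At u \<inter> At w. G u x = G w x)"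
    proof (intro exI[of _ "N \<inter> ball w 1"] conjI ballI)
      fix u x assume u: "u \<in> N \<inter> ball w 1 \<inter> UNIV" and x: "x \<in> At u \<inter> At w"
      have "u \<in> cball w 1" using u by auto
      then have "u \<in> R k" using k by blast
      then show "G u x = G w x" using GF wk u x N(3) by auto
    qed (use N in auto)
  qed
  have const: "G u x = G w x" if "x \<in> At u" "x \<in> At w" for u w x
  proof (rule connected_induction_simple[OF conn[of x], where a=w and b=u and P = "\<lambda>u. G u x = G w x"])
    fix a assume a: "a \<in> {w. x \<in> At w}"
    obtain N where N: "open N" "a \<in> N" "\<forall>u \<in> N. \<forall>x \<in> At u \<inter> At a. G u x = G a x"
      using lc unfolding locally_const_def by auto
    have "G y x = G a x" if "y \<in> {w. x \<in> At w} \<inter> N" for y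
      using N(3) a that by blast
    moreover have "openin (top_of_set {w. x \<in> At w}) ({w. x \<in> At w} \<inter> N)"
      using N(1) by (simp add: openin_open_Int)
    ultimately show "\<exists>T. openin (top_of_set {w. x \<in> At w}) T \<and> a \<in> T \<and>
       (\<forall>y\<in>T. \<forall>z\<in>T. G y x = G w x \<longrightarrow> G z x = G w x)"
      using a N(2) by (metis IntI)
  qed (use that in auto)
  \<comment> \<open>Elements lying in no \<open>At w\<close> get the value 1, since \<open>g\<close>
    has to be a sign everywhere.\<close>
  define g where "g x = (if \<exists>w. x \<in> At w then G (SOME w. x \<in> At w) x else 1)" for x
  have g: "g x = G w x" if "x \<in> At w" for x w
  proof -
    have "x \<in> At (SOME w. x \<in> At w)" using that by (rule someI)
    then have "G (SOME w. x \<in> At w) x = G w x" using const that by blast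
    then show ?thesis using that by (auto simp: g_def)
  qed
  have pm: "F k w x \<in> {1,-1}" for k w x using F(1)[of k] by (auto simp: section_on_def)
  show ?thesis
  proof (intro exI[of _ g] conjI allI impI)
    show "g x \<in> {1,-1}" for x using pm by (auto simp: g_def G_def)
    show "g x0 = 1" using g[OF assms(3)] GF[OF R0 assms(3), of 0] F(2) by simp
    fix w x y assume a: "adj w x y"
    have "F (K w) w y = s x y * F (K w) w x"
      using F(1)[of "K w"] K[of w] a unfolding section_on_def by blast
    then show "g y = s x y * g x"
      using g[of x w] g[of y w] adj_At[OF a] by (simp add: G_def)
  qed
qed

end

section \<open>Signs around a vertex\<close>

text \<open>Since no reflection of the dihedral group generated by \<open>a\<close> and \<open>b\<close> has a fixed point, \<open>S\<close> consists of
  an orbit of \<open>a \<circ> b\<close> and its disjoint image under \<open>b\<close>, so this orbit has even length.\<close>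

lemma involutions_signs:
  fixes a b :: "'a \<Rightarrow> 'a" and A B :: int
  assumes fin: "finite S"
    and aS: "\<And>x. x \<in> S \<Longrightarrow> a x \<in> S" and bS: "\<And>x. x \<in> S \<Longrightarrow> b x \<in> S"
    and aa: "\<And>x. x \<in> S \<Longrightarrow> a (a x) = x" and bb: "\<And>x. x \<in> S \<Longrightarrow> b (b x) = x"
    and a_ne: "\<And>x. x \<in> S \<Longrightarrow> a x \<noteq> x" and b_ne: "\<And>x. x \<in> S \<Longrightarrow> b x \<noteq> x"
    and trans: "\<And>U. U \<subseteq> S \<Longrightarrow> U \<noteq> {} \<Longrightarrow> (\<And>x. x \<in> U \<Longrightarrow> a x \<in> U \<and> b x \<in> U) \<Longrightarrow> U = S"
    and "4 dvd card S" and AB: "A \<in> {1, -1}" "B \<in> {1, -1}"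
  shows "\<exists>g. (\<forall>x. g x \<in> {1, -1}) \<and> (\<forall>x\<in>S. g (a x) = A * g x \<and> g (b x) = B * g x)"
proof (cases "S = {}")
  case True
  then show ?thesis by auto
next
  case False
  then obtain x0 where x0: "x0 \<in> S" by blast
  define y where "y t = ((\<lambda>x. a (b x)) ^^ t) x0" for t
  have y0: "y 0 = x0" and yS: "y (Suc t) = a (b (y t))" for t by (auto simp: y_def)
  have y_in: "y t \<in> S" for t by (induction t) (auto simp: y0 yS x0 aS bS)
  have ab_inj: "u = v" if "a (b u) = a (b v)" "u \<in> S" "v \<in> S" for u v
    using that aa bb bS by metis
  have y_cancel: "y t = y 0" if "y (s + t) = y s" for s t
    using that
  proof (induction s)
    case (Suc s)
    then show ?case using ab_inj[OF _ y_in y_in, of "s + t" s] by (simp add: yS)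
  qed simp
  have "\<not> inj y"
    using finite_imageD[of y UNIV] finite_subset[OF _ fin, of "range y"] y_in by auto
  then obtain s t where "s < t" "y s = y t" unfolding inj_def by (metis linorder_neq_iff)
  then have "0 < t - s \<and> y (t - s) = y 0" using y_cancel[of s "t - s"] by simp
  then have ex: "\<exists>p>0. y p = y 0" by blast
  define p where "p = (LEAST p. 0 < p \<and> y p = y 0)"
  have p: "0 < p" "y p = y 0" using LeastI_ex[OF ex] by (auto simp: p_def)
  have p_min: "p \<le> t" if "0 < t" "y t = y 0" for t
    unfolding p_def using that by (intro Least_le) auto
  have yp: "y (t + p) = y t" for t
    by (induction t) (auto simp: yS p(2))
  have ypk: "y (t + p * k) = y t" for t k
  proof (induction k)
    case (Suc k)
    then show ?case using yp[of "t + p * k"] by (simp add: algebra_simps)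
  qed simp
  have y_mod: "y t = y (t mod p)" for t
    using ypk[of "t mod p" "t div p"] by simp
  have y_eq: "s = t" if "y s = y t" "s \<le> t" "t < p" for s t
    using y_cancel[of s "t - s"] p_min[of "t - s"] that by (cases "s = t") auto
  have y_eq_mod: "s mod p = t mod p" if "y s = y t" for s t
    using y_eq[of "s mod p" "t mod p"] y_eq[of "t mod p" "s mod p"] y_mod that p(1)
    by (metis mod_less_divisor nle_le)
  \<comment> \<open>Peeling one reflection off each end of \<open>b (y s) = y (s + d)\<close>
    shortens the distance \<open>d\<close> by 2. At \<open>d = 0\<close> the equation gives a fixed
    point of \<open>b\<close>, at \<open>d = 1\<close> one of \<open>a\<close>.\<close>
  have off: "b (y s) \<noteq> y (s + d)" for s d
  proof (induction d arbitrary: s rule: less_induct)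
    case (less d)
    show ?case
    proof
      assume eq: "b (y s) = y (s + d)"
      consider "d = 0" | "d = 1" | e where "d = Suc (Suc e)" by (metis One_nat_def old.nat.exhaust)
      then show False
      proof cases
        case 1
        then show ?thesis using eq b_ne y_in by simp
      next
        case 2
        then show ?thesis using eq a_ne[of "b (y s)"] bS y_in by (simp add: yS)
      next
        case 3
        then have "b (y s) = a (b (y (s + Suc e)))" using eq by (simp add: yS)
        then have "a (b (y s)) = b (y (s + Suc e))" using aa bS y_in by metis
        then have "b (y (Suc s)) = y (Suc s + e)" using bb y_in by (metis yS add_Suc_shift)
        then show ?thesis using less.IH[of e "Suc s"] 3 by simp
      qed
    qed
  qed
  have disj: "b (y s) \<noteq> y t" for s t
  proof -
    \<comment> \<open>\<open>off\<close> only treats indices from \<open>s\<close> onwards, so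
      \<open>t\<close> is first moved past \<open>s\<close> by whole periods.\<close>
    have "t + p * s = s + (t + p * s - s)" using p(1) by (simp add: trans_le_add2)
    then show ?thesis using off[of s "t + p * s - s"] ypk[of t s] by metis
  qed
  define U where "U = y ` {..<p} \<union> (\<lambda>t. b (y t)) ` {..<p}"
  have yU: "y t \<in> U" "b (y t) \<in> U" for t
    using p(1) y_mod[of t] by (auto simp: U_def intro!: image_eqI[of _ _ "t mod p"])
  \<comment> \<open>Morally \<open>a (y t) = b (y (t - 1))\<close>; adding \<open>p\<close> avoids
    truncated subtraction at \<open>t = 0\<close>.\<close>
  have a_y: "a (y t) = b (y (t + p - 1))" for t
  proof -
    have "y t = y (Suc (t + p - 1))" using yp[of t] p(1) by simp
    then show ?thesis using aa bS y_in yS by metis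
  qed
  have "U = S"
  proof (rule trans)
    show "U \<subseteq> S" using y_in bS by (auto simp: U_def)
    show "U \<noteq> {}" using yU by blast
    fix x assume "x \<in> U"
    then consider t where "x = y t" | t where "x = b (y t)" by (auto simp: U_def)
    then show "a x \<in> U \<and> b x \<in> U"
    proof cases
      case 1
      then show ?thesis using a_y yU by simp
    next
      case 2
      then show ?thesis using yU[of "Suc t"] yU[of t] bb[OF y_in, of t] by (simp add: yS)
    qed
  qed
  have inj1: "inj_on y {..<p}" using y_eq_mod by (intro inj_onI) (metis lessThan_iff mod_less)
  have inj2: "inj_on (\<lambda>t. b (y t)) {..<p}"
    using inj1 bb y_in by (intro inj_onI) (metis inj_onD)
  have "card U = p + p"
    unfolding U_def using disj disj[symmetric] by (subst card_Un_disjoint) (auto simp: card_image inj1 inj2)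
  then have "4 dvd p + p" using \<open>4 dvd card S\<close> \<open>U = S\<close> by simp
  \<comment> \<open>Two disjoint copies of the orbit have \<open>2 * p\<close> elements, so
    divisibility by 4 makes \<open>p\<close> even, and the parity of an index is well defined on the
    orbit.\<close>
  then have "even p" by presburger
  have par: "even s = even t" if "y s = y t" for s t
    using y_eq_mod[OF that] \<open>even p\<close> by (metis dvd_mod_iff)
  have AB2: "A * A = 1" "B * B = 1" using AB by auto
  have pow: "(A * B) ^ t = (if even t then 1 else A * B)" for t
    using AB2 by (induction t) (auto simp: algebra_simps)
  \<comment> \<open>One rotation multiplies by \<open>A * B\<close>, one application of
    \<open>b\<close> by \<open>B\<close>; the chosen index matters only through its parity.\<close>
  define g where "g x = (if \<exists>t. x = y t then (A * B) ^ (SOME t. x = y t)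
     else if \<exists>t. x = b (y t) then B * (A * B) ^ (SOME t. x = b (y t)) else 1)" for x
  have g1: "g (y t) = (A * B) ^ t" for t
  proof -
    have "y t = y (SOME s. y t = y s)" by (rule someI) (rule refl)
    then have "even (SOME s. y t = y s) = even t" by (metis par)
    then show ?thesis by (auto simp: g_def pow)
  qed
  have g2: "g (b (y t)) = B * (A * B) ^ t" for t
  proof -
    have "b (y t) = b (y (SOME s. b (y t) = b (y s)))" by (rule someI) (rule refl)
    then have "y t = y (SOME s. b (y t) = b (y s))" using bb y_in by metis
    then have "even (SOME s. b (y t) = b (y s)) = even t" by (metis par)
    moreover have "\<not> (\<exists>s. b (y t) = y s)" using disj by blast
    ultimately show ?thesis by (auto simp: g_def pow)
  qed
  show ?thesis
  proof (intro exI[of _ g] conjI allI ballI)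
    show "g x \<in> {1, -1}" for x using AB by (auto simp: g_def pow)
    fix x assume "x \<in> S"
    then consider t where "x = y t" | t where "x = b (y t)" using \<open>U = S\<close> by (auto simp: U_def)
    then show "g (a x) = A * g x" "g (b x) = B * g x"
    proof (atomize (full), cases)
      case 1
      have "even (t + p - 1) \<noteq> even t" using \<open>even p\<close> p(1) by (cases p) auto
      then show "g (a x) = A * g x \<and> g (b x) = B * g x"
        unfolding 1 a_y g1 g2 using AB2 AB by (auto simp: pow)
    next
      case 2
      have "a (b (y t)) = y (Suc t)" by (simp add: yS)
      then show "g (a x) = A * g x \<and> g (b x) = B * g x"
        using 2 g1[of t] g1[of "Suc t"] g2[of t] bb[OF y_in, of t] AB2 AB by auto
    qed
  qed
qed

section \<open>The regular polygon\<close>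

locale mgon =
  fixes m :: nat and c :: gon_comp
  assumes m3: "3 \<le> m" and cat: "mgon_category m c"
begin

abbreviation C :: "nat \<Rightarrow> complex" where "C \<equiv> polygon_corner m"
definition poly :: "complex set" where "poly = convex hull (C ` {..<m})"
definition seg :: "complex set" where "seg = closed_segment 0 1"

lemma model_spaces: "model_space m Ob0 = {0}" "model_space m Ob1 = seg" "model_space m Ob2 = poly"
  by (simp_all add: seg_def poly_def)


definition src_corner :: "nat \<Rightarrow> nat" where "src_corner i = corner_index (c (Side i) Src)"
definition tgt_corner :: "nat \<Rightarrow> nat" where "tgt_corner i = corner_index (c (Side i) Tgt)"
definition side_pt :: "nat \<Rightarrow> complex \<Rightarrow> complex" where "side_pt i z = (1 - z) * C (src_corner i) + z * C (tgt_corner i)"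

lemma ends:
  assumes "i < m"
  shows "src_corner i = i \<and> tgt_corner i = Suc i mod m \<or> src_corner i = Suc i mod m \<and> tgt_corner i = i"
    and "c (Side i) Src = Corner (src_corner i)" "c (Side i) Tgt = Corner (tgt_corner i)"
    and "src_corner i < m" "tgt_corner i < m"
  using mgon_ends[OF cat assms] assms by (auto simp: src_corner_def tgt_corner_def corner_index_def)

lemma model_map_Side: "i < m \<Longrightarrow> model_map m c (Side i) z = side_pt i z"
  using ends[of i] by (simp add: side_pt_def side_end_def)

lemma Suc_mod: "i < m \<Longrightarrow> Suc i mod m = (if Suc i = m then 0 else Suc i)"
  by auto

lemma side_pt_ends: "side_pt i 0 = C (src_corner i)" "side_pt i 1 = C (tgt_corner i)"
  by (auto simp: side_pt_def)

lemma segE: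
  assumes "z \<in> seg" obtains t where "0 \<le> t" "t \<le> 1" "z = complex_of_real t"
  using assms by (auto simp: seg_def in_segment scaleR_conv_of_real)

lemma segI: "0 \<le> t \<Longrightarrow> t \<le> 1 \<Longrightarrow> complex_of_real t \<in> seg"
  by (auto simp: seg_def in_segment scaleR_conv_of_real)

lemma seg_ends: "0 \<in> seg" "1 \<in> seg"
  by (auto simp: seg_def)

text \<open>The outer unit normals of the sides; the polygon lies in the half-planes
  \<open>side_normal j \<bullet> z \<le> apothem\<close>, with equality exactly on the \<open>j\<close>-th side.\<close>

definition side_normal :: "nat \<Rightarrow> complex" where "side_normal j = cis (pi * (2 * real j + 1) / real m)"
definition apothem :: real where "apothem = cos (pi / real m)"

lemma apothem_pos: "apothem > 0"
proof -
  have "pi / real m < pi / 2" using m3 by (intro divide_strict_left_mono) auto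
  moreover have "0 < pi / real m" using m3 by simp
  ultimately show ?thesis unfolding apothem_def by (intro cos_gt_zero_pi) linarith+
qed

text \<open>The angle between normal and corner is an odd multiple of \<open>pi / m\<close>. Cosine
  decreases on \<open>[0, pi]\<close>, so the maximum is attained exactly at the angle
  \<open>pi / m\<close>, that is, at the two ends of the side.\<close>

lemma side_normal_corner:
  assumes "j < m" "l < m"
  shows "side_normal j \<bullet> C l \<le> apothem" "side_normal j \<bullet> C l = apothem \<longleftrightarrow> l = j \<or> l = Suc j mod m"
proof -
  define k where "k = \<bar>2 * int l - 2 * int j - 1\<bar>"
  \<comment> \<open>Folds the angle into \<open>[0, pi]\<close> by
    \<open>cos (2 * pi - a) = cos a\<close>.\<close>
  define k' where "k' = min k (2 * int m - k)"
  have k: "1 \<le> k" "k \<le> 2 * int m - 1" unfolding k_def using assms by presburger+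
  have k': "1 \<le> k'" "k' \<le> int m" using k by (auto simp: k'_def)
  have "side_normal j \<bullet> C l = cos (pi * (2 * real j + 1) / real m - 2 * pi * real l / real m)"
    by (simp add: side_normal_def polygon_corner_def inner_complex_def cos_diff)
  also have "\<dots> = cos (- (pi * real_of_int (2 * int l - 2 * int j - 1) / real m))"
    by (rule arg_cong[where f = cos]) (use m3 in \<open>simp add: field_simps\<close>)
  also have "\<dots> = cos (pi * real_of_int k / real m)"
    unfolding cos_minus k_def by (auto simp: abs_if) (metis cos_minus minus_diff_eq minus_divide_left mult_minus_right)
  also have "\<dots> = cos (pi * real_of_int k' / real m)"
  proof (cases "k \<le> 2 * int m - k")
    case False
    then have "pi * real_of_int k' / real m = 2 * pi - pi * real_of_int k / real m"
      using m3 by (simp add: k'_def field_simps)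
    then show ?thesis by (simp add: cos_diff)
  qed (simp add: k'_def)
  finally have eq: "side_normal j \<bullet> C l = cos (pi * real_of_int k' / real m)" .
  have lt: "cos (pi * real_of_int k' / real m) < apothem" if "k' \<noteq> 1"
    unfolding apothem_def
  proof (rule cos_monotone_0_pi)
    show "pi / real m < pi * real_of_int k' / real m"
      using that k' m3 by (simp add: divide_strict_right_mono)
    show "pi * real_of_int k' / real m \<le> pi"
      using k' m3 by (simp add: field_simps)
  qed (use m3 in auto)
  have "k' = 1 \<longleftrightarrow> l = j \<or> l = Suc j mod m"
    using assms by (auto simp: k'_def k_def Suc_mod min_def abs_if split: if_splits)
  then show "side_normal j \<bullet> C l \<le> apothem" "side_normal j \<bullet> C l = apothem \<longleftrightarrow> l = j \<or> l = Suc j mod m"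
    using lt eq by (auto simp: apothem_def) (metis less_irrefl apothem_def)
qed

lemma corner_inj: "inj_on C {..<m}"
proof -
  have "inj_on (\<lambda>k. cis (2 * pi * real k / real m)) {..<m}"
    using Complex.bij_betw_roots_unity[of m] m3 by (auto simp: bij_betw_def)
  then show ?thesis by (simp add: polygon_corner_def[abs_def])
qed

lemma corner_poly: "l < m \<Longrightarrow> C l \<in> poly"
  by (auto simp: poly_def intro: hull_inc)

lemma poly_convex: "convex poly" and poly_compact: "compact poly"
  by (auto simp: poly_def intro: finite_imp_compact_convex_hull)

text \<open>The centre is the mean of the corners, as the \<open>m\<close>-th roots of unity sum to
  0.\<close>

lemma zero_poly: "0 \<in> poly"
proof -
  have "(\<Sum>i<m. (1 / real m) *\<^sub>R C i) \<in> poly"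
    using m3 by (intro convex_sum poly_convex corner_poly) auto
  moreover have "(\<Sum>i<m. C i) = \<Sum>{z::complex. z ^ m = 1}"
    using sum.reindex_bij_betw[OF Complex.bij_betw_roots_unity[of m], of "\<lambda>z. z"] m3
    by (simp add: polygon_corner_def)
  moreover have "\<dots> = 0" using sum_roots_unity[of m] m3 by simp
  ultimately show ?thesis by (simp flip: scaleR_sum_right)
qed

lemma side_normal_poly:
  assumes "z \<in> poly" "j < m" shows "side_normal j \<bullet> z \<le> apothem"
proof -
  have "poly \<subseteq> {z. side_normal j \<bullet> z \<le> apothem}"
    unfolding poly_def using side_normal_corner(1)[OF assms(2)]
    by (intro hull_minimal convex_halfspace_le) auto
  with assms show ?thesis by blast
qed

lemma norm_poly: "z \<in> poly \<Longrightarrow> cmod z \<le> 1"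
proof -
  have "poly \<subseteq> cball 0 1"
    unfolding poly_def by (intro hull_minimal) (auto simp: polygon_corner_def)
  then show "z \<in> poly \<Longrightarrow> cmod z \<le> 1" by auto
qed

lemma side_pt_poly: "i < m \<Longrightarrow> z \<in> seg \<Longrightarrow> side_pt i z \<in> poly"
  using model_map_comp(2)[OF cat, of "Side i" Ob1 Ob2 "Idn Ob2" Ob2 z] model_map_Side[of i z]
  by (simp only: model_spaces ghom_simps) simp

lemma side_normal_side_pt:
  "side_normal j \<bullet> side_pt i (of_real t) = (1 - t) * (side_normal j \<bullet> C (src_corner i)) + t * (side_normal j \<bullet> C (tgt_corner i))"
proof -
  have "side_pt i (of_real t) = (1 - t) *\<^sub>R C (src_corner i) + t *\<^sub>R C (tgt_corner i)"
    by (simp add: side_pt_def scaleR_conv_of_real)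
  then show ?thesis by (simp add: inner_add_right)
qed

lemma side_normal_side_pt_self: "i < m \<Longrightarrow> z \<in> seg \<Longrightarrow> side_normal i \<bullet> side_pt i z = apothem"
proof -
  assume *: "i < m" "z \<in> seg"
  then obtain t where t: "z = complex_of_real t" using segE by metis
  have "side_normal i \<bullet> C (src_corner i) = apothem" "side_normal i \<bullet> C (tgt_corner i) = apothem"
    using ends(1,4,5)[OF *(1)] side_normal_corner(2)[OF *(1)] by auto
  then show ?thesis by (simp add: t side_normal_side_pt algebra_simps)
qed

lemma side_pt_inj: "i < m \<Longrightarrow> side_pt i z = side_pt i w \<Longrightarrow> z = w"
proof -
  assume "i < m" "side_pt i z = side_pt i w"
  then have "(z - w) * (C (tgt_corner i) - C (src_corner i)) = 0" by (simp add: side_pt_def algebra_simps)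
  moreover have "src_corner i \<noteq> tgt_corner i" using ends(1)[OF \<open>i < m\<close>] m3 \<open>i < m\<close> by (auto simp: Suc_mod split: if_splits)
  then have "C (tgt_corner i) \<noteq> C (src_corner i)" using corner_inj ends(4,5)[OF \<open>i < m\<close>] by (auto dest: inj_onD)
  ultimately show "z = w" by simp
qed

text \<open>A point strictly inside a segment attains the maximum of a linear functional only if
  both ends do; and since \<open>m \<ge> 3\<close>, no two sides share both ends.\<close>

lemma side_pt_on_side:
  assumes "i < m" "j < m" "z \<in> seg" "side_normal j \<bullet> side_pt i z = apothem" "z \<noteq> 0" "z \<noteq> 1"
  shows "i = j"
proof -
  obtain t where t: "0 \<le> t" "t \<le> 1" "z = complex_of_real t" using assms segE by metis
  then have t': "0 < t" "t < 1" using assms by (auto simp: less_le)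
  have le: "side_normal j \<bullet> C (src_corner i) \<le> apothem" "side_normal j \<bullet> C (tgt_corner i) \<le> apothem"
    using side_normal_corner(1)[OF assms(2)] ends(4,5)[OF assms(1)] by auto
  have "(1 - t) * (apothem - side_normal j \<bullet> C (src_corner i)) + t * (apothem - side_normal j \<bullet> C (tgt_corner i)) = 0"
    using assms(4) t side_normal_side_pt[of j i t] by (simp add: algebra_simps)
  moreover have "(1 - t) * (apothem - side_normal j \<bullet> C (src_corner i)) \<ge> 0" "t * (apothem - side_normal j \<bullet> C (tgt_corner i)) \<ge> 0"
    using t' le by auto
  ultimately have "(1 - t) * (apothem - side_normal j \<bullet> C (src_corner i)) = 0" "t * (apothem - side_normal j \<bullet> C (tgt_corner i)) = 0"
    by linarith+
  then have "side_normal j \<bullet> C (src_corner i) = apothem" "side_normal j \<bullet> C (tgt_corner i) = apothem" using t' by auto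
  then have "src_corner i = j \<or> src_corner i = Suc j mod m" "tgt_corner i = j \<or> tgt_corner i = Suc j mod m"
    using side_normal_corner(2)[OF assms(2)] ends(4,5)[OF assms(1)] by auto
  then show "i = j"
    using ends(1)[OF assms(1)] assms(1,2) m3 by (auto simp: Suc_mod split: if_splits)
qed

lemma side_pt_eq:
  assumes "i < m" "j < m" "z \<in> seg" "w \<in> seg" "side_pt i z = side_pt j w" "z \<noteq> 0" "z \<noteq> 1"
  shows "i = j" "z = w"
proof -
  show "i = j" using side_pt_on_side[OF assms(1,2,3) _ assms(6,7)] side_normal_side_pt_self[OF assms(2,4)] assms(5) by simp
  then show "z = w" using side_pt_inj assms by blast
qed

lemma corner_on_side: "l < m \<Longrightarrow> C l = side_pt l 0 \<or> C l = side_pt l 1"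
  using ends(1)[of l] by (auto simp: side_pt_ends)

lemma side_pt_eq_corner:
  assumes "i < m" "l < m" "z \<in> seg" "side_pt i z = C l"
  shows "z = 0 \<and> l = src_corner i \<or> z = 1 \<and> l = tgt_corner i"
proof -
  have "z = 0 \<or> z = 1"
  proof (rule ccontr)
    assume *: "\<not> (z = 0 \<or> z = 1)"
    then show False
      using corner_on_side[OF assms(2)] side_pt_eq(2)[OF assms(1,2,3)] seg_ends assms(4) by metis
  qed
  then show ?thesis
    using assms corner_inj ends(4,5)[OF assms(1)] by (auto simp: side_pt_ends dest: inj_onD)
qed

text \<open>Phrased through the sides rather than the topological interior, because gluing happens
  along sides.\<close>

definition inner_pt :: "complex \<Rightarrow> bool" where
  "inner_pt z \<longleftrightarrow> z \<in> poly \<and> (\<forall>i<m. z \<notin> side_pt i ` seg)"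

lemma scale_poly: "z \<in> poly \<Longrightarrow> 0 \<le> t \<Longrightarrow> t \<le> 1 \<Longrightarrow> t *\<^sub>R z \<in> poly"
  using convexD_alt[OF poly_convex zero_poly, of z t] by simp

text \<open>Shrinking towards the centre makes every product with a normal strictly smaller than
  \<open>apothem\<close>.\<close>

lemma inner_pt_scale:
  assumes "z \<in> poly" "0 \<le> t" "t < 1" shows "inner_pt (t *\<^sub>R z)"
  unfolding inner_pt_def
proof (intro conjI allI impI notI)
  show "t *\<^sub>R z \<in> poly" using scale_poly assms by simp
  fix i assume i: "i < m" "t *\<^sub>R z \<in> side_pt i ` seg"
  then have "side_normal i \<bullet> (t *\<^sub>R z) = apothem" using side_normal_side_pt_self[OF i(1)] by (metis imageE)
  then have "apothem = t * (side_normal i \<bullet> z)" by simp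
  also have "\<dots> \<le> t * apothem" using side_normal_poly[OF assms(1) i(1)] assms by (intro mult_left_mono) auto
  also have "\<dots> < apothem" using assms apothem_pos by simp
  finally show False by simp
qed

text \<open>A short step along the outer normal leaves the half-plane that contains the
  polygon.\<close>

lemma side_pt_not_interior:
  assumes "i < m" "z \<in> seg" "open U" "U \<subseteq> poly" shows "side_pt i z \<notin> U"
proof
  assume "side_pt i z \<in> U"
  then obtain e where e: "e > 0" "cball (side_pt i z) e \<subseteq> U" using assms open_contains_cball by blast
  have "norm (side_normal i) = 1" by (simp add: side_normal_def)
  then have "side_pt i z + e *\<^sub>R side_normal i \<in> cball (side_pt i z) e" using e by (simp add: dist_norm)
  then have "side_pt i z + e *\<^sub>R side_normal i \<in> poly" using e assms by blast
  then have "side_normal i \<bullet> side_pt i z + e * (side_normal i \<bullet> side_normal i) \<le> apothem"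
    using side_normal_poly[OF _ assms(1)] by (force simp: inner_add_right)
  then show False
    using side_normal_side_pt_self[OF assms(1,2)] e \<open>norm (side_normal i) = 1\<close> by (simp add: dot_square_norm)
qed

lemma side_pt_continuous: "continuous_on A (side_pt i)"
  unfolding side_pt_def by (intro continuous_intros)

text \<open>The rest is star-shaped about 0: a corner has norm 1, so it cannot lie on a segment from
  0 to another point of the unit disc.\<close>

lemma poly_minus_corner_connected: 
  assumes "l < m" shows "connected (poly - {C l})"
proof (rule starlike_imp_connected)
  have "C l \<noteq> 0" by (simp add: polygon_corner_def)
  moreover have "closed_segment 0 z \<subseteq> poly - {C l}" if z: "z \<in> poly - {C l}" for z
  proof
    fix w assume "w \<in> closed_segment 0 z"
    then obtain t where t: "0 \<le> t" "t \<le> 1" "w = t *\<^sub>R z" by (auto simp: in_segment)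
    have "w \<noteq> C l"
    proof
      assume "w = C l"
      then have "cmod w = 1" by (simp add: polygon_corner_def)
      then have "t * cmod z = 1" using t by simp
      moreover have "t * cmod z \<le> t * 1" using t z norm_poly by (intro mult_left_mono) auto
      ultimately have "t = 1" using t by linarith
      then show False using \<open>w = C l\<close> t z by simp
    qed
    then show "w \<in> poly - {C l}" using scale_poly[of z t] t z by auto
  qed
  ultimately show "starlike (poly - {C l})"
    unfolding starlike_def using zero_poly by (intro bexI[of _ 0]) auto
qed

end

section \<open>Points of the realization\<close>

locale mgon_presheaf = mgon +
  fixes T :: "('v, 'e, 't) gon_presheaf"
  assumes pre: "gon_presheaf m c T"
begin

lemma src_tgt_verts: "e \<in> edges T \<Longrightarrow> src T e \<in> verts T" "e \<in> edges T \<Longrightarrow> tgt T e \<in> verts T"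
  and side_edges: "i < m \<Longrightarrow> x \<in> tiles T \<Longrightarrow> side T i x \<in> edges T"
  and corner_verts: "i < m \<Longrightarrow> x \<in> tiles T \<Longrightarrow> corner T i x \<in> verts T"
  and src_side: "i < m \<Longrightarrow> x \<in> tiles T \<Longrightarrow> src T (side T i x) = corner T (src_corner i) x"
  and tgt_side: "i < m \<Longrightarrow> x \<in> tiles T \<Longrightarrow> tgt T (side T i x) = corner T (tgt_corner i) x"
  using pre unfolding presheaf_iff[OF cat] src_corner_def tgt_corner_def by blast+

definition all_cells :: "('v, 'e, 't) cell set" where "all_cells = (\<Union>j. cells T j)"

lemma all_cells_eq: "all_cells = VCell ` verts T \<union> ECell ` edges T \<union> TCell ` tiles T"
proof -
  have U: "(UNIV :: gon_ob set) = {Ob0, Ob1, Ob2}" by (auto intro: gon_ob.exhaust)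
  show ?thesis unfolding all_cells_def U by auto
qed

lemma cell_space_simps [simp]:
  "cell_space m (VCell v) = {0}" "cell_space m (ECell e) = seg" "cell_space m (TCell x) = poly"
  by (simp_all add: cell_space_def model_spaces del: model_space.simps)

text \<open>Every point of the realization has exactly one representative in the interior of a cell, which \<open>nf\<close>
  computes; hence \<open>nf\<close> decides whether two points are glued.\<close>

definition nf_edge :: "'e \<Rightarrow> complex \<Rightarrow> ('v, 'e, 't) cell \<times> complex" where
  "nf_edge e z = (if z = 0 then (VCell (src T e), 0) else if z = 1 then (VCell (tgt T e), 0)
     else (ECell e, z))"

fun nf :: "('v, 'e, 't) cell \<times> complex \<Rightarrow> ('v, 'e, 't) cell \<times> complex" where
  "nf (VCell v, z) = (VCell v, 0)"
| "nf (ECell e, z) = nf_edge e z"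
| "nf (TCell x, z) = (if inner_pt z then (TCell x, z)
     else (case SOME (i, w). i < m \<and> w \<in> seg \<and> z = side_pt i w of (i, w) \<Rightarrow> nf_edge (side T i x) w))"

lemma not_inner_ptE:
  assumes "z \<in> poly" "\<not> inner_pt z"
  obtains i w where "i < m" "w \<in> seg" "z = side_pt i w"
  using assms unfolding inner_pt_def by blast

lemma not_inner_pt_side_pt: "i < m \<Longrightarrow> w \<in> seg \<Longrightarrow> \<not> inner_pt (side_pt i w)"
  unfolding inner_pt_def by blast

lemma nf_edge_vertex:
  assumes "i < m" "w \<in> seg" "l < m" "x \<in> tiles T" "side_pt i w = C l"
  shows "nf_edge (side T i x) w = (VCell (corner T l x), 0)"
  using side_pt_eq_corner[OF assms(1,3,2,5)] src_side[OF assms(1,4)] tgt_side[OF assms(1,4)] by (auto simp: nf_edge_def)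

text \<open>Makes the arbitrary choice in \<open>nf\<close> harmless: sides overlap only at corners,
  where both descriptions yield the same vertex.\<close>

lemma nf_edge_eq:
  assumes "i < m" "j < m" "w \<in> seg" "u \<in> seg" "side_pt i w = side_pt j u" "x \<in> tiles T"
  shows "nf_edge (side T i x) w = nf_edge (side T j x) u"
proof (cases "w = 0 \<or> w = 1")
  case True
  then obtain l where "l < m" "side_pt i w = C l" using ends(4,5)[OF assms(1)] side_pt_ends by metis
  then show ?thesis using nf_edge_vertex assms by metis
next
  case False
  then show ?thesis using side_pt_eq[OF assms(1-5)] by blast
qed

lemma nf_side:
  assumes "i < m" "w \<in> seg" "x \<in> tiles T"
  shows "nf (TCell x, side_pt i w) = nf_edge (side T i x) w"
proof -
  let ?P = "\<lambda>(j, u). j < m \<and> u \<in> seg \<and> side_pt i w = side_pt j u"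
  obtain j u where ju: "(SOME (j, u). j < m \<and> u \<in> seg \<and> side_pt i w = side_pt j u) = (j, u)" by fastforce
  have "?P (SOME p. ?P p)" by (rule someI[of ?P "(i, w)"]) (use assms in simp)
  then have "j < m \<and> u \<in> seg \<and> side_pt i w = side_pt j u" using ju by simp
  then have "nf_edge (side T i x) w = nf_edge (side T j x) u" using nf_edge_eq assms by blast
  then show ?thesis using not_inner_pt_side_pt[OF assms(1,2)] ju by simp
qed

lemma nf_corner: "l < m \<Longrightarrow> x \<in> tiles T \<Longrightarrow> nf (TCell x, C l) = (VCell (corner T l x), 0)"
  using corner_on_side[of l] nf_side[of l _ x] nf_edge_vertex[of l _ l x] seg_ends by metis

lemma glue_nf:
  assumes "(p, q) \<in> realization_glue m c T" shows "nf p = nf q"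
proof -
  obtain i j f a z where *: "p = (restr T f a, z)" "q = (a, model_map m c f z)"
    "f \<in> ghom m i j" "a \<in> cells T j" "z \<in> model_space m i"
    using assms unfolding realization_glue_def by blast
  then consider "f = Idn i" "i = j" | "f = Src" "i = Ob0" "j = Ob1" | "f = Tgt" "i = Ob0" "j = Ob1"
    | l where "f = Side l" "l < m" "i = Ob1" "j = Ob2" | l where "f = Corner l" "l < m" "i = Ob0" "j = Ob2"
    by (cases i; cases j) (auto simp: ghom_simps)
  then show ?thesis
  proof cases
    case 4
    then obtain x where x: "a = TCell x" "x \<in> tiles T" using * by auto
    have "z \<in> seg" using * 4 by (simp add: model_spaces del: model_space.simps)
    then show ?thesis using nf_side[OF 4(2) _ x(2), of z] * 4 x
      by (simp add: model_map_Side del: nf.simps(3) model_map.simps(5))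
  next
    case 5
    then show ?thesis using * nf_corner[OF 5(2)] by (auto simp del: nf.simps(3))
  qed (use * in \<open>auto simp: nf_edge_def\<close>)
qed

definition gluing :: "(('v, 'e, 't) cell \<times> complex) rel" where
  "gluing = (realization_glue m c T \<union> (realization_glue m c T)\<inverse>)\<^sup>*"

definition pts :: "(('v, 'e, 't) cell \<times> complex) set" where
  "pts = (SIGMA a:all_cells. cell_space m a)"

lemma gluing_nf: "(p, q) \<in> gluing \<Longrightarrow> nf p = nf q"
  unfolding gluing_def
proof (induction rule: rtrancl_induct)
  case (step y z)
  then show ?case using glue_nf[of y z] glue_nf[of z y] by auto
qed simp

lemma gluing_sym: "(p, q) \<in> gluing \<Longrightarrow> (q, p) \<in> gluing"
  unfolding gluing_def by (rule symD[OF sym_rtrancl]) (auto intro: symI)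

lemma gluing_trans: "(p, q) \<in> gluing \<Longrightarrow> (q, r) \<in> gluing \<Longrightarrow> (p, r) \<in> gluing"
  unfolding gluing_def by (rule rtrancl_trans)

lemma glueI:
  assumes "f \<in> ghom m i j" "a \<in> cells T j" "z \<in> model_space m i" "q = model_map m c f z"
  shows "((a, q), (restr T f a, z)) \<in> gluing"
proof -
  have "((restr T f a, z), (a, q)) \<in> realization_glue m c T"
    unfolding realization_glue_def using assms by blast
  then show ?thesis unfolding gluing_def by blast
qed

text \<open>A boundary point of a tile passes to an edge, and an end of an edge to a vertex.\<close>

lemma gluing_to_nf:
  assumes "p \<in> pts" shows "(p, nf p) \<in> gluing"
proof -
  have edge: "((ECell e, z), nf_edge e z) \<in> gluing" if "e \<in> edges T" for e z
    using glueI[of Src Ob0 Ob1 "ECell e" 0 0] glueI[of Tgt Ob0 Ob1 "ECell e" 0 1] that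
    by (auto simp: ghom_simps nf_edge_def) (auto simp: gluing_def)
  obtain a z where p: "p = (a, z)" "a \<in> all_cells" "z \<in> cell_space m a" using assms by (auto simp: pts_def)
  show ?thesis
  proof (cases a)
    case (VCell v)
    then show ?thesis using p by (auto simp: gluing_def)
  next
    case (ECell e)
    then show ?thesis using p edge by (auto simp: all_cells_eq)
  next
    case (TCell x)
    then have x: "x \<in> tiles T" "z \<in> poly" using p by (auto simp: all_cells_eq)
    show ?thesis
    proof (cases "inner_pt z")
      case True
      then show ?thesis using p TCell by (simp add: gluing_def)
    next
      case False
      then obtain i w where iw: "i < m" "w \<in> seg" "z = side_pt i w" using x not_inner_ptE by metis
      have "((TCell x, z), (ECell (side T i x), w)) \<in> gluing"
        using glueI[of "Side i" Ob1 Ob2 "TCell x" w z] iw x model_map_Side[of i w]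
        by (simp add: ghom_simps model_spaces del: model_space.simps model_map.simps(5))
      then show ?thesis
        using gluing_trans edge[OF side_edges[OF iw(1) x(1)]] nf_side[OF iw(1,2) x(1)] p TCell iw
        by (metis)
    qed
  qed
qed

lemma gluing_class_eq:
  assumes "p \<in> pts" "q \<in> pts"
  shows "gluing `` {p} = gluing `` {q} \<longleftrightarrow> nf p = nf q"
proof
  assume "gluing `` {p} = gluing `` {q}"
  moreover have "p \<in> gluing `` {p}" by (simp add: gluing_def)
  ultimately show "nf p = nf q" using gluing_nf[of q p] by auto
next
  assume "nf p = nf q"
  then have "(p, q) \<in> gluing"
    using gluing_to_nf[OF assms(1)] gluing_to_nf[OF assms(2)] gluing_sym gluing_trans by metis
  then show "gluing `` {p} = gluing `` {q}" using gluing_sym gluing_trans by blast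
qed

text \<open>\<open>f\<close> exhibits \<open>S\<close> as the realization itself: gluing is
  expressed by \<open>nf\<close>, and the last clause is the quotient topology in terms of closed
  sets. As cells are closed in the plane, plain \<open>closed\<close> can stand for relative
  closedness.\<close>

definition realizes :: "'a::metric_space set \<Rightarrow> (('v, 'e, 't) cell \<times> complex \<Rightarrow> 'a) \<Rightarrow> bool" where
  "realizes S f \<longleftrightarrow>
     (\<forall>a \<in> all_cells. continuous_on (cell_space m a) (\<lambda>z. f (a, z))) \<and>
     f ` pts = S \<and> (\<forall>p \<in> pts. \<forall>q \<in> pts. f p = f q \<longleftrightarrow> nf p = nf q) \<and>
     (\<forall>K \<subseteq> S. (\<forall>a \<in> all_cells. closed {z \<in> cell_space m a. f (a, z) \<in> K}) \<longrightarrow>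
        closedin (top_of_set S) K)"

lemma homeomorphic_realizes:
  fixes S :: "'a::metric_space set"
  assumes "realization m c T homeomorphic_space top_of_set S"
  shows "\<exists>f. realizes S f"
proof -
  let ?X = "sum_topology (\<lambda>a. top_of_set (cell_space m a)) all_cells"
  have R: "realization m c T = quotient_topology ?X gluing"
    by (simp add: realization_def gluing_def all_cells_def)
  have tsX: "topspace ?X = pts" by (auto simp: pts_def)
  obtain h where h: "homeomorphic_map (quotient_topology ?X gluing) (top_of_set S) h"
    using assms unfolding R homeomorphic_space by blast
  define f where "f = h \<circ> (\<lambda>p. gluing `` {p})"
  have q: "quotient_map ?X (top_of_set S) f"
    unfolding f_def
    by (rule quotient_map_compose[OF quotient_map_quotient_topology h[unfolded homeomorphic_map_def, THEN conjunct1]])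
  have "inj_on h (topspace (quotient_topology ?X gluing))"
    using h by (rule homeomorphic_imp_injective_map)
  then have hinj: "inj_on h (pts // gluing)" by (simp only: topspace_quotient_topology tsX)
  have "realizes S f"
    unfolding realizes_def
  proof (intro conjI ballI allI impI)
    show "f ` pts = S" using quotient_imp_surjective_map[OF q] tsX by simp
    show "f p = f q \<longleftrightarrow> nf p = nf q" if "p \<in> pts" "q \<in> pts" for p q
      using inj_on_eq_iff[OF hinj quotientI[OF that(1)] quotientI[OF that(2)]] gluing_class_eq[OF that]
      by (simp add: f_def)
    fix a assume a: "a \<in> all_cells"
    have "continuous_map (top_of_set (cell_space m a)) (top_of_set S) (f \<circ> (\<lambda>z. (a, z)))"
      using a by (intro continuous_map_compose[OF continuous_map_component_injection quotient_imp_continuous_map[OF q]]) 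
    then show "continuous_on (cell_space m a) (\<lambda>z. f (a, z))"
      by (simp add: comp_def)
  next
    fix K assume K: "K \<subseteq> S" "\<forall>a \<in> all_cells. closed {z \<in> cell_space m a. f (a, z) \<in> K}"
    have "closedin ?X {p \<in> topspace ?X. f p \<in> K}"
      unfolding closedin_sum_topology
    proof (intro conjI ballI)
      fix a assume a: "a \<in> all_cells"
      have "{z. (a, z) \<in> {p \<in> topspace ?X. f p \<in> K}} = {z \<in> cell_space m a. f (a, z) \<in> K}"
        using a by (auto simp: tsX pts_def)
      then show "closedin (top_of_set (cell_space m a)) {z. (a, z) \<in> {p \<in> topspace ?X. f p \<in> K}}"
        using K(2) a by (auto simp: closedin_closed_eq closed_subset)
    qed auto
    then show "closedin (top_of_set S) K"
      using q K(1) unfolding quotient_map_closedin by simp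
  qed
  then show ?thesis by blast
qed

end

text \<open>The puncture of the sphere is left arbitrary, since the vertex to be removed depends on
  the tiling. For the open disc, a linear isometry from the complex numbers onto the horizontal
  plane carries the unit ball to the model.\<close>

lemma tiling_space_chart:
  obtains "tiling_space m n = top_of_set (sphere 0 1)" "\<And>b. b \<in> sphere 0 1 \<Longrightarrow>
      (sphere 0 1 - {b} :: (real^3) set) homeomorphic (UNIV :: complex set)"
  | S :: "(real^3) set" where "tiling_space m n = top_of_set S" "S homeomorphic (UNIV :: complex set)"
proof -
  let ?H = "{x :: real^3. x $ 3 = 0}"
  have H: "?H = {x. axis 3 1 \<bullet> x = 0}" by (simp add: inner_axis inner_commute)
  have affH: "affine ?H" unfolding H by (rule affine_hyperplane)
  have dimH: "aff_dim ?H = 2" unfolding H by (subst aff_dim_hyperplane) (auto simp: axis_eq_0_iff)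
  have HC: "?H homeomorphic (UNIV :: complex set)"
    using affH dimH by (intro homeomorphic_affine_sets) (auto simp: aff_dim_UNIV)
  have sph: "(sphere 0 1 - {b} :: (real^3) set) homeomorphic (UNIV :: complex set)" if "b \<in> sphere 0 1" for b
  proof -
    have "(sphere 0 1 - {b}) homeomorphic ?H"
      using homeomorphic_punctured_sphere_affine[of 1 b 0 ?H] that affH dimH by simp
    then show ?thesis using HC by (rule homeomorphic_trans)
  qed
  define S where "S = {x :: real^3. x $ 3 = 0 \<and> norm x < 1}"
  have S: "S homeomorphic (UNIV :: complex set)"
  proof -
    have dim: "dim (UNIV :: complex set) = dim ?H"
      unfolding H by (subst dim_hyperplane) (auto simp: axis_eq_0_iff)
    have sub: "subspace ?H" unfolding H by (rule subspace_hyperplane)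
    obtain g :: "complex \<Rightarrow> real^3" where g: "linear g" "g ` UNIV = ?H" "\<And>x. norm (g x) = norm x"
      by (rule isometry_subspaces[OF subspace_UNIV sub dim]) blast
    have "inj g" using g(1,3) by (metis linear_injective_0 norm_eq_zero)
    have "S = g ` ball 0 1"
    proof (intro equalityI subsetI)
      fix x assume x: "x \<in> S"
      then have "x \<in> g ` UNIV" unfolding g(2) by (simp add: S_def)
      then show "x \<in> g ` ball 0 1" using x g(3) by (auto simp: S_def)
    next
      fix x assume "x \<in> g ` ball 0 1"
      then obtain y where y: "x = g y" "norm y < 1" by auto
      then have "x \<in> ?H" using g(2) by blast
      then show "x \<in> S" using y g(3) by (simp add: S_def)
    qed
    then have "(ball 0 1 :: complex set) homeomorphic S"
      using linear_homeomorphic_image[OF g(1) \<open>inj g\<close>, of "ball 0 1"] by simp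
    then have "S homeomorphic (ball 0 1 :: complex set)" by (rule homeomorphic_sym[THEN iffD1])
    moreover have "(ball 0 1 :: complex set) homeomorphic (UNIV :: complex set)"
      by (rule homeomorphic_ball_UNIV) simp
    ultimately show ?thesis by (rule homeomorphic_trans)
  qed
  show ?thesis
  proof (cases "(m, n) \<in> {(3, 3), (3, 4), (4, 3), (3, 5), (5, 3)}")
    case True
    then show ?thesis using that(1) sph by (auto simp: tiling_space_def)
  next
    case False
    show ?thesis
    proof (cases "(m, n) \<in> {(3, 6), (4, 4), (6, 3)}")
      case True
      then have "tiling_space m n = top_of_set ?H"
        using False unfolding tiling_space_def by (simp only: if_False if_True)
      then show ?thesis using HC by (rule that(2))
    next
      case False
      then have "tiling_space m n = top_of_set S"
        using \<open>(m, n) \<notin> {(3, 3), (3, 4), (4, 3), (3, 5), (5, 3)}\<close>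
        unfolding tiling_space_def S_def by (simp only: if_False if_True)
      then show ?thesis using S by (rule that(2))
    qed
  qed
qed

section \<open>Tilings of surfaces\<close>

text \<open>\<open>k\<close> is a chart of the surface minus \<open>P\<close>, where \<open>P\<close> is empty for a plane and a single vertex for a sphere.\<close>

locale tiled_surface = mgon_presheaf m c T
  for m c and T :: "('v, 'e, 't) gon_presheaf" +
  fixes n :: nat and S P :: "'a::euclidean_space set"
    and f :: "('v, 'e, 't) cell \<times> complex \<Rightarrow> 'a"
    and k :: "complex \<Rightarrow> 'a" and k' :: "'a \<Rightarrow> complex" and v0 :: 'v
  assumes levelwise_inj: "a \<in> cells T j \<Longrightarrow> inj_on (\<lambda>g. restr T g a) (ghom m i j)"
    and common_sides: "x \<in> tiles T \<Longrightarrow> y \<in> tiles T \<Longrightarrow> x \<noteq> y \<Longrightarrow>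
        card ((\<lambda>i. side T i x) ` {..<m} \<inter> (\<lambda>i. side T i y) ` {..<m}) \<le> 1"
    and degree: "v \<in> verts T \<Longrightarrow> finite {e \<in> edges T. src T e = v \<or> tgt T e = v} \<and>
        card {e \<in> edges T. src T e = v \<or> tgt T e = v} = n"
    and n: "n > 0" "4 dvd n"
    and refl: "reflective m T"
    and real: "realizes S f"
    and puncture: "P \<subseteq> {f (VCell v0, 0)}" "v0 \<in> verts T"
    and chart: "homeomorphism UNIV (S - P) k k'"
begin

section \<open>Closed cells as embedded pieces of the surface\<close>

definition vert_pt :: "'v \<Rightarrow> 'a" where "vert_pt v = f (VCell v, 0)"
definition edge_pt :: "'e \<Rightarrow> complex \<Rightarrow> 'a" where "edge_pt e z = f (ECell e, z)"
definition tile_pt :: "'t \<Rightarrow> complex \<Rightarrow> 'a" where "tile_pt x z = f (TCell x, z)"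

lemma side_inj: "x \<in> tiles T \<Longrightarrow> i < m \<Longrightarrow> j < m \<Longrightarrow> side T i x = side T j x \<Longrightarrow> i = j"
  using levelwise_inj[of "TCell x" Ob2 Ob1, unfolded ghom_simps]
  by (auto dest: inj_onD[where x = "Side i" and y = "Side j"])

lemma corner_T_inj: "x \<in> tiles T \<Longrightarrow> i < m \<Longrightarrow> j < m \<Longrightarrow> corner T i x = corner T j x \<Longrightarrow> i = j"
  using levelwise_inj[of "TCell x" Ob2 Ob0, unfolded ghom_simps]
  by (auto dest: inj_onD[where x = "Corner i" and y = "Corner j"])

lemma src_tgt_ne: "e \<in> edges T \<Longrightarrow> src T e \<noteq> tgt T e"
  using levelwise_inj[of "ECell e" Ob1 Ob0, unfolded ghom_simps]
  by (auto dest: inj_onD[where x = "Src" and y = "Tgt"])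

lemma in_pts:
  "(VCell v, z) \<in> pts \<longleftrightarrow> v \<in> verts T \<and> z = 0"
  "(ECell e, z) \<in> pts \<longleftrightarrow> e \<in> edges T \<and> z \<in> seg"
  "(TCell x, z) \<in> pts \<longleftrightarrow> x \<in> tiles T \<and> z \<in> poly"
  by (auto simp: pts_def all_cells_eq)

lemma f_eq: "p \<in> pts \<Longrightarrow> q \<in> pts \<Longrightarrow> f p = f q \<longleftrightarrow> nf p = nf q"
  using real unfolding realizes_def by blast

lemma vert_pt_eq: "v \<in> verts T \<Longrightarrow> w \<in> verts T \<Longrightarrow> vert_pt v = vert_pt w \<longleftrightarrow> v = w"
  by (simp add: vert_pt_def f_eq in_pts)

lemma edge_pt_ends: "e \<in> edges T \<Longrightarrow> edge_pt e 0 = vert_pt (src T e)" "e \<in> edges T \<Longrightarrow> edge_pt e 1 = vert_pt (tgt T e)"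
  by (simp_all add: edge_pt_def vert_pt_def f_eq in_pts seg_ends src_tgt_verts nf_edge_def)

lemma tile_pt_side_pt: "x \<in> tiles T \<Longrightarrow> i < m \<Longrightarrow> w \<in> seg \<Longrightarrow> tile_pt x (side_pt i w) = edge_pt (side T i x) w"
  unfolding tile_pt_def edge_pt_def
  by (subst f_eq) (auto simp: in_pts side_pt_poly side_edges nf_side simp del: nf.simps(3))

lemma tile_pt_corner: "x \<in> tiles T \<Longrightarrow> l < m \<Longrightarrow> tile_pt x (C l) = vert_pt (corner T l x)"
  unfolding tile_pt_def vert_pt_def
  by (subst f_eq) (auto simp: in_pts corner_poly corner_verts nf_corner simp del: nf.simps(3))

lemma edge_pt_open_eq:
  assumes "e \<in> edges T" "e' \<in> edges T" "z \<in> seg" "z' \<in> seg" "z \<noteq> 0" "z \<noteq> 1" "edge_pt e z = edge_pt e' z'"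
  shows "e = e' \<and> z = z'"
  using assms by (auto simp: edge_pt_def f_eq in_pts nf_edge_def split: if_splits)

lemma edge_pt_open_ne_vert_pt:
  "e \<in> edges T \<Longrightarrow> v \<in> verts T \<Longrightarrow> z \<in> seg \<Longrightarrow> z \<noteq> 0 \<Longrightarrow> z \<noteq> 1 \<Longrightarrow> edge_pt e z \<noteq> vert_pt v"
  by (simp add: edge_pt_def vert_pt_def f_eq in_pts nf_edge_def)

lemma inner_poly: "inner_pt z \<Longrightarrow> z \<in> poly"
  by (simp add: inner_pt_def)

lemma nf_edge_not_tile: "nf_edge e z \<noteq> (TCell x, w)"
  by (simp add: nf_edge_def)

lemma tile_pt_inner_eq:
  assumes "x \<in> tiles T" "y \<in> tiles T" "inner_pt z" "w \<in> poly" "tile_pt x z = tile_pt y w"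
  shows "x = y \<and> z = w"
proof (cases "inner_pt w")
  case True
  then show ?thesis using assms inner_poly by (auto simp: tile_pt_def f_eq in_pts)
next
  case False
  then obtain i u where "i < m" "u \<in> seg" "w = side_pt i u" using not_inner_ptE assms by metis
  moreover have "nf (TCell x, z) = nf (TCell y, w)"
    using assms f_eq inner_poly unfolding tile_pt_def by (metis in_pts(3))
  ultimately show ?thesis using nf_side[of i u y] assms nf_edge_not_tile[of "side T i y" u x z] by simp
qed

lemma tile_pt_inner_ne_edge_pt: "x \<in> tiles T \<Longrightarrow> e \<in> edges T \<Longrightarrow> inner_pt z \<Longrightarrow> w \<in> seg \<Longrightarrow> tile_pt x z \<noteq> edge_pt e w"
  using inner_poly by (simp add: tile_pt_def edge_pt_def f_eq in_pts nf_edge_def)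

lemma tile_pt_inner_ne_vert_pt: "x \<in> tiles T \<Longrightarrow> v \<in> verts T \<Longrightarrow> inner_pt z \<Longrightarrow> tile_pt x z \<noteq> vert_pt v"
  using inner_poly by (simp add: tile_pt_def vert_pt_def f_eq in_pts)

lemma edge_pt_inj: "e \<in> edges T \<Longrightarrow> inj_on (edge_pt e) seg"
proof (rule inj_onI)
  fix z w assume *: "e \<in> edges T" "z \<in> seg" "w \<in> seg" "edge_pt e z = edge_pt e w"
  show "z = w"
  proof (cases "(z = 0 \<or> z = 1) \<and> (w = 0 \<or> w = 1)")
    case True
    then show ?thesis using * src_tgt_ne edge_pt_ends vert_pt_eq src_tgt_verts by metis
  next
    case False
    then show ?thesis using edge_pt_open_eq[of e e z w] edge_pt_open_eq[of e e w z] * by auto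
  qed
qed

text \<open>Levelwise injectivity excludes self-gluing of a tile: its corners are distinct vertices
  and its sides distinct edges. The embedding prepares the use of invariance of domain.\<close>

lemma tile_pt_inj: "x \<in> tiles T \<Longrightarrow> inj_on (tile_pt x) poly"
proof (rule inj_onI)
  fix z w assume *: "x \<in> tiles T" "z \<in> poly" "w \<in> poly" "tile_pt x z = tile_pt x w"
  show "z = w"
  proof (cases "inner_pt z \<or> inner_pt w")
    case True
    then show ?thesis using tile_pt_inner_eq[of x x z w] tile_pt_inner_eq[of x x w z] * by auto
  next
    case False
    obtain i u where iu: "i < m" "u \<in> seg" "z = side_pt i u" using False * not_inner_ptE by metis
    obtain j t where jt: "j < m" "t \<in> seg" "w = side_pt j t" using False * not_inner_ptE by metis
    have eq: "edge_pt (side T i x) u = edge_pt (side T j x) t" using * iu jt tile_pt_side_pt by simp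
    note ed = side_edges[OF iu(1) *(1)] side_edges[OF jt(1) *(1)]
    show ?thesis
    proof (cases "(u = 0 \<or> u = 1) \<and> (t = 0 \<or> t = 1)")
      case True
      obtain l where l: "l < m" "z = C l" using True iu ends(4,5) side_pt_ends by metis
      obtain l' where l': "l' < m" "w = C l'" using True jt ends(4,5) side_pt_ends by metis
      have "corner T l x = corner T l' x"
        using * l l' tile_pt_corner vert_pt_eq corner_verts by metis
      then show ?thesis using corner_T_inj *(1) l l' by blast
    next
      case False
      then have "side T i x = side T j x \<and> u = t"
        using edge_pt_open_eq[OF ed iu(2) jt(2) _ _ eq] edge_pt_open_eq[OF ed(2,1) jt(2) iu(2) _ _ eq[symmetric]] by auto
      then show ?thesis using side_inj *(1) iu jt by blast
    qed
  qed
qed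

lemma edge_pt_cont: "e \<in> edges T \<Longrightarrow> continuous_on seg (edge_pt e)"
  and tile_pt_cont: "x \<in> tiles T \<Longrightarrow> continuous_on poly (tile_pt x)"
proof -
  have c: "continuous_on (cell_space m a) (\<lambda>z. f (a, z))" if "a \<in> all_cells" for a
    using real that unfolding realizes_def by blast
  show "e \<in> edges T \<Longrightarrow> continuous_on seg (edge_pt e)"
    using c[of "ECell e"] by (simp add: all_cells_eq edge_pt_def[abs_def] del: model_space.simps)
  show "x \<in> tiles T \<Longrightarrow> continuous_on poly (tile_pt x)"
    using c[of "TCell x"] by (simp add: all_cells_eq tile_pt_def[abs_def] del: model_space.simps)
qed

definition body :: "'t \<Rightarrow> 'a set" where "body x = tile_pt x ` poly"
definition line :: "'e \<Rightarrow> 'a set" where "line e = edge_pt e ` seg"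

lemma in_S: "v \<in> verts T \<Longrightarrow> vert_pt v \<in> S" "e \<in> edges T \<Longrightarrow> line e \<subseteq> S" "x \<in> tiles T \<Longrightarrow> body x \<subseteq> S"
proof -
  have "f ` pts = S" using real unfolding realizes_def by blast
  then show "v \<in> verts T \<Longrightarrow> vert_pt v \<in> S" "e \<in> edges T \<Longrightarrow> line e \<subseteq> S" "x \<in> tiles T \<Longrightarrow> body x \<subseteq> S"
    by (auto simp: vert_pt_def line_def body_def edge_pt_def tile_pt_def in_pts)
qed

lemma point_cases:
  assumes "q \<in> S"
  obtains (vertex) v where "v \<in> verts T" "q = vert_pt v"
  | (edge) e z where "e \<in> edges T" "z \<in> seg" "z \<noteq> 0" "z \<noteq> 1" "q = edge_pt e z"
  | (tile) x z where "x \<in> tiles T" "inner_pt z" "q = tile_pt x z"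
proof -
  have edge': thesis if e: "e \<in> edges T" "z \<in> seg" "q = edge_pt e z" for e z
  proof (cases "z = 0 \<or> z = 1")
    case True
    then show ?thesis using vertex edge_pt_ends[OF e(1)] src_tgt_verts[OF e(1)] e(3) by blast
  next
    case False
    then show ?thesis using e edge by blast
  qed
  have "f ` pts = S" using real unfolding realizes_def by blast
  then obtain a z where az: "q = f (a, z)" "(a, z) \<in> pts" using assms by force
  show thesis
  proof (cases a)
    case (VCell v)
    then show ?thesis using az vertex by (auto simp: in_pts vert_pt_def)
  next
    case (ECell e)
    then show ?thesis using az edge'[of e z] by (auto simp: in_pts edge_pt_def)
  next
    case (TCell x)
    then have x: "x \<in> tiles T" "z \<in> poly" "q = tile_pt x z" using az by (auto simp: in_pts tile_pt_def)
    show ?thesis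
    proof (cases "inner_pt z")
      case True
      then show ?thesis using x tile by blast
    next
      case False
      then obtain i u where "i < m" "u \<in> seg" "z = side_pt i u" using x not_inner_ptE by metis
      then show ?thesis using edge'[of "side T i x" u] x side_edges tile_pt_side_pt by simp
    qed
  qed
qed

lemma vertex_in_line:
  assumes "e \<in> edges T" "v \<in> verts T" shows "vert_pt v \<in> line e \<longleftrightarrow> src T e = v \<or> tgt T e = v"
proof
  assume "vert_pt v \<in> line e"
  then obtain z where z: "z \<in> seg" "edge_pt e z = vert_pt v" by (auto simp: line_def)
  then have "z = 0 \<or> z = 1" using edge_pt_open_ne_vert_pt assms by blast
  then show "src T e = v \<or> tgt T e = v" using z edge_pt_ends vert_pt_eq src_tgt_verts assms by metis
next
  assume "src T e = v \<or> tgt T e = v"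
  then show "vert_pt v \<in> line e" using edge_pt_ends[OF assms(1)] seg_ends unfolding line_def by (metis imageI)
qed

lemma open_edge_in_line:
  assumes "e \<in> edges T" "e' \<in> edges T" "z \<in> seg" "z \<noteq> 0" "z \<noteq> 1" "edge_pt e z \<in> line e'" shows "e' = e"
  using assms edge_pt_open_eq unfolding line_def by blast

lemma line_subset_body: "x \<in> tiles T \<Longrightarrow> i < m \<Longrightarrow> line (side T i x) \<subseteq> body x"
  unfolding line_def body_def using tile_pt_side_pt side_pt_poly by (metis image_eqI image_subsetI)

lemma body_cases:
  assumes "x \<in> tiles T" "q \<in> body x"
  obtains (inner) z where "inner_pt z" "q = tile_pt x z" | (side) i where "i < m" "q \<in> line (side T i x)"
proof -
  obtain z where z: "z \<in> poly" "q = tile_pt x z" using assms by (auto simp: body_def)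
  show thesis
  proof (cases "inner_pt z")
    case False
    then obtain i u where "i < m" "u \<in> seg" "z = side_pt i u" using z not_inner_ptE by metis
    then show ?thesis using side[of i] z assms tile_pt_side_pt by (auto simp: line_def)
  qed (use z inner in blast)
qed

lemma open_edge_in_body:
  assumes "e \<in> edges T" "x \<in> tiles T" "z \<in> seg" "z \<noteq> 0" "z \<noteq> 1" "edge_pt e z \<in> body x"
  shows "\<exists>i<m. side T i x = e"
  using assms(2,6)
proof (cases rule: body_cases)
  case (inner w)
  then show ?thesis using tile_pt_inner_ne_edge_pt assms by metis
next
  case (side i)
  then show ?thesis using open_edge_in_line[of e "side T i x" z] side_edges assms by metis
qed

lemma inner_in_body: "x \<in> tiles T \<Longrightarrow> y \<in> tiles T \<Longrightarrow> inner_pt z \<Longrightarrow> tile_pt x z \<in> body y \<Longrightarrow> y = x"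
  unfolding body_def using tile_pt_inner_eq by blast

lemma inner_not_in_line: "x \<in> tiles T \<Longrightarrow> e \<in> edges T \<Longrightarrow> inner_pt z \<Longrightarrow> tile_pt x z \<notin> line e"
  unfolding line_def using tile_pt_inner_ne_edge_pt by blast

lemma vertex_in_body:
  assumes "x \<in> tiles T" "v \<in> verts T" shows "vert_pt v \<in> body x \<longleftrightarrow> (\<exists>l<m. corner T l x = v)"
proof
  assume "\<exists>l<m. corner T l x = v"
  then show "vert_pt v \<in> body x" using tile_pt_corner assms(1) corner_poly unfolding body_def by (metis imageI)
next
  assume "vert_pt v \<in> body x"
  with assms(1) show "\<exists>l<m. corner T l x = v"
  proof (cases rule: body_cases)
    case (inner z)
    then show ?thesis using tile_pt_inner_ne_vert_pt assms by metis
  next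
    case (side i)
    then show ?thesis using vertex_in_line[OF side_edges[OF side(1) assms(1)] assms(2)]
        src_side tgt_side assms ends(4,5)[OF side(1)] by metis
  qed
qed

section \<open>Subcomplexes and open stars\<close>

lemma closed_subcomplex:
  assumes K: "K \<subseteq> S"
    and tile: "\<And>x z. x \<in> tiles T \<Longrightarrow> inner_pt z \<Longrightarrow> tile_pt x z \<in> K \<Longrightarrow> body x \<subseteq> K"
    and edge: "\<And>e z. e \<in> edges T \<Longrightarrow> z \<in> seg \<Longrightarrow> z \<noteq> 0 \<Longrightarrow> z \<noteq> 1 \<Longrightarrow> edge_pt e z \<in> K \<Longrightarrow> line e \<subseteq> K"
  shows "closedin (top_of_set S) K"
proof -
  have seg_cpt: "compact seg" by (simp add: seg_def)
  \<comment> \<open>By the hypotheses \<open>K\<close> meets the inside of a cell only if it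
    contains the closed cell; on an edge the trace is thus everything or a subset of the two
    ends.\<close>
  have E: "compact {z \<in> seg. edge_pt e z \<in> K}" if e: "e \<in> edges T" for e
  proof (cases "\<exists>z\<in>seg. z \<noteq> 0 \<and> z \<noteq> 1 \<and> edge_pt e z \<in> K")
    case True
    then have "line e \<subseteq> K" using edge[OF e] by blast
    then have "{z \<in> seg. edge_pt e z \<in> K} = seg" by (auto simp: line_def)
    then show ?thesis using seg_cpt by simp
  next
    case False
    then have "{z \<in> seg. edge_pt e z \<in> K} \<subseteq> {0, 1}" by blast
    then show ?thesis by (meson finite.emptyI finite.insertI finite_imp_compact finite_subset)
  qed
  have V: "closed {z \<in> {0}. f (VCell v, z) \<in> K}" for v
    by (intro finite_imp_closed) simp
  have T': "closed {z \<in> poly. tile_pt x z \<in> K}" if x: "x \<in> tiles T" for x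
  proof (cases "\<exists>z. inner_pt z \<and> tile_pt x z \<in> K")
    case True
    then have "body x \<subseteq> K" using tile[OF x] by blast
    then have "{z \<in> poly. tile_pt x z \<in> K} = poly" by (auto simp: body_def)
    then show ?thesis using poly_compact compact_imp_closed by simp
  next
    case False
    \<comment> \<open>Otherwise \<open>K\<close> meets the tile only in its sides, and the trace is
      a finite union of compact pieces.\<close>
    have "{z \<in> poly. tile_pt x z \<in> K} = (\<Union>i<m. side_pt i ` {w \<in> seg. edge_pt (side T i x) w \<in> K})"
    proof (intro equalityI subsetI)
      fix z assume z: "z \<in> {z \<in> poly. tile_pt x z \<in> K}"
      then have "z \<in> poly" "\<not> inner_pt z" using False by auto
      then obtain i u where "i < m" "u \<in> seg" "z = side_pt i u" using not_inner_ptE by metis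
      then show "z \<in> (\<Union>i<m. side_pt i ` {w \<in> seg. edge_pt (side T i x) w \<in> K})"
        using z tile_pt_side_pt[OF x] by auto
    next
      fix z assume "z \<in> (\<Union>i<m. side_pt i ` {w \<in> seg. edge_pt (side T i x) w \<in> K})"
      then show "z \<in> {z \<in> poly. tile_pt x z \<in> K}" using tile_pt_side_pt[OF x] side_pt_poly by auto
    qed
    moreover have "closed (\<Union>i<m. side_pt i ` {w \<in> seg. edge_pt (side T i x) w \<in> K})"
    proof (intro closed_UN ballI)
      show "closed (side_pt i ` {w \<in> seg. edge_pt (side T i x) w \<in> K})" if "i \<in> {..<m}" for i
        using E[OF side_edges[OF _ x]] that by (intro compact_imp_closed compact_continuous_image side_pt_continuous) auto
    qed simp
    ultimately show ?thesis by simp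
  qed
  have "\<forall>a \<in> all_cells. closed {z \<in> cell_space m a. f (a, z) \<in> K}"
    using V T' compact_imp_closed[OF E] unfolding all_cells_eq edge_pt_def tile_pt_def
    by (auto simp del: model_space.simps)
  then show ?thesis using real K unfolding realizes_def by blast
qed

text \<open>The open star of the open cell containing \<open>q\<close>, written as the complement of
  all closed cells missing \<open>q\<close> so that openness follows from
  \<open>closed_subcomplex\<close>.\<close>

definition star_at :: "'a \<Rightarrow> 'a set" where
  "star_at q = S - ((\<Union>x \<in> {x \<in> tiles T. q \<notin> body x}. body x) \<union>
     (\<Union>e \<in> {e \<in> edges T. q \<notin> line e}. line e) \<union> (vert_pt ` {v \<in> verts T. vert_pt v \<noteq> q}))"

lemma star_at_open: "openin (top_of_set S) (star_at q)"
proof -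
  let ?K = "(\<Union>x \<in> {x \<in> tiles T. q \<notin> body x}. body x) \<union>
     (\<Union>e \<in> {e \<in> edges T. q \<notin> line e}. line e) \<union> (vert_pt ` {v \<in> verts T. vert_pt v \<noteq> q})"
  have "closedin (top_of_set S) ?K"
  proof (rule closed_subcomplex)
    show "?K \<subseteq> S" using in_S by blast
    show "body x \<subseteq> ?K" if x: "x \<in> tiles T" "inner_pt z" "tile_pt x z \<in> ?K" for x z
    proof -
      have "tile_pt x z \<notin> vert_pt ` verts T" using tile_pt_inner_ne_vert_pt x by blast
      moreover have "tile_pt x z \<notin> line e" if "e \<in> edges T" for e using inner_not_in_line x that by blast
      ultimately obtain y where y: "y \<in> tiles T" "q \<notin> body y" "tile_pt x z \<in> body y" using x(3) by blast
      have "y = x" using inner_in_body[OF x(1) y(1) x(2) y(3)] .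
      then show ?thesis using y(1,2) by auto
    qed
    show "line e \<subseteq> ?K" if e: "e \<in> edges T" "z \<in> seg" "z \<noteq> 0" "z \<noteq> 1" "edge_pt e z \<in> ?K" for e z
    proof -
      have "edge_pt e z \<notin> vert_pt ` verts T" using edge_pt_open_ne_vert_pt e(1-4) by blast
      then have "(\<exists>y\<in>tiles T. q \<notin> body y \<and> edge_pt e z \<in> body y) \<or> (\<exists>e'\<in>edges T. q \<notin> line e' \<and> edge_pt e z \<in> line e')"
        using e(5) by auto
      then show ?thesis
      proof (elim disjE bexE conjE)
        fix y assume y: "y \<in> tiles T" "q \<notin> body y" "edge_pt e z \<in> body y"
        obtain i where i: "i < m" "side T i y = e" using open_edge_in_body[OF e(1) y(1) e(2-4) y(3)] by blast
        have "line e \<subseteq> body y" using line_subset_body[OF y(1) i(1)] i(2) by simp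
        then show ?thesis using y(1,2) by auto
      next
        fix e' assume e': "e' \<in> edges T" "q \<notin> line e'" "edge_pt e z \<in> line e'"
        have "e' = e" using open_edge_in_line[OF e(1) e'(1) e(2-4) e'(3)] .
        then show ?thesis using e'(1,2) by auto
      qed
    qed
  qed
  then show ?thesis
    unfolding star_at_def by (intro openin_diff) auto
qed

lemma star_at_self: "q \<in> S \<Longrightarrow> q \<in> star_at q"
  by (auto simp: star_at_def)

lemma star_atD:
  assumes "u \<in> star_at q"
  shows "u \<in> S" "x \<in> tiles T \<Longrightarrow> u \<in> body x \<Longrightarrow> q \<in> body x"
    "e \<in> edges T \<Longrightarrow> u \<in> line e \<Longrightarrow> q \<in> line e" "v \<in> verts T \<Longrightarrow> u = vert_pt v \<Longrightarrow> u = q"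
  using assms unfolding star_at_def by blast+

section \<open>The planar chart and invariance of domain\<close>

lemma k_chart:
  shows k_in: "k w \<in> S" "k w \<notin> P" and k'_k: "k' (k w) = w"
    and k_k': "q \<in> S \<Longrightarrow> q \<notin> P \<Longrightarrow> k (k' q) = q"
    and k_cont: "continuous_on UNIV k" and k'_cont: "continuous_on (S - P) k'"
  using chart unfolding homeomorphism_def by auto

lemma k_inj: "k u = k w \<Longrightarrow> u = w"
  by (metis k'_k)

lemma k'_inj: "p \<in> S - P \<Longrightarrow> q \<in> S - P \<Longrightarrow> k' p = k' q \<Longrightarrow> p = q"
  using k_k' by (metis DiffE)

lemma k_vimage_open:
  assumes "openin (top_of_set S) W" shows "open (k -` W)"
proof -
  obtain V where "open V" "W = S \<inter> V" using assms by (auto simp: openin_open)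
  then show ?thesis using k_in open_vimage[OF _ k_cont, of V] by (simp add: vimage_def)
qed

lemma k_vimage_closed:
  assumes "closedin (top_of_set S) W" shows "closed (k -` W)"
proof -
  obtain V where "closed V" "W = S \<inter> V" using assms by (auto simp: closedin_closed)
  then show ?thesis using k_in closed_vimage[OF _ k_cont, of V] by (simp add: vimage_def)
qed

lemma edge_pt_open_not_P: "e \<in> edges T \<Longrightarrow> z \<in> seg \<Longrightarrow> z \<noteq> 0 \<Longrightarrow> z \<noteq> 1 \<Longrightarrow> edge_pt e z \<notin> P"
  using puncture edge_pt_open_ne_vert_pt[of e v0 z] unfolding vert_pt_def by blast

lemma tile_pt_inner_not_P: "x \<in> tiles T \<Longrightarrow> inner_pt z \<Longrightarrow> tile_pt x z \<notin> P"
  using puncture tile_pt_inner_ne_vert_pt[of x v0 z] unfolding vert_pt_def by blast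

lemma edge_pt_S: "e \<in> edges T \<Longrightarrow> z \<in> seg \<Longrightarrow> edge_pt e z \<in> S"
  using in_S(2) unfolding line_def by blast

lemma tile_pt_S: "x \<in> tiles T \<Longrightarrow> z \<in> poly \<Longrightarrow> tile_pt x z \<in> S"
  using in_S(3) unfolding body_def by blast

text \<open>The chart followed by the inverse of \<open>g\<close> maps an open planar set
  injectively and continuously into \<open>D\<close>, hence onto an open set by invariance of
  domain. So an embedded planar piece can cover a neighbourhood only of images of its interior
  points.\<close>

lemma neighbourhood_in_image:
  fixes g :: "complex \<Rightarrow> 'a"
  assumes D: "compact D" "continuous_on D g" "inj_on g D"
    and W: "openin (top_of_set S) W" "q \<in> W" "q \<notin> P" "W \<subseteq> g ` D"
  shows "\<exists>U. open U \<and> U \<subseteq> D \<and> q \<in> g ` U"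
proof -
  define h where "h = inv_into D g \<circ> k"
  have V: "open (k -` W)" using k_vimage_open W by blast
  have inv: "continuous_on (g ` D) (inv_into D g)"
    using D by (intro continuous_on_inv) auto
  have "continuous_on (k -` W) h"
    unfolding h_def using W(4)
    by (intro continuous_on_compose continuous_on_subset[OF k_cont] continuous_on_subset[OF inv]) auto
  moreover have gh: "g (h u) = k u" if "u \<in> k -` W" for u
    using that W(4) f_inv_into_f[of "k u" g D] by (auto simp: h_def)
  then have "inj_on h (k -` W)" by (intro inj_onI) (metis k_inj)
  ultimately have "open (h ` (k -` W))" using V invariance_of_domain by blast
  moreover have "h ` (k -` W) \<subseteq> D"
    using W(4) inv_into_into[of _ g D] by (auto simp: h_def)
  moreover have "q \<in> S" using W(1,2) openin_imp_subset by blast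
  then have "k (k' q) = q" using k_k' W(3) by blast
  then have "g (h (k' q)) = q" "h (k' q) \<in> h ` (k -` W)" using gh[of "k' q"] W(2) by auto
  then have "q \<in> g ` h ` (k -` W)" by (metis imageI)
  ultimately show ?thesis by blast
qed

section \<open>Every edge lies on exactly two tiles\<close>

definition tiles_of :: "'e \<Rightarrow> 't set" where
  "tiles_of e = {x \<in> tiles T. \<exists>i<m. side T i x = e}"

text \<open>Reflectivity supplies one index valid for both tiles; as distinct sides of a tile are
  distinct edges, it equals both \<open>i\<close> and \<open>j\<close>.\<close>

lemma same_side:
  assumes "x \<in> tiles T" "y \<in> tiles T" "x \<noteq> y" "i < m" "j < m" "side T i x = side T j y"
  shows "i = j"
proof -
  have "side T i x \<in> (\<lambda>i. side T i x) ` {..<m}" using assms(4) by simp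
  moreover have "side T i x \<in> (\<lambda>i. side T i y) ` {..<m}" using assms(5,6) by simp
  ultimately obtain l where "l < m" "side T i x = side T l x" "side T i x = side T l y"
    using refl assms(1-3) unfolding reflective_def by blast
  then show ?thesis using side_inj assms by metis
qed

definition mid :: complex where "mid = complex_of_real (1/2)"

lemma mid: "mid \<in> seg" "mid \<noteq> 0" "mid \<noteq> 1"
  unfolding mid_def of_real_eq_0_iff of_real_eq_1_iff by (rule segI) simp_all

lemma star_at_mid:
  assumes e: "e \<in> edges T" and u: "u \<in> star_at (edge_pt e mid)"
  shows "u \<in> line e \<or> (\<exists>x\<in>tiles_of e. u \<in> body x)"
  using star_atD(1)[OF u]
proof (cases rule: point_cases)
  case (vertex v)
  then show ?thesis using star_atD(4)[OF u vertex] e edge_pt_open_ne_vert_pt mid by metis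
next
  case (edge e' z)
  then have "u \<in> line e'" by (auto simp: line_def)
  then show ?thesis using star_atD(3)[OF u edge(1)] open_edge_in_line[OF e edge(1) mid] by blast
next
  case (tile x z)
  then have "u \<in> body x" using inner_poly by (auto simp: body_def)
  then show ?thesis
    using star_atD(2)[OF u tile(1)] open_edge_in_body[OF e tile(1) mid] tile(1) unfolding tiles_of_def by blast
qed

lemma mid_not_P: "e \<in> edges T \<Longrightarrow> edge_pt e mid \<in> S \<and> edge_pt e mid \<notin> P"
  using edge_pt_open_not_P edge_pt_S mid by blast

text \<open>Otherwise the segment alone would cover a neighbourhood of the midpoint, but it has
  empty interior in the plane.\<close>

lemma edge_on_tile: assumes e: "e \<in> edges T" shows "tiles_of e \<noteq> {}"
proof
  assume "tiles_of e = {}"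
  then have "star_at (edge_pt e mid) \<subseteq> edge_pt e ` seg" using star_at_mid[OF e] by (auto simp: line_def)
  moreover have "compact seg" by (simp add: seg_def)
  moreover have "edge_pt e mid \<in> star_at (edge_pt e mid)" "edge_pt e mid \<notin> P" using star_at_self mid_not_P[OF e] by blast+
  ultimately obtain U where U: "open U" "U \<subseteq> seg" "edge_pt e mid \<in> edge_pt e ` U"
    using neighbourhood_in_image[OF _ edge_pt_cont[OF e] edge_pt_inj[OF e] star_at_open] by metis
  then obtain z where "z \<in> U" by blast
  then obtain r where r: "r > 0" "cball z r \<subseteq> U" using U open_contains_cball by blast
  then have "z + \<i> * of_real r \<in> U" by (auto simp: dist_norm norm_mult)
  moreover have "Im u = 0" if "u \<in> U" for u using that U(2) by (auto elim!: segE)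
  ultimately have "Im z = 0" "Im (z + \<i> * of_real r) = 0" using \<open>z \<in> U\<close> by blast+
  then show False using r by simp
qed

text \<open>A single tile would cover a neighbourhood of the midpoint, putting a point of one of its
  sides into the interior of the polygon.\<close>

lemma edge_not_on_one_tile: assumes e: "e \<in> edges T" shows "tiles_of e \<noteq> {x}"
proof
  assume x: "tiles_of e = {x}"
  then obtain i where i: "x \<in> tiles T" "i < m" "side T i x = e" unfolding tiles_of_def by blast
  then have "star_at (edge_pt e mid) \<subseteq> tile_pt x ` poly"
    using star_at_mid[OF e] x line_subset_body[of x i] by (auto simp: body_def)
  moreover have "edge_pt e mid \<in> star_at (edge_pt e mid)" "edge_pt e mid \<notin> P" using star_at_self mid_not_P[OF e] by blast+
  ultimately obtain U where U: "open U" "U \<subseteq> poly" "edge_pt e mid \<in> tile_pt x ` U"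
    using neighbourhood_in_image[OF poly_compact tile_pt_cont[OF i(1)] tile_pt_inj[OF i(1)] star_at_open] by metis
  then have "tile_pt x (side_pt i mid) \<in> tile_pt x ` U" using tile_pt_side_pt[OF i(1,2) mid(1)] i(3) by simp
  then have "side_pt i mid \<in> U"
    using inj_on_image_mem_iff[OF tile_pt_inj[OF i(1)] side_pt_poly[OF i(2) mid(1)] U(2)] by blast
  then show False using side_pt_not_interior[OF i(2) mid(1) U(1,2)] by blast
qed

text \<open>Moving towards the centre of the tile enters its inner points at once and stays off
  \<open>P\<close>.\<close>

lemma inner_pt_near:
  assumes x: "x \<in> tiles T" "z \<in> poly" "tile_pt x z \<notin> P" and V: "open V" "k' (tile_pt x z) \<in> V"
  shows "\<exists>z'. inner_pt z' \<and> k' (tile_pt x z') \<in> V"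
proof -
  define g where "g t = tile_pt x ((1 - t) *\<^sub>R z)" for t :: real
  have g_in: "g t \<in> S - P" if "t \<in> {0..1}" for t
  proof (cases "t = 0")
    case True
    then show ?thesis using x tile_pt_S by (simp add: g_def)
  next
    case False
    then have "inner_pt ((1 - t) *\<^sub>R z)" using that x(2) by (intro inner_pt_scale) auto
    then show ?thesis using x(1) tile_pt_S tile_pt_inner_not_P inner_poly by (simp add: g_def)
  qed
  have "continuous_on {0..1} g"
    unfolding g_def
    by (rule continuous_on_compose2[OF tile_pt_cont[OF x(1)]]) (use scale_poly[OF x(2)] in \<open>auto intro!: continuous_intros\<close>)
  then have "continuous_on {0..1} (\<lambda>t. k' (g t))"
    by (rule continuous_on_compose2[OF k'_cont]) (use g_in in blast)
  then have "openin (top_of_set {0..1}) ({0..1} \<inter> (\<lambda>t. k' (g t)) -` V)"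
    using V(1) by (rule continuous_openin_preimage_gen)
  moreover have "0 \<in> {0..1} \<inter> (\<lambda>t. k' (g t)) -` V" using V(2) by (simp add: g_def)
  ultimately obtain r where r: "r > 0" "ball 0 r \<inter> {0..1} \<subseteq> {0..1} \<inter> (\<lambda>t. k' (g t)) -` V"
    unfolding openin_contains_ball by blast
  define t where "t = min (r/2) 1"
  have t: "0 < t" "t \<le> 1" "t \<in> ball 0 r \<inter> {0..1}" using r(1) by (auto simp: t_def min_def)
  then have "k' (g t) \<in> V" using r(2) by blast
  moreover have "inner_pt ((1 - t) *\<^sub>R z)" using t x(2) by (intro inner_pt_scale) auto
  ultimately show ?thesis unfolding g_def by blast
qed

text \<open>The product with the normal recovers the scale, and \<open>side_pt_inj\<close> then the
  position along the side.\<close>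

lemma polar_eq:
  assumes "i < m" "a *\<^sub>R side_pt i z = b *\<^sub>R side_pt i w" "z \<in> seg" "w \<in> seg" "a \<noteq> 0"
  shows "a = b \<and> z = w"
proof -
  have "side_normal i \<bullet> (a *\<^sub>R side_pt i z) = side_normal i \<bullet> (b *\<^sub>R side_pt i w)" using assms(2) by simp
  then have "a = b" using side_normal_side_pt_self[OF assms(1)] assms(3,4) apothem_pos by simp
  then show ?thesis using assms side_pt_inj by simp
qed

text \<open>Two tiles on \<open>e\<close> form an open disc around the midpoint of \<open>e\<close>; by invariance of domain it is a neighbourhood
  of the midpoint, hence contains interior points of any third tile on \<open>e\<close>.\<close>

lemma edge_not_on_three_tiles:
  assumes e: "e \<in> edges T" and xyw: "x \<in> tiles_of e" "y \<in> tiles_of e" "w \<in> tiles_of e" "x \<noteq> y"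
  shows "w = x \<or> w = y"
proof (rule ccontr)
  assume "\<not> (w = x \<or> w = y)"
  then have ne: "w \<noteq> x" "w \<noteq> y" by auto
  have T': "x \<in> tiles T" "y \<in> tiles T" "w \<in> tiles T" using xyw by (auto simp: tiles_of_def)
  obtain i where i: "i < m" "side T i x = e" using xyw by (auto simp: tiles_of_def)
  obtain j where j: "j < m" "side T j y = e" using xyw by (auto simp: tiles_of_def)
  obtain l where l: "l < m" "side T l w = e" using xyw by (auto simp: tiles_of_def)
  have "i = j" using same_side[OF T'(1,2) xyw(4) i(1) j(1)] i j by simp
  have "l = i" using same_side[OF T'(3,1) ne(1) l(1) i(1)] i l by simp
  have sides: "side T i x = e" "side T i y = e" "side T i w = e" using i j l \<open>i = j\<close> \<open>l = i\<close> by auto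
  \<comment> \<open>Coordinates around the open edge: the real part runs along \<open>e\<close>, the
    imaginary part measures how far to shrink towards the centre of \<open>x\<close> (above) or of
    \<open>y\<close> (below).\<close>
  define Q where "Q = box (Complex 0 (-1)) (Complex 1 1)"
  have Q: "u \<in> Q \<longleftrightarrow> 0 < Re u \<and> Re u < 1 \<and> -1 < Im u \<and> Im u < 1" for u
    by (auto simp: Q_def in_box_complex_iff)
  define r where "r u = complex_of_real (Re u)" for u
  have r: "r u \<in> seg" "r u \<noteq> 0" "r u \<noteq> 1" if "u \<in> Q" for u
    using that unfolding r_def by (auto simp: Q intro: segI)
  have r_cont: "continuous_on A r" for A unfolding r_def by (intro continuous_intros)
  define \<psi>1 where "\<psi>1 u = tile_pt x ((1 - Im u) *\<^sub>R side_pt i (r u))" for u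
  define \<psi>2 where "\<psi>2 u = tile_pt y ((1 + Im u) *\<^sub>R side_pt i (r u))" for u
  define \<psi> where "\<psi> u = (if Im u \<le> 0 then \<psi>2 u else \<psi>1 u)" for u
  have in1: "(1 - Im u) *\<^sub>R side_pt i (r u) \<in> poly" if "u \<in> Q" "0 \<le> Im u" for u
    using that r[OF that(1)] i(1) by (intro scale_poly side_pt_poly) (auto simp: Q)
  have in2: "(1 + Im u) *\<^sub>R side_pt i (r u) \<in> poly" if "u \<in> Q" "Im u \<le> 0" for u
    using that r[OF that(1)] i(1) by (intro scale_poly side_pt_poly) (auto simp: Q)
  have inn1: "inner_pt ((1 - Im u) *\<^sub>R side_pt i (r u))" if "u \<in> Q" "0 < Im u" for u
    using that r[OF that(1)] i(1) by (intro inner_pt_scale side_pt_poly) (auto simp: Q)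
  have inn2: "inner_pt ((1 + Im u) *\<^sub>R side_pt i (r u))" if "u \<in> Q" "Im u < 0" for u
    using that r[OF that(1)] i(1) by (intro inner_pt_scale side_pt_poly) (auto simp: Q)
  have on_e: "\<psi>1 u = edge_pt e (r u)" "\<psi>2 u = edge_pt e (r u)" if "u \<in> Q" "Im u = 0" for u
    using that tile_pt_side_pt[OF T'(1) i(1) r(1)] tile_pt_side_pt[OF T'(2) i(1) r(1)] sides by (auto simp: \<psi>1_def \<psi>2_def)
  have "continuous_on Q \<psi>"
    unfolding \<psi>_def
  proof (rule continuous_on_cases_le)
    show "continuous_on {t \<in> Q. Im t \<le> 0} \<psi>2"
      unfolding \<psi>2_def by (rule continuous_on_compose2[OF tile_pt_cont[OF T'(2)]])
        (use in2 in \<open>auto intro!: continuous_intros continuous_on_compose2[OF side_pt_continuous r_cont]\<close>)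
    show "continuous_on {t \<in> Q. 0 \<le> Im t} \<psi>1"
      unfolding \<psi>1_def by (rule continuous_on_compose2[OF tile_pt_cont[OF T'(1)]])
        (use in1 in \<open>auto intro!: continuous_intros continuous_on_compose2[OF side_pt_continuous r_cont]\<close>)
    show "\<psi>2 u = \<psi>1 u" if "u \<in> Q" "Im u = 0" for u using on_e that by simp
  qed (intro continuous_intros)
  moreover have in_SP: "\<psi> u \<in> S - P" if u: "u \<in> Q" for u
  proof -
    consider "Im u < 0" | "Im u = 0" | "0 < Im u" by linarith
    then show ?thesis
    proof cases
      case 1
      then show ?thesis
        using inn2[OF u] T' tile_pt_S[OF _ inner_poly] tile_pt_inner_not_P by (simp add: \<psi>_def \<psi>2_def)
    next
      case 2
      then show ?thesis using on_e[OF u] r[OF u] edge_pt_open_not_P[OF e] edge_pt_S[OF e] by (simp add: \<psi>_def)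
    next
      case 3
      then show ?thesis
        using inn1[OF u] T' tile_pt_S[OF _ inner_poly] tile_pt_inner_not_P by (simp add: \<psi>_def \<psi>1_def)
    qed
  qed
  ultimately have cont: "continuous_on Q (\<lambda>u. k' (\<psi> u))"
    by (intro continuous_on_compose2[OF k'_cont]) auto
  have recover: "u = v" if "u \<in> Q" "v \<in> Q" "Im u = Im v" "r u = r v" for u v
    using that by (simp add: r_def complex_eq_iff)
  have psi_le: "\<psi> u = \<psi>2 u" if "u \<in> Q" "Im u \<le> 0" for u using that by (simp add: \<psi>_def)
  have psi_ge: "\<psi> u = \<psi>1 u" if "u \<in> Q" "0 \<le> Im u" for u
    using that on_e[of u] by (auto simp: \<psi>_def)
  have inj: "u = v" if uv: "u \<in> Q" "v \<in> Q" "\<psi> u = \<psi> v" for u v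
  proof -
    \<comment> \<open>Off the real axis images are inner points of one tile, so both the tile and
      the polar coordinates are determined; on the axis \<open>edge_pt\<close> is injective.\<close>
    have neg: "u = v" if uv: "u \<in> Q" "v \<in> Q" "\<psi> u = \<psi> v" and "Im u < 0" for u v
    proof (cases "Im v \<le> 0")
      case True
      then have eq: "(1 + Im u) *\<^sub>R side_pt i (r u) = (1 + Im v) *\<^sub>R side_pt i (r v)"
        using tile_pt_inner_eq[OF T'(2,2) inn2[OF uv(1) \<open>Im u < 0\<close>] in2[OF uv(2) True]] uv psi_le \<open>Im u < 0\<close>
        by (simp add: \<psi>2_def)
      have "1 - Im u \<noteq> 0" "1 + Im u \<noteq> 0" using uv(1) by (auto simp: Q)
      then show ?thesis
        using polar_eq[OF i(1) eq r(1)[OF uv(1)] r(1)[OF uv(2)]] recover[OF uv(1,2)] by simp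
    next
      case False
      then show ?thesis
        using tile_pt_inner_eq[OF T'(2,1) inn2[OF uv(1) \<open>Im u < 0\<close>] in1[OF uv(2)]] uv psi_le[OF uv(1)] psi_ge[OF uv(2)]
          \<open>Im u < 0\<close> xyw(4) by (simp add: \<psi>1_def \<psi>2_def)
    qed
    have pos: "u = v" if uv: "u \<in> Q" "v \<in> Q" "\<psi> u = \<psi> v" and "Im u > 0" for u v
    proof (cases "Im v \<ge> 0")
      case True
      then have eq: "(1 - Im u) *\<^sub>R side_pt i (r u) = (1 - Im v) *\<^sub>R side_pt i (r v)"
        using tile_pt_inner_eq[OF T'(1,1) inn1[OF uv(1) \<open>Im u > 0\<close>] in1[OF uv(2) True]] uv psi_ge \<open>Im u > 0\<close>
        by (simp add: \<psi>1_def)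
      have "1 - Im u \<noteq> 0" "1 + Im u \<noteq> 0" using uv(1) by (auto simp: Q)
      then show ?thesis
        using polar_eq[OF i(1) eq r(1)[OF uv(1)] r(1)[OF uv(2)]] recover[OF uv(1,2)] by simp
    next
      case False
      then show ?thesis
        using tile_pt_inner_eq[OF T'(1,2) inn1[OF uv(1) \<open>Im u > 0\<close>] in2[OF uv(2)]] uv psi_ge[OF uv(1)] psi_le[OF uv(2)]
          \<open>Im u > 0\<close> xyw(4) by (simp add: \<psi>1_def \<psi>2_def)
    qed
    show ?thesis
    proof (cases "Im u = 0 \<and> Im v = 0")
      case True
      then have "edge_pt e (r u) = edge_pt e (r v)" using on_e[OF uv(1)] on_e[OF uv(2)] psi_ge[OF uv(1)] psi_ge[OF uv(2)] uv(3) by simp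
      then have "r u = r v" using inj_onD[OF edge_pt_inj[OF e]] r(1)[OF uv(1)] r(1)[OF uv(2)] by blast
      then show ?thesis using recover[OF uv(1,2)] True by simp
    next
      case False
      then consider "Im u < 0" | "Im u > 0" | "Im v < 0" | "Im v > 0" by linarith
      then show ?thesis
        by cases (fact neg[OF uv] pos[OF uv] neg[OF uv(2,1) uv(3)[symmetric], symmetric]
            pos[OF uv(2,1) uv(3)[symmetric], symmetric])+
    qed
  qed
  have "inj_on (\<lambda>u. k' (\<psi> u)) Q"
    by (intro inj_onI inj) (use k'_inj in_SP in blast)+
  then have op: "open ((\<lambda>u. k' (\<psi> u)) ` Q)"
    using invariance_of_domain[OF cont] open_box unfolding Q_def by blast
  have u0: "Complex (1/2) 0 \<in> Q" "r (Complex (1/2) 0) = mid" by (auto simp: Q r_def mid_def)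
  have "\<psi> (Complex (1/2) 0) = edge_pt e mid" using psi_ge[OF u0(1)] on_e[OF u0(1)] u0(2) by simp
  also have "\<dots> = tile_pt w (side_pt i mid)" using tile_pt_side_pt[OF T'(3) i(1) mid(1)] sides by simp
  finally have eq: "tile_pt w (side_pt i mid) = \<psi> (Complex (1/2) 0)" by simp
  then have "k' (tile_pt w (side_pt i mid)) \<in> (\<lambda>u. k' (\<psi> u)) ` Q" using u0(1) by simp
  moreover have "tile_pt w (side_pt i mid) \<notin> P" using in_SP[OF u0(1)] eq by simp
  ultimately obtain z where z: "inner_pt z" "k' (tile_pt w z) \<in> (\<lambda>u. k' (\<psi> u)) ` Q"
    using inner_pt_near[OF T'(3) side_pt_poly[OF i(1) mid(1)] _ op] by blast
  then obtain u where u: "u \<in> Q" "k' (tile_pt w z) = k' (\<psi> u)" by blast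
  have "tile_pt w z \<in> S - P" using tile_pt_S[OF T'(3) inner_poly[OF z(1)]] tile_pt_inner_not_P[OF T'(3) z(1)] by blast
  then have "tile_pt w z = \<psi> u" using k'_inj in_SP[OF u(1)] u(2) by blast
  then show False
  proof (cases "Im u \<le> 0")
    case True
    then show ?thesis using \<open>tile_pt w z = \<psi> u\<close> psi_le[OF u(1)] tile_pt_inner_eq[OF T'(3,2) z(1) in2[OF u(1)]] ne by (simp add: \<psi>2_def)
  next
    case False
    then show ?thesis using \<open>tile_pt w z = \<psi> u\<close> psi_ge[OF u(1)] tile_pt_inner_eq[OF T'(3,1) z(1) in1[OF u(1)]] ne by (simp add: \<psi>1_def)
  qed
qed

lemma two_tiles:
  assumes "e \<in> edges T" shows "\<exists>x y. x \<noteq> y \<and> tiles_of e = {x, y}"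
proof -
  obtain x where x: "x \<in> tiles_of e" using edge_on_tile[OF assms] by blast
  obtain y where y: "y \<in> tiles_of e" "y \<noteq> x" using edge_not_on_one_tile[OF assms, of x] x by blast
  have "w = x \<or> w = y" if "w \<in> tiles_of e" for w
    using edge_not_on_three_tiles[OF assms x y(1) that] y(2) by blast
  then have "tiles_of e = {x, y}" using x y by blast
  then show ?thesis using y(2) by blast
qed

text \<open>\<open>two_tiles\<close> makes the \<open>THE\<close> in \<open>tile_across\<close>
  meaningful; reflectivity gives the shared edge the same index \<open>i\<close> in the other
  tile.\<close>

lemma tile_across:
  assumes x: "x \<in> tiles T" and i: "i < m"
  shows "tile_across m T i x \<in> tiles T" "tile_across m T i x \<noteq> x"
    "side T i (tile_across m T i x) = side T i x"
    "y \<in> tiles T \<Longrightarrow> y \<noteq> x \<Longrightarrow> side T i y = side T i x \<Longrightarrow> y = tile_across m T i x"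
proof -
  let ?R = "\<lambda>y. y \<in> tiles T \<and> y \<noteq> x \<and> side T i x \<in> (\<lambda>j. side T j y) ` {..<m}"
  obtain u v where uv: "u \<noteq> v" "tiles_of (side T i x) = {u, v}" using two_tiles[OF side_edges[OF i x]] by blast
  have R: "?R y \<longleftrightarrow> y \<in> {u, v} \<and> y \<noteq> x" for y
    unfolding uv(2)[symmetric] tiles_of_def image_def by (simp add: eq_commute[of "side T i x"]) blast
  have "x \<in> {u, v}" unfolding uv(2)[symmetric] tiles_of_def using x i by blast
  then have ex: "\<exists>!y. ?R y" unfolding R using uv(1) by auto
  have R': "?R (tile_across m T i x)" unfolding tile_across_def by (rule theI'[OF ex])
  then show "tile_across m T i x \<in> tiles T" "tile_across m T i x \<noteq> x" by auto
  obtain j where "j < m" "side T i x = side T j (tile_across m T i x)" using R' by auto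
  then show "side T i (tile_across m T i x) = side T i x"
    using same_side[of x "tile_across m T i x" i j] R' x i by metis
  show "y = tile_across m T i x" if "y \<in> tiles T" "y \<noteq> x" "side T i y = side T i x"
  proof -
    have "side T i x \<in> (\<lambda>j. side T j y) ` {..<m}" using that(3) i by (metis image_eqI lessThan_iff)
    then have "?R y" using that by blast
    then show ?thesis using ex R' by blast
  qed
qed

section \<open>Tiles around a point\<close>

definition tiles_at :: "'a \<Rightarrow> 't set" where "tiles_at q = {x \<in> tiles T. q \<in> body x}"

text \<open>The common edge has to pass through \<open>q\<close>: tiles that meet at a vertex but
  share an edge elsewhere are not adjacent there.\<close>

definition adj_at :: "'a \<Rightarrow> 't \<Rightarrow> 't \<Rightarrow> bool" where
  "adj_at q x y \<longleftrightarrow> x \<in> tiles T \<and> y \<in> tiles T \<and> x \<noteq> y \<and>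
     (\<exists>i<m. side T i x = side T i y \<and> q \<in> line (side T i x))"

lemma adj_at_tiles: "adj_at q x y \<Longrightarrow> x \<in> tiles_at q \<and> y \<in> tiles_at q"
  unfolding adj_at_def tiles_at_def using line_subset_body by fastforce

lemma tiles_of_subset_tiles_at: "q \<in> line e \<Longrightarrow> tiles_of e \<subseteq> tiles_at q"
  unfolding tiles_of_def tiles_at_def using line_subset_body by blast

lemma tiles_at_nonempty:
  assumes "q \<in> S" shows "tiles_at q \<noteq> {}"
  using assms
proof (cases rule: point_cases)
  case (vertex v)
  then have "{e \<in> edges T. src T e = v \<or> tgt T e = v} \<noteq> {}"
    using degree[of v] n(1) by (metis card.empty less_irrefl)
  then obtain e where "e \<in> edges T" "q \<in> line e" using vertex vertex_in_line by blast
  then show ?thesis using tiles_of_subset_tiles_at edge_on_tile by blast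
next
  case (edge e z)
  then have "q \<in> line e" by (auto simp: line_def)
  then show ?thesis using tiles_of_subset_tiles_at edge_on_tile edge(1) by blast
next
  case (tile x z)
  then show ?thesis using inner_poly by (auto simp: tiles_at_def body_def)
qed

text \<open>Upper semicontinuity: moving away from \<open>q\<close> within its open star can only
  lose tiles and adjacencies.\<close>

lemma star_at_upper:
  assumes "u \<in> star_at q"
  shows "tiles_at u \<subseteq> tiles_at q" "adj_at u x y \<Longrightarrow> adj_at q x y"
  using star_atD(2,3)[OF assms] side_edges unfolding tiles_at_def adj_at_def by blast+

lemma tiles_at_inner: "x \<in> tiles T \<Longrightarrow> inner_pt z \<Longrightarrow> tiles_at (tile_pt x z) = {x}"
  using inner_in_body inner_poly unfolding tiles_at_def body_def by blast

lemma tiles_at_open_edge: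
  assumes "e \<in> edges T" "z \<in> seg" "z \<noteq> 0" "z \<noteq> 1" shows "tiles_at (edge_pt e z) = tiles_of e"
proof
  show "tiles_at (edge_pt e z) \<subseteq> tiles_of e"
    using open_edge_in_body[OF assms(1) _ assms(2-4)] unfolding tiles_at_def tiles_of_def by blast
  show "tiles_of e \<subseteq> tiles_at (edge_pt e z)"
    using assms by (intro tiles_of_subset_tiles_at) (auto simp: line_def)
qed

lemma tiles_of_adj:
  assumes "x \<in> tiles_of e" "y \<in> tiles_of e" "x \<noteq> y" "q \<in> line e" shows "adj_at q x y"
proof -
  obtain i j where ij: "i < m" "side T i x = e" "j < m" "side T j y = e" "x \<in> tiles T" "y \<in> tiles T"
    using assms by (auto simp: tiles_of_def)
  then have "i = j" using same_side[OF ij(5,6) assms(3) ij(1,3)] by simp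
  then show ?thesis using ij assms unfolding adj_at_def by metis
qed

lemma closedin_bodies: "A \<subseteq> tiles T \<Longrightarrow> closedin (top_of_set S) (\<Union>x\<in>A. body x)"
proof (rule closed_subcomplex)
  assume A: "A \<subseteq> tiles T"
  show "(\<Union>x\<in>A. body x) \<subseteq> S" using A in_S by blast
  show "body x \<subseteq> (\<Union>x\<in>A. body x)" if t: "x \<in> tiles T" "inner_pt z" "tile_pt x z \<in> (\<Union>x\<in>A. body x)" for x z
  proof -
    obtain y where y: "y \<in> A" "tile_pt x z \<in> body y" using t(3) by blast
    then have "y = x" using inner_in_body[OF t(1) _ t(2)] A by blast
    then show ?thesis using y(1) by blast
  qed
  show "line e \<subseteq> (\<Union>x\<in>A. body x)"
    if t: "e \<in> edges T" "z \<in> seg" "z \<noteq> 0" "z \<noteq> 1" "edge_pt e z \<in> (\<Union>x\<in>A. body x)" for e z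
  proof -
    obtain y where y: "y \<in> A" "edge_pt e z \<in> body y" using t(5) by blast
    then obtain i where "i < m" "side T i y = e" using open_edge_in_body[OF t(1) _ t(2-4)] A by blast
    then show ?thesis using line_subset_body[of y i] y(1) A by blast
  qed
qed

text \<open>Otherwise the tiles in \<open>A\<close> and the remaining ones would disconnect a small punctured disc around the vertex.\<close>

lemma link_vertex:
  assumes v: "v \<in> verts T" "vert_pt v \<notin> P"
    and A: "A \<subseteq> tiles_at (vert_pt v)" "A \<noteq> {}" "\<And>x y. x \<in> A \<Longrightarrow> adj_at (vert_pt v) x y \<Longrightarrow> y \<in> A"
  shows "A = tiles_at (vert_pt v)"
proof (rule ccontr)
  assume "A \<noteq> tiles_at (vert_pt v)"
  define B where "B = tiles_at (vert_pt v) - A"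
  have B: "B \<noteq> {}" "B \<subseteq> tiles_at (vert_pt v)" using A(1) \<open>A \<noteq> tiles_at (vert_pt v)\<close> by (auto simp: B_def)
  define q where "q = vert_pt v"
  have q: "q \<in> S" "q \<notin> P" using v in_S by (auto simp: q_def)
  have "open (k -` star_at q)" using k_vimage_open star_at_open by blast
  moreover have "k' q \<in> k -` star_at q" using k_k'[OF q] star_at_self[OF q(1)] by simp
  ultimately obtain r where r: "r > 0" "ball (k' q) r \<subseteq> k -` star_at q"
    using open_contains_ball by blast
  define D where "D = ball (k' q) r - {k' q}"
  have "connected D" unfolding D_def by (rule connected_punctured_ball) simp
  define K where "K A = k -` (\<Union>x\<in>A. body x)" for A
  have tA: "A \<subseteq> tiles T" "B \<subseteq> tiles T" using A(1) B(2) by (auto simp: tiles_at_def)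
  have "closed (K A)" "closed (K B)" unfolding K_def using k_vimage_closed closedin_bodies tA by blast+
  moreover have "D \<subseteq> K A \<union> K B"
  proof
    fix u assume "u \<in> D"
    then have "k u \<in> star_at q" using r(2) by (auto simp: D_def)
    moreover obtain x where "x \<in> tiles_at (k u)" using tiles_at_nonempty[OF k_in(1)] by blast
    ultimately have "x \<in> A \<union> B" using star_at_upper(1) by (auto simp: B_def q_def)
    then show "u \<in> K A \<union> K B" using \<open>x \<in> tiles_at (k u)\<close> by (auto simp: K_def tiles_at_def)
  qed
  \<comment> \<open>Away from \<open>q\<close>, a point of both parts lies inside an edge through
    \<open>q\<close>; the two tiles of that edge are adjacent at \<open>q\<close>, so
    \<open>A\<close> contains both or neither.\<close>
  moreover have "K A \<inter> K B \<inter> D = {}"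
  proof (rule ccontr)
    assume "K A \<inter> K B \<inter> D \<noteq> {}"
    then obtain u x y where u: "u \<in> D" "x \<in> A" "y \<in> B" "k u \<in> body x" "k u \<in> body y"
      unfolding K_def by auto
    have st: "k u \<in> star_at q" using u(1) r(2) by (auto simp: D_def)
    have "x \<noteq> y" using u by (auto simp: B_def)
    from k_in(1)[of u] show False
    proof (cases rule: point_cases)
      case (vertex w)
      then have "k u = q" using star_atD(4)[OF st] by blast
      then show False using u(1) k'_k[of u] by (simp add: D_def)
    next
      case (edge e z)
      have "x \<in> tiles_of e" "y \<in> tiles_of e"
        using u tA tiles_at_open_edge[OF edge(1-4)] edge(5) by (auto simp: tiles_at_def)
      moreover have "k u \<in> line e" using edge by (auto simp: line_def)
      then have "q \<in> line e" using star_atD(3)[OF st edge(1)] by blast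
      ultimately have "adj_at q x y" using tiles_of_adj \<open>x \<noteq> y\<close> by blast
      then have "y \<in> A" using A(3)[OF u(2)] by (simp add: q_def)
      then show False using u(3) by (simp add: B_def)
    next
      case (tile w z)
      then have "tiles_at (k u) = {w}" using tiles_at_inner by simp
      moreover have "x \<in> tiles_at (k u)" "y \<in> tiles_at (k u)" using u tA by (auto simp: tiles_at_def)
      ultimately show False using \<open>x \<noteq> y\<close> by simp
    qed
  qed
  \<comment> \<open>A tile at \<open>q\<close> has inner points arbitrarily near \<open>q\<close>,
    so both parts survive the puncture.\<close>
  moreover have meets: "K A' \<inter> D \<noteq> {}" if A': "A' \<noteq> {}" "A' \<subseteq> tiles_at (vert_pt v)" for A'
  proof -
    obtain x where x: "x \<in> A'" "x \<in> tiles T" "q \<in> body x" using A' by (auto simp: tiles_at_def q_def)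
    then obtain z where z: "z \<in> poly" "q = tile_pt x z" by (auto simp: body_def)
    then obtain z' where z': "inner_pt z'" "k' (tile_pt x z') \<in> ball (k' q) r"
      using inner_pt_near[OF x(2) z(1), of "ball (k' q) r"] q(2) r(1) by auto
    have in_SP: "tile_pt x z' \<in> S" "tile_pt x z' \<notin> P"
      using tile_pt_S[OF x(2) inner_poly[OF z'(1)]] tile_pt_inner_not_P[OF x(2) z'(1)] by auto
    have "tile_pt x z' \<noteq> q" using tile_pt_inner_ne_vert_pt[OF x(2) v(1) z'(1)] by (simp add: q_def)
    then have "k' (tile_pt x z') \<noteq> k' q" using k_k'[OF in_SP] k_k'[OF q] by metis
    then have "k' (tile_pt x z') \<in> D" using z'(2) by (simp add: D_def)
    moreover have "k' (tile_pt x z') \<in> K A'"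
      using x(1) k_k'[OF in_SP] inner_poly[OF z'(1)] by (auto simp: K_def body_def)
    ultimately show ?thesis by blast
  qed
  ultimately show False
    using connected_closedD[OF \<open>connected D\<close>] meets[OF A(2,1)] meets[OF B] by blast
qed

lemma link_point:
  assumes q: "q \<in> S" "q \<notin> P"
    and A: "A \<subseteq> tiles_at q" "A \<noteq> {}" "\<And>x y. x \<in> A \<Longrightarrow> adj_at q x y \<Longrightarrow> y \<in> A"
  shows "A = tiles_at q"
  using q(1)
proof (cases rule: point_cases)
  case (vertex v)
  then show ?thesis using link_vertex assms by metis
next
  case (edge e z)
  have eq: "tiles_at q = tiles_of e" using tiles_at_open_edge[OF edge(1-4)] edge(5) by simp
  have "q \<in> line e" using edge by (auto simp: line_def)
  then have "y \<in> A" if "x \<in> A" "y \<in> tiles_at q" for x y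
    using tiles_of_adj[of x e y q] A that eq by (cases "x = y") auto
  then show ?thesis using A(1,2) by blast
next
  case (tile x z)
  then have "tiles_at q = {x}" using tiles_at_inner by simp
  then show ?thesis using A(1,2) by auto
qed

text \<open>\<open>P\<close> meets a tile at most in a corner, and a polygon without a corner is
  still connected; here it matters that the puncture is a vertex.\<close>

lemma connected_tile_preimage:
  assumes x: "x \<in> tiles T" shows "connected {w. x \<in> tiles_at (k w)}"
proof -
  define D where "D = {z \<in> poly. tile_pt x z \<notin> P}"
  have "D = poly \<or> (\<exists>l<m. D = poly - {C l})"
  proof (cases "\<exists>z\<in>poly. tile_pt x z \<in> P")
    case True
    then obtain z where z: "z \<in> poly" "tile_pt x z \<in> P" by blast
    then have P: "P = {vert_pt v0}" "tile_pt x z = vert_pt v0" using puncture by (auto simp: vert_pt_def)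
    then obtain l where l: "l < m" "corner T l x = v0"
      using vertex_in_body[OF x puncture(2)] z(1) unfolding body_def by (metis imageI)
    then have "tile_pt x (C l) = vert_pt v0" using tile_pt_corner x by simp
    then have "D = poly - {C l}"
      using P(1) inj_onD[OF tile_pt_inj[OF x]] corner_poly[OF l(1)] by (auto simp: D_def)
    then show ?thesis using l by blast
  qed (auto simp: D_def)
  then have "connected D" using poly_minus_corner_connected convex_connected[OF poly_convex] by auto
  moreover have "continuous_on D (\<lambda>z. k' (tile_pt x z))"
    by (rule continuous_on_compose2[OF k'_cont continuous_on_subset[OF tile_pt_cont[OF x]]])
      (use tile_pt_S[OF x] in \<open>auto simp: D_def\<close>)
  ultimately have "connected ((\<lambda>z. k' (tile_pt x z)) ` D)" by (rule connected_continuous_image[rotated])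
  also have "(\<lambda>z. k' (tile_pt x z)) ` D = {w. x \<in> tiles_at (k w)}"
  proof (intro equalityI subsetI)
    fix w assume "w \<in> (\<lambda>z. k' (tile_pt x z)) ` D"
    then show "w \<in> {w. x \<in> tiles_at (k w)}"
      using k_k'[OF tile_pt_S[OF x]] x by (auto simp: D_def tiles_at_def body_def)
  next
    fix w assume "w \<in> {w. x \<in> tiles_at (k w)}"
    then obtain z where z: "z \<in> poly" "k w = tile_pt x z" by (auto simp: tiles_at_def body_def)
    then have "z \<in> D" using k_in(2)[of w] by (simp add: D_def)
    then show "w \<in> (\<lambda>z. k' (tile_pt x z)) ` D" using z(2) k'_k[of w] by force
  qed
  finally show ?thesis .
qed

section \<open>Local solutions of the sign equation\<close>

lemma common_side_unique:
  assumes "x \<in> tiles T" "y \<in> tiles T" "x \<noteq> y" "i < m" "j < m"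
    and "side T i x = side T i y" "side T j x = side T j y"
  shows "i = j"
proof (rule ccontr)
  assume "i \<noteq> j"
  let ?I = "(\<lambda>i. side T i x) ` {..<m} \<inter> (\<lambda>i. side T i y) ` {..<m}"
  have "side T i x \<in> (\<lambda>i. side T i x) ` {..<m}" "side T j x \<in> (\<lambda>i. side T i x) ` {..<m}"
    using assms(4,5) by simp_all
  moreover have "side T i x \<in> (\<lambda>i. side T i y) ` {..<m}" "side T j x \<in> (\<lambda>i. side T i y) ` {..<m}"
    using assms(4-7) by simp_all
  ultimately have "card {side T i x, side T j x} \<le> card ?I" by (intro card_mono) auto
  moreover have "side T i x \<noteq> side T j x" using side_inj assms(1,4,5) \<open>i \<noteq> j\<close> by blast
  ultimately show False using common_sides[OF assms(1-3)] by simp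
qed

text \<open>For adjacent tiles the index is unique by \<open>common_side_unique\<close>. Dependence
  on a pair of tiles matches the crossing signs \<open>s\<close> of
  \<open>plane_links\<close>.\<close>

definition edge_sign :: "(nat \<Rightarrow> int) \<Rightarrow> 't \<Rightarrow> 't \<Rightarrow> int" where
  "edge_sign \<kappa> x y = \<kappa> (SOME i. i < m \<and> side T i x = side T i y)"

lemma edge_sign_eq:
  assumes "x \<in> tiles T" "y \<in> tiles T" "x \<noteq> y" "i < m" "side T i x = side T i y"
  shows "edge_sign \<kappa> x y = \<kappa> i"
proof -
  let ?j = "SOME i. i < m \<and> side T i x = side T i y"
  have "?j < m \<and> side T ?j x = side T ?j y" by (rule someI[of _ i]) (use assms in simp)
  then have "?j = i" using common_side_unique assms by blast
  then show ?thesis by (simp add: edge_sign_def)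
qed

text \<open>Crossing an edge through the vertex keeps the corner index: the edge has the same index
  in both tiles, and so have its ends. Hence \<open>link_vertex\<close> gives one corner
  \<open>l\<close> for all tiles there.\<close>

lemma vertex_tiles:
  assumes v: "v \<in> verts T" "vert_pt v \<notin> P"
  obtains l p where "l < m" "p < m" "l \<noteq> p"
    "\<And>x i. x \<in> tiles_at (vert_pt v) \<Longrightarrow> i < m \<Longrightarrow> vert_pt v \<in> line (side T i x) \<longleftrightarrow> i = l \<or> i = p"
proof -
  let ?X = "tiles_at (vert_pt v)"
  obtain x0 where x0: "x0 \<in> ?X" using tiles_at_nonempty in_S v by blast
  then obtain l where l: "l < m" "corner T l x0 = v" using vertex_in_body v by (auto simp: tiles_at_def)
  have ends_iff: "vert_pt v \<in> line (side T i x) \<longleftrightarrow> corner T (src_corner i) x = v \<or> corner T (tgt_corner i) x = v"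
    if "x \<in> tiles T" "i < m" for x i
    using vertex_in_line[OF side_edges[OF that(2,1)] v(1)] src_side[OF that(2,1)] tgt_side[OF that(2,1)] by simp
  have X: "x \<in> tiles T" if "x \<in> ?X" for x using that by (simp add: tiles_at_def)
  have "{x \<in> ?X. corner T l x = v} = ?X"
  proof (rule link_vertex[OF v])
    fix x y assume x: "x \<in> {x \<in> ?X. corner T l x = v}" and xy: "adj_at (vert_pt v) x y"
    then have t: "x \<in> tiles T" "y \<in> tiles T" "y \<in> ?X" using adj_at_tiles by (auto simp: adj_at_def)
    obtain i where i: "i < m" "side T i x = side T i y" "vert_pt v \<in> line (side T i x)"
      using xy by (auto simp: adj_at_def)
    have eq: "corner T (src_corner i) x = corner T (src_corner i) y" "corner T (tgt_corner i) x = corner T (tgt_corner i) y"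
      using src_side[OF i(1)] tgt_side[OF i(1)] t i(2) by metis+
    have "corner T (src_corner i) x = v \<or> corner T (tgt_corner i) x = v" using ends_iff[OF t(1) i(1)] i(3) by simp
    then have "src_corner i = l \<or> tgt_corner i = l" using corner_T_inj[OF t(1)] ends(4,5)[OF i(1)] l(1) x by auto
    then have "corner T l x = corner T l y" using eq by auto
    then show "y \<in> {x \<in> ?X. corner T l x = v}" using x t by simp
  qed (use x0 l in auto)
  then have corner: "corner T l x = v" if "x \<in> ?X" for x using that by blast
  \<comment> \<open>Side \<open>i\<close> joins corners \<open>i\<close> and \<open>i + 1\<close>,
    so the other side at corner \<open>l\<close> is its cyclic predecessor.\<close>
  define p where "p = (if l = 0 then m - 1 else l - 1)"
  have p: "p < m" "l \<noteq> p" using l(1) m3 by (auto simp: p_def)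
  have "vert_pt v \<in> line (side T i x) \<longleftrightarrow> i = l \<or> i = p" if "x \<in> ?X" "i < m" for x i
  proof -
    have "corner T j x = v \<longleftrightarrow> j = l" if "j < m" for j
      using corner_T_inj[OF X[OF \<open>x \<in> ?X\<close>] that l(1)] corner[OF \<open>x \<in> ?X\<close>] by auto
    then have "vert_pt v \<in> line (side T i x) \<longleftrightarrow> src_corner i = l \<or> tgt_corner i = l"
      using ends_iff[OF X[OF that(1)] that(2)] ends(4,5)[OF that(2)] by simp
    also have "\<dots> \<longleftrightarrow> i = l \<or> Suc i mod m = l" using ends(1)[OF that(2)] by auto
    also have "Suc i mod m = l \<longleftrightarrow> i = p" using that(2) l(1) m3 by (auto simp: p_def Suc_mod split: if_splits)
    finally show ?thesis .
  qed
  then show ?thesis using that[OF l(1) p(1) p(2)] by blast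
qed

text \<open>Edges of index \<open>l\<close> at the vertex pair up its tiles, and so do those of
  index \<open>p\<close>. The two families thus have equal size and together are the
  \<open>n\<close> edges at the vertex.\<close>

lemma card_tiles_at_vertex:
  assumes v: "v \<in> verts T" "vert_pt v \<notin> P"
    and lp: "l < m" "p < m" "l \<noteq> p"
    and on: "\<And>x i. x \<in> tiles_at (vert_pt v) \<Longrightarrow> i < m \<Longrightarrow> vert_pt v \<in> line (side T i x) \<longleftrightarrow> i = l \<or> i = p"
  shows "finite (tiles_at (vert_pt v)) \<and> card (tiles_at (vert_pt v)) = n"
proof -
  let ?X = "tiles_at (vert_pt v)"
  let ?Ev = "{e \<in> edges T. src T e = v \<or> tgt T e = v}"
  have X: "x \<in> tiles T" if "x \<in> ?X" for x using that by (simp add: tiles_at_def)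
  have Ev: "e \<in> ?Ev \<longleftrightarrow> e \<in> edges T \<and> vert_pt v \<in> line e" for e using vertex_in_line v(1) by blast
  have fin: "finite ?Ev" "card ?Ev = n" using degree[OF v(1)] by auto
  have E_sub: "side T i ` ?X \<subseteq> ?Ev" if "i = l \<or> i = p" for i
    using on that lp side_edges X Ev by blast
  \<comment> \<open>Both tiles of an edge see it under the same index; this separates the pairs
    within a family and the two families from each other.\<close>
  have at_side: "side T i z = e" if t: "i < m" "z \<in> tiles_of e" "e \<in> side T i ` ?X" for i z e
  proof -
    obtain x where x: "x \<in> ?X" "e = side T i x" using t(3) by blast
    obtain j where j: "z \<in> tiles T" "j < m" "side T j z = e" using t(2) by (auto simp: tiles_of_def)
    show ?thesis
      using same_side[OF j(1) X[OF x(1)] _ j(2) t(1)] j x by (cases "z = x") auto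
  qed
  have two: "finite (tiles_of e) \<and> card (tiles_of e) = 2" if "e \<in> edges T" for e
    using two_tiles[OF that] by auto
  have X_card: "finite ?X \<and> card ?X = 2 * card (side T i ` ?X)" if i: "i = l \<or> i = p" for i
  proof -
    have im: "i < m" using i lp by blast
    define U where "U = (\<Union>e\<in>side T i ` ?X. tiles_of e)"
    have eq: "?X = U"
    proof (intro equalityI subsetI)
      fix x assume "x \<in> ?X"
      then show "x \<in> U" using im X by (auto simp: tiles_of_def U_def)
    next
      fix x assume "x \<in> U"
      then obtain e where "e \<in> side T i ` ?X" "x \<in> tiles_of e" unfolding U_def by blast
      then show "x \<in> ?X" using E_sub[OF i] Ev tiles_of_subset_tiles_at[of "vert_pt v" e] by blast
    qed
    have finE: "finite (side T i ` ?X)" using finite_subset[OF E_sub[OF i] fin(1)] .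
    have e2: "finite (tiles_of e) \<and> card (tiles_of e) = 2" if "e \<in> side T i ` ?X" for e
      using two E_sub[OF i] that by blast
    have "card U = (\<Sum>e\<in>side T i ` ?X. card (tiles_of e))"
      unfolding U_def
    proof (rule card_UN_disjoint[OF finE])
      show "\<forall>e\<in>side T i ` ?X. finite (tiles_of e)" using e2 by blast
      show "\<forall>e\<in>side T i ` ?X. \<forall>e'\<in>side T i ` ?X. e \<noteq> e' \<longrightarrow> tiles_of e \<inter> tiles_of e' = {}"
      proof (intro ballI impI equals0I)
        fix e e' z
        assume e: "e \<in> side T i ` ?X" "e' \<in> side T i ` ?X" "e \<noteq> e'" and z: "z \<in> tiles_of e \<inter> tiles_of e'"
        show False using at_side[OF im _ e(1), of z] at_side[OF im _ e(2), of z] z e(3) by simp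
      qed
    qed
    also have "\<dots> = (\<Sum>e\<in>side T i ` ?X. 2)" using e2 by (intro sum.cong) auto
    also have "\<dots> = 2 * card (side T i ` ?X)" by simp
    finally have "card U = 2 * card (side T i ` ?X)" .
    moreover have "finite U" unfolding U_def using finE e2 by blast
    ultimately show ?thesis by (simp only: eq)
  qed
  have "?Ev = side T l ` ?X \<union> side T p ` ?X"
  proof (intro equalityI subsetI)
    fix e assume e: "e \<in> ?Ev"
    then obtain x where x: "x \<in> tiles_of e" using edge_on_tile by blast
    then obtain i where i: "i < m" "side T i x = e" by (auto simp: tiles_of_def)
    have "x \<in> ?X" using e Ev tiles_of_subset_tiles_at x by blast
    then have "i = l \<or> i = p" using on[OF _ i(1)] e Ev i(2) by blast
    then show "e \<in> side T l ` ?X \<union> side T p ` ?X" using \<open>x \<in> ?X\<close> i(2) by blast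
  qed (use E_sub in blast)
  moreover have "side T l ` ?X \<inter> side T p ` ?X = {}"
  proof (rule ccontr)
    assume "side T l ` ?X \<inter> side T p ` ?X \<noteq> {}"
    then obtain e x where e: "e \<in> side T l ` ?X" "x \<in> ?X" "e = side T p x" by blast
    then have "x \<in> tiles_of e" using lp X by (auto simp: tiles_of_def)
    then have "side T l x = side T p x" using at_side[OF lp(1) _ e(1)] e(3) by blast
    then show False using side_inj[OF X[OF e(2)] lp(1,2)] lp(3) by blast
  qed
  ultimately have "n = card (side T l ` ?X) + card (side T p ` ?X)"
    using fin X_card by (metis card_Un_disjoint finite_imageI)
  then show ?thesis using X_card[of l] X_card[of p] by simp
qed

text \<open>Crossing side \<open>l\<close> and crossing side \<open>p\<close> are fixed-point free
  involutions on the tiles at the vertex, jointly transitive by \<open>link_vertex\<close>, and the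
  number \<open>n\<close> of these tiles is divisible by 4.\<close>

lemma vertex_signs:
  fixes \<kappa> :: "nat \<Rightarrow> int"
  assumes v: "v \<in> verts T" "vert_pt v \<notin> P" and \<kappa>: "\<And>i. \<kappa> i \<in> {1, -1}"
  shows "\<exists>g. (\<forall>x. g x \<in> {1, -1}) \<and> (\<forall>x y. adj_at (vert_pt v) x y \<longrightarrow> g y = edge_sign \<kappa> x y * g x)"
proof -
  obtain l p where lp: "l < m" "p < m" "l \<noteq> p"
    and on: "\<And>x i. x \<in> tiles_at (vert_pt v) \<Longrightarrow> i < m \<Longrightarrow> vert_pt v \<in> line (side T i x) \<longleftrightarrow> i = l \<or> i = p"
    using vertex_tiles[OF v] by metis
  let ?X = "tiles_at (vert_pt v)"
  have X: "x \<in> tiles T" if "x \<in> ?X" for x using that by (simp add: tiles_at_def)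
  have card: "finite ?X" "4 dvd card ?X" using card_tiles_at_vertex[OF v lp on] n by auto
  have across_adj: "adj_at (vert_pt v) x (tile_across m T i x)" if "x \<in> ?X" "i = l \<or> i = p" for x i
  proof -
    have "i < m" using that lp by blast
    then show ?thesis
      using tile_across(1-3)[OF X[OF that(1)], of i] on[OF that(1), of i] that X unfolding adj_at_def by metis
  qed
  have adj_across: "\<exists>i. (i = l \<or> i = p) \<and> y = tile_across m T i x \<and> edge_sign \<kappa> x y = \<kappa> i"
    if xy: "adj_at (vert_pt v) x y" for x y
  proof -
    have t: "x \<in> ?X" "x \<in> tiles T" "y \<in> tiles T" "x \<noteq> y"
      using adj_at_tiles[OF xy] xy by (auto simp: adj_at_def)
    obtain i where i: "i < m" "side T i x = side T i y" "vert_pt v \<in> line (side T i x)"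
      using xy by (auto simp: adj_at_def)
    then show ?thesis
      using on[OF t(1) i(1)] tile_across(4)[OF t(2) i(1) t(3)] t edge_sign_eq[OF t(2-4) i(1,2)] by metis
  qed
  have invol: "tile_across m T i x \<in> ?X" "tile_across m T i (tile_across m T i x) = x" "tile_across m T i x \<noteq> x"
    if "x \<in> ?X" "i = l \<or> i = p" for x i
  proof -
    have im: "i < m" using that lp by blast
    show in_X: "tile_across m T i x \<in> ?X" using adj_at_tiles[OF across_adj[OF that]] by blast
    note ta = tile_across[OF X[OF that(1)] im]
    show "tile_across m T i x \<noteq> x" by (rule ta(2))
    show "tile_across m T i (tile_across m T i x) = x"
      using tile_across(4)[OF X[OF in_X] im X[OF that(1)]] ta(2,3) by metis
  qed
  have "\<exists>g. (\<forall>x. g x \<in> {1, -1}) \<and>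
      (\<forall>x\<in>?X. g (tile_across m T l x) = \<kappa> l * g x \<and> g (tile_across m T p x) = \<kappa> p * g x)"
  proof (rule involutions_signs[OF card(1)])
    fix U assume U: "U \<subseteq> ?X" "U \<noteq> {}" "\<And>x. x \<in> U \<Longrightarrow> tile_across m T l x \<in> U \<and> tile_across m T p x \<in> U"
    show "U = ?X"
    proof (rule link_vertex[OF v U(1,2)])
      show "y \<in> U" if "x \<in> U" "adj_at (vert_pt v) x y" for x y
        using adj_across[OF that(2)] U(3)[OF that(1)] by blast
    qed
  qed (use invol card(2) \<kappa> in blast)+
  then obtain g where g: "\<forall>x. g x \<in> {1, -1}"
    "\<And>x. x \<in> ?X \<Longrightarrow> g (tile_across m T l x) = \<kappa> l * g x \<and> g (tile_across m T p x) = \<kappa> p * g x" by blast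
  have "g y = edge_sign \<kappa> x y * g x" if xy: "adj_at (vert_pt v) x y" for x y
    using adj_across[OF xy] adj_at_tiles[OF xy] g(2)[of x] by auto
  then show ?thesis using g(1) by blast
qed

lemma point_signs:
  fixes \<kappa> :: "nat \<Rightarrow> int"
  assumes q: "q \<in> S" "q \<notin> P" and \<kappa>: "\<And>i. \<kappa> i \<in> {1, -1}"
  shows "\<exists>g. (\<forall>x. g x \<in> {1, -1}) \<and> (\<forall>x y. adj_at q x y \<longrightarrow> g y = edge_sign \<kappa> x y * g x)"
  using q(1)
proof (cases rule: point_cases)
  case (vertex v)
  then show ?thesis using vertex_signs[of v \<kappa>, OF vertex(1) _ \<kappa>] q(2) by simp
next
  case (edge e z)
  then have eq: "tiles_at q = tiles_of e" using tiles_at_open_edge by simp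
  obtain x y where xy: "x \<noteq> y" "tiles_of e = {x, y}" using two_tiles[OF edge(1)] by blast
  \<comment> \<open>Inside an edge there is a single crossing, and as its sign does not depend on
    the direction, one choice serves both ways.\<close>
  have sym: "edge_sign \<kappa> y x = edge_sign \<kappa> x y" by (simp add: edge_sign_def eq_commute)
  have pm: "edge_sign \<kappa> x y \<in> {1, -1}" using \<kappa> by (simp add: edge_sign_def)
  define g where "g z = (if z = y then edge_sign \<kappa> x y else 1)" for z
  have "g w = edge_sign \<kappa> u w * g u" if "adj_at q u w" for u w
  proof -
    have "u \<noteq> w" "u \<in> {x, y}" "w \<in> {x, y}" using that adj_at_tiles[OF that] eq xy by (auto simp: adj_at_def)
    then consider "u = x" "w = y" | "u = y" "w = x" by blast
    then show ?thesis using sym pm xy(1) by cases (auto simp: g_def)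
  qed
  moreover have "\<forall>z. g z \<in> {1, -1}" using pm by (simp add: g_def)
  ultimately show ?thesis by blast
next
  case (tile x z)
  then have "tiles_at q = {x}" using tiles_at_inner by simp
  then have "\<not> adj_at q u w" for u w
    using adj_at_tiles[of q u w] unfolding adj_at_def by (metis singletonD)
  then show ?thesis by (intro exI[of _ "\<lambda>_. 1"]) simp
qed

section \<open>From local to global signs\<close>

sublocale links: plane_links "\<lambda>w. tiles_at (k w)" "\<lambda>w. adj_at (k w)"
proof
  fix w
  show "tiles_at (k w) \<noteq> {}" using tiles_at_nonempty k_in by blast
  show "\<exists>N. open N \<and> w \<in> N \<and> (\<forall>u\<in>N. tiles_at (k u) \<subseteq> tiles_at (k w) \<and>
      (\<forall>x y. adj_at (k u) x y \<longrightarrow> adj_at (k w) x y))"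
    using k_vimage_open[OF star_at_open] star_at_self[OF k_in(1)] star_at_upper
    by (intro exI[of _ "k -` star_at (k w)"]) auto
  show "A = tiles_at (k w)"
    if "A \<subseteq> tiles_at (k w)" "A \<noteq> {}" "\<And>x y. x \<in> A \<Longrightarrow> adj_at (k w) x y \<Longrightarrow> y \<in> A" for A
    using link_point[OF k_in] that by blast
  show "x \<in> tiles_at (k w) \<and> y \<in> tiles_at (k w)" if "adj_at (k w) x y" for x y
    using adj_at_tiles that by blast
qed

lemma tile_preimage: assumes "x \<in> tiles T" shows "\<exists>w. x \<in> tiles_at (k w)"
proof -
  have "inner_pt 0" using inner_pt_scale[OF zero_poly, of 0] by simp
  then have "tile_pt x 0 \<in> body x" "tile_pt x 0 \<in> S" "tile_pt x 0 \<notin> P"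
    using tile_pt_S tile_pt_inner_not_P assms inner_poly by (auto simp: body_def)
  then have "x \<in> tiles_at (k (k' (tile_pt x 0)))" using k_k' assms by (simp add: tiles_at_def)
  then show ?thesis by blast
qed

text \<open>The midpoint of the common edge is never the puncture, so every adjacency is visible in
  the chart.\<close>

lemma adjacent_at_point:
  assumes "x \<in> tiles T" "y \<in> tiles T" "x \<noteq> y" "i < m" "side T i x = side T i y"
  shows "\<exists>w. adj_at (k w) x y"
proof -
  have e: "side T i x \<in> edges T" using side_edges assms by blast
  have "edge_pt (side T i x) mid \<in> line (side T i x)" using mid by (simp add: line_def)
  then have "adj_at (k (k' (edge_pt (side T i x) mid))) x y"
    using k_k'[of "edge_pt (side T i x) mid"] mid_not_P[OF e] assms unfolding adj_at_def by auto
  then show ?thesis by blast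
qed

lemma exists_tile_signs:
  fixes \<kappa> :: "nat \<Rightarrow> int"
  assumes \<kappa>: "\<And>i. \<kappa> i \<in> {1, -1}" and "x0 \<in> tiles T"
  shows "\<exists>g :: 't \<Rightarrow> int. (\<forall>x. g x \<in> {1, -1}) \<and> g x0 = 1 \<and>
     (\<forall>x\<in>tiles T. \<forall>i<m. g (tile_across m T i x) = \<kappa> i * g x)"
proof -
  obtain w0 where w0: "x0 \<in> tiles_at (k w0)" using tile_preimage assms(2) by blast
  have conn: "connected {w. x \<in> tiles_at (k w)}" for x
  proof (cases "x \<in> tiles T")
    case False
    then have "{w. x \<in> tiles_at (k w)} = {}" by (simp add: tiles_at_def)
    then show ?thesis by simp
  qed (rule connected_tile_preimage)
  obtain g where g: "\<forall>x. g x \<in> {1, -1}" "\<forall>w x y. adj_at (k w) x y \<longrightarrow> g y = edge_sign \<kappa> x y * g x" "g x0 = 1"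
    using links.exists_sign_function[where s = "edge_sign \<kappa>", OF point_signs[OF k_in \<kappa>] conn w0] by blast
  have "g (tile_across m T i x) = \<kappa> i * g x" if "x \<in> tiles T" "i < m" for x i
  proof -
    note ta = tile_across[OF that]
    show ?thesis
      using adjacent_at_point[OF that(1) ta(1) ta(2)[symmetric] that(2) ta(3)[symmetric]] g(2)
        edge_sign_eq[OF that(1) ta(1) ta(2)[symmetric] that(2) ta(3)[symmetric]] by metis
  qed
  then show ?thesis using g by blast
qed

text \<open>An induction principle for tiles, from \<open>all_tiles_if_one\<close> with a property
  independent of the point. It serves both to locate the values of the edge-reversal and to prove
  uniqueness.\<close>

lemma tiles_connected:
  assumes "x0 \<in> A" "x0 \<in> tiles T" "\<And>x i. x \<in> A \<Longrightarrow> x \<in> tiles T \<Longrightarrow> i < m \<Longrightarrow> tile_across m T i x \<in> A"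
    and x: "x \<in> tiles T"
  shows "x \<in> A"
proof -
  obtain w0 where w0: "x0 \<in> tiles_at (k w0)" using tile_preimage assms(2) by blast
  obtain w where w: "x \<in> tiles_at (k w)" using tile_preimage x by blast
  show ?thesis
  proof (rule links.all_tiles_if_one[where R = UNIV and Q = "\<lambda>w x. x \<in> A", OF _ _ _ _ w0 assms(1) _ w])
    show "links.locally_const UNIV (\<lambda>w x. x \<in> A)"
      unfolding links.locally_const_def by auto
    fix w u y assume adj: "adj_at (k w) u y" and u: "u \<in> A"
    obtain i where i: "i < m" "side T i u = side T i y" "u \<in> tiles T" "y \<in> tiles T" "u \<noteq> y"
      using adj by (auto simp: adj_at_def)
    then have "y = tile_across m T i u" using tile_across(4)[OF i(3,1,4)] by metis
    then show "y \<in> A" using assms(3)[OF u i(3,1)] by simp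
  qed auto
qed

end

section \<open>Edge-reversals\<close>

lemma gon_dirs_sign_tuples: "gon_dirs m c \<in> sign_tuples m"
  by (auto simp: gon_dirs_def sign_tuples_def)

lemma dihedral_act_sign_tuples: "\<delta> \<in> sign_tuples m \<Longrightarrow> dihedral_act \<sigma> \<delta> \<in> sign_tuples m"
  by (auto simp: dihedral_act_def sign_tuples_def)

lemma tuple_mult_nth: 
  "\<delta> \<in> sign_tuples m \<Longrightarrow> \<epsilon> \<in> sign_tuples m \<Longrightarrow> i < m \<Longrightarrow> tuple_mult \<delta> \<epsilon> ! i = \<delta> ! i * \<epsilon> ! i"
  by (simp add: tuple_mult_def sign_tuples_def)

lemma sign_tuples_nth: "\<delta> \<in> sign_tuples m \<Longrightarrow> i < m \<Longrightarrow> \<delta> ! i \<in> {1, -1}"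
  using nth_mem[of i \<delta>] by (auto simp: sign_tuples_def simp del: nth_mem)

lemma sign_tuplesI: "length \<delta> = m \<Longrightarrow> (\<And>i. i < m \<Longrightarrow> \<delta> ! i \<in> {1, -1}) \<Longrightarrow> \<delta> \<in> sign_tuples m"
  unfolding sign_tuples_def by (auto simp: in_set_conv_nth) force

lemma tuple_mult_sign_tuples:
  assumes "\<delta> \<in> sign_tuples m" "\<epsilon> \<in> sign_tuples m" shows "tuple_mult \<delta> \<epsilon> \<in> sign_tuples m"
proof (rule sign_tuplesI)
  show "length (tuple_mult \<delta> \<epsilon>) = m" using assms by (simp add: tuple_mult_def sign_tuples_def)
  show "tuple_mult \<delta> \<epsilon> ! i \<in> {1, -1}" if "i < m" for i
    using sign_tuples_nth[OF assms(1) that] sign_tuples_nth[OF assms(2) that] tuple_mult_nth[OF assms that] by auto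
qed

lemma sign_tuples_eqI:
  "\<delta> \<in> sign_tuples m \<Longrightarrow> \<epsilon> \<in> sign_tuples m \<Longrightarrow> (\<And>i. i < m \<Longrightarrow> \<delta> ! i = \<epsilon> ! i) \<Longrightarrow> \<delta> = \<epsilon>"
  by (rule nth_equalityI) (auto simp: sign_tuples_def)

lemma gon_maps_eqI:
  assumes "\<tau> \<in> gon_maps m P Q" "\<tau>' \<in> gon_maps m P Q"
    and "\<And>v. v \<in> verts P \<Longrightarrow> on_verts \<tau> v = on_verts \<tau>' v"
    and "\<And>e. e \<in> edges P \<Longrightarrow> on_edges \<tau> e = on_edges \<tau>' e"
    and "\<And>x. x \<in> tiles P \<Longrightarrow> on_tiles \<tau> x = on_tiles \<tau>' x"
  shows "\<tau> = \<tau>'"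
proof -
  have "on_verts \<tau> = on_verts \<tau>'"
    using assms(1-3) unfolding gon_maps_def by (blast intro: PiE_ext)
  moreover have "on_edges \<tau> = on_edges \<tau>'"
    using assms(1,2,4) unfolding gon_maps_def by (blast intro: PiE_ext)
  moreover have "on_tiles \<tau> = on_tiles \<tau>'"
    using assms(1,2,5) unfolding gon_maps_def by (blast intro: PiE_ext)
  ultimately show ?thesis by (simp add: prod_eq_iff)
qed

text \<open>Side \<open>i\<close> of \<open>Outer i\<close> and side \<open>i\<close> of
  \<open>Centre\<close> are one edge of the star, so both tuples have the same \<open>i\<close>-th
  entry.\<close>

lemma scheme_fixes_side:
  assumes "\<phi> \<in> gon_maps m (star m c) (dir_presheaf B)" "on_tiles \<phi> Centre = replicate m 1" "i < m"
  shows "on_tiles \<phi> (Outer i) ! i = 1"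
proof -
  have "on_tiles \<phi> s ! i = on_edges \<phi> (star_side i s)" if "s \<in> star_tiles m" for s
    using gon_maps_dir_side(1)[OF assms(1), of s i] that assms(3) by (simp add: star_def)
  from this[of Centre] this[of "Outer i"] show ?thesis
    using assms(2,3) by (simp add: star_side_def star_tiles_def)
qed

section \<open>Construction and uniqueness of the edge-reversal\<close>

context tiled_surface begin

text \<open>Makes values on edges well defined: two different tiles on an edge lie across from each
  other, under the same index.\<close>

lemma side_value_unique:
  assumes "\<And>x i. x \<in> tiles T \<Longrightarrow> i < m \<Longrightarrow> h (tile_across m T i x) i = h x i"
    and "x \<in> tiles T" "y \<in> tiles T" "i < m" "j < m" "side T i x = side T j y"
  shows "h x i = h y j"
proof (cases "x = y")
  case True
  then show ?thesis using side_inj assms by metis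
next
  case False
  then have "i = j" using same_side assms(2-6) by blast
  moreover have "y = tile_across m T i x"
    using tile_across(4)[OF assms(2,4,3)] False assms(6) \<open>i = j\<close> by metis
  ultimately show ?thesis using assms(1,2,4) by metis
qed

lemma generated_reversal_ex1:
  assumes rc: "reversal_closed m (gon_dirs m c') \<Gamma>" and scheme: "reflection_scheme m n' c c' \<Gamma> \<phi>"
    and x0: "x0 \<in> tiles T" and \<sigma>: "\<sigma> \<in> \<Gamma>"
  shows "\<exists>!\<tau>. \<tau> \<in> gon_maps m T (Lam_cat m c c') \<and> generated m c T \<phi> \<tau> \<and>
           on_tiles \<tau> x0 = tuple_mult (gon_dirs m c) (dihedral_act \<sigma> (gon_dirs m c'))"
proof -
  define \<delta> \<delta>' where "\<delta> = gon_dirs m c" and "\<delta>' = gon_dirs m c'"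
  define act where "act \<sigma> = dihedral_act \<sigma> \<delta>'" for \<sigma>
  have st: "\<delta> \<in> sign_tuples m" "\<delta>' \<in> sign_tuples m" "act \<sigma> \<in> sign_tuples m" for \<sigma>
    by (simp_all add: \<delta>_def \<delta>'_def act_def gon_dirs_sign_tuples dihedral_act_sign_tuples)
  define A where "A = {tuple_mult \<delta> (act \<sigma>) | \<sigma>. \<sigma> \<in> carrier (dihedral m)}"
  \<comment> \<open>Values are tracked in this smaller set, since reversal-closedness speaks about
    \<open>\<Gamma>\<close> alone.\<close>
  define A\<Gamma> where "A\<Gamma> = {tuple_mult \<delta> (act \<sigma>) | \<sigma>. \<sigma> \<in> \<Gamma>}"
  define B where "B = {tuple_mult \<delta>' (act \<sigma>) | \<sigma>. \<sigma> \<in> \<Gamma>}"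
  have Lam_A: "Lam_cat m c c' = dir_presheaf A" by (simp add: Lam_cat_def A_def \<delta>_def act_def \<delta>'_def)
  have Lam_B: "Lam_sub m c' \<Gamma> = dir_presheaf B" by (simp add: Lam_sub_def B_def act_def \<delta>'_def)
  have "\<Gamma> \<subseteq> carrier (dihedral m)" using rc by (simp add: reversal_closed_def)
  then have A_sub: "A \<subseteq> sign_tuples m" "B \<subseteq> sign_tuples m" "A\<Gamma> \<subseteq> A"
    using st tuple_mult_sign_tuples unfolding A_def B_def A\<Gamma>_def by blast+
  have \<phi>: "\<phi> \<in> gon_maps m (star m c) (dir_presheaf B)" "on_tiles \<phi> Centre = replicate m 1"
    using scheme by (auto simp: reflection_scheme_def Lam_B)
  define p where "p i = on_tiles \<phi> (Outer i)" for i
  have pB: "p i \<in> B" if "i < m" for i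
    using gon_maps_dir_side(2)[OF \<phi>(1), of "Outer i" i] that by (simp add: p_def star_def star_tiles_def)
  have p_self: "p i ! i = 1" if "i < m" for i using scheme_fixes_side[OF \<phi> that] by (simp add: p_def)
  have p_st: "p i \<in> sign_tuples m" if "i < m" for i using pB[OF that] A_sub by blast
  have gen: "generated m c T \<phi> \<tau> \<longleftrightarrow> (\<forall>x\<in>tiles T. \<forall>i<m.
      on_tiles \<tau> (tile_across m T i x) = tuple_mult (p i) (on_tiles \<tau> x))"
    if "\<tau> \<in> gon_maps m T (dir_presheaf A)" for \<tau>
    unfolding p_def
    by (rule generated_iff[OF cat pre that A_sub(1) \<phi>(1) A_sub(2) \<phi>(2) tile_across(1)])
  define start where "start = tuple_mult \<delta> (act \<sigma>)"
  have start: "start \<in> A\<Gamma>" "start \<in> sign_tuples m"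
    using \<sigma> st tuple_mult_sign_tuples unfolding start_def A\<Gamma>_def by blast+
  have "\<exists>g :: 't \<Rightarrow> int. (\<forall>x. g x \<in> {1, -1}) \<and> g x0 = 1 \<and>
     (\<forall>x\<in>tiles T. \<forall>i<m. g (tile_across m T i x) = p i ! l * g x)" if "l < m" for l
  proof -
    \<comment> \<open>Padded by 1 beyond the sides, as \<open>exists_tile_signs\<close> expects a
      sign at every index.\<close>
    define \<kappa> where "\<kappa> i = (if i < m then p i ! l else 1)" for i
    have "\<kappa> i \<in> {1, -1}" for i using sign_tuples_nth[OF p_st that] by (auto simp: \<kappa>_def)
    from exists_tile_signs[of \<kappa>, OF this x0] show ?thesis by (simp add: \<kappa>_def)
  qed
  then obtain g where g: "\<And>l x. l < m \<Longrightarrow> g l x \<in> {1, -1 :: int}" "\<And>l. l < m \<Longrightarrow> g l x0 = 1"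
    "\<And>l x i. l < m \<Longrightarrow> x \<in> tiles T \<Longrightarrow> i < m \<Longrightarrow> g l (tile_across m T i x) = p i ! l * g l x"
    by metis
  define t where "t x = map (\<lambda>l. g l x * start ! l) [0..<m]" for x
  have t_nth: "t x ! l = g l x * start ! l" if "l < m" for x l using that by (simp add: t_def)
  have t_st: "t x \<in> sign_tuples m" for x
  proof (rule sign_tuplesI)
    show "t x ! l \<in> {1, -1}" if "l < m" for l
      using g(1)[OF that, of x] sign_tuples_nth[OF start(2) that] t_nth[OF that, of x] by auto
  qed (simp add: t_def)
  have t_x0: "t x0 = start"
    by (rule sign_tuples_eqI[OF t_st start(2)]) (simp add: t_nth g(2))
  have t_across: "t (tile_across m T i x) = tuple_mult (p i) (t x)" if "x \<in> tiles T" "i < m" for x i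
    by (rule sign_tuples_eqI[OF t_st tuple_mult_sign_tuples[OF p_st[OF that(2)] t_st]])
      (simp add: t_nth tuple_mult_nth[OF p_st[OF that(2)] t_st] g(3) that)
  have t_A: "t x \<in> A\<Gamma>" if "x \<in> tiles T" for x
  proof -
    have "x \<in> {x. t x \<in> A\<Gamma>}"
    proof (rule tiles_connected[OF _ x0 _ that])
      show "x0 \<in> {x. t x \<in> A\<Gamma>}" using start t_x0 by simp
      fix y i assume y: "y \<in> {x. t x \<in> A\<Gamma>}" "y \<in> tiles T" "i < m"
      obtain \<sigma>1 where s1: "\<sigma>1 \<in> \<Gamma>" "p i = tuple_mult \<delta>' (act \<sigma>1)" using pB[OF y(3)] by (auto simp: B_def)
      obtain \<sigma>2 where s2: "\<sigma>2 \<in> \<Gamma>" "t y = tuple_mult \<delta> (act \<sigma>2)" using y(1) by (auto simp: A\<Gamma>_def)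
      obtain \<sigma>3 where s3: "\<sigma>3 \<in> \<Gamma>" "tuple_mult (tuple_mult \<delta>' (act \<sigma>1)) (act \<sigma>2) = act \<sigma>3"
        using rc s1(1) s2(1) unfolding reversal_closed_def act_def \<delta>'_def by blast
      \<comment> \<open>The product of the two tuples is \<open>\<delta>\<close> times
        \<open>\<delta>' \<cdot> act \<sigma>1 \<cdot> act \<sigma>2\<close>, the product that
        reversal-closedness turns into \<open>act \<sigma>3\<close>.\<close>
      have "t (tile_across m T i y) = tuple_mult \<delta> (act \<sigma>3)"
      proof (rule sign_tuples_eqI[OF t_st tuple_mult_sign_tuples[OF st(1,3)]])
        fix l assume l: "l < m"
        have "t (tile_across m T i y) ! l = p i ! l * t y ! l"
          using t_across[OF y(2,3)] tuple_mult_nth[OF p_st[OF y(3)] t_st l] by simp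
        also have "\<dots> = \<delta> ! l * (tuple_mult (tuple_mult \<delta>' (act \<sigma>1)) (act \<sigma>2) ! l)"
          using l by (simp add: s1(2) s2(2) tuple_mult_nth[where m = m] st tuple_mult_sign_tuples)
        finally show "t (tile_across m T i y) ! l = tuple_mult \<delta> (act \<sigma>3) ! l"
          using l by (simp add: s3(2) tuple_mult_nth[where m = m] st)
      qed
      then show "tile_across m T i y \<in> {x. t x \<in> A\<Gamma>}" using s3(1) unfolding A\<Gamma>_def by blast
    qed
    then show ?thesis by simp
  qed
  \<comment> \<open>Crossing side \<open>i\<close> multiplies entry \<open>i\<close> by
    \<open>p i ! i = 1\<close>, so the entry belonging to the crossed edge does not change.\<close>
  have side_val: "t x ! i = t y ! j"
    if "x \<in> tiles T" "y \<in> tiles T" "i < m" "j < m" "side T i x = side T j y" for x y i j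
  proof (rule side_value_unique[where h = "\<lambda>x i. t x ! i", OF _ that])
    show "t (tile_across m T i x) ! i = t x ! i" if "x \<in> tiles T" "i < m" for x i
      using t_across[OF that] tuple_mult_nth[OF p_st[OF that(2)] t_st that(2)] p_self[OF that(2)] by simp
  qed
  have on_side: "\<exists>x i. x \<in> tiles T \<and> i < m \<and> e = side T i x" if "e \<in> edges T" for e
    using edge_on_tile[OF that] by (auto simp: tiles_of_def)
  then obtain ex ei where e: "\<And>e. e \<in> edges T \<Longrightarrow> ex e \<in> tiles T \<and> ei e < m \<and> e = side T (ei e) (ex e)"
    by metis
  \<comment> \<open>Read off at an arbitrarily chosen tile and side of the edge;
    \<open>side_val\<close> gives independence of the choice.\<close>
  define et where "et e = t (ex e) ! ei e" for e
  have et_side: "et (side T i x) = t x ! i" if "x \<in> tiles T" "i < m" for x i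
    using side_val[of "ex (side T i x)" x "ei (side T i x)" i] e[OF side_edges[OF that(2,1)]] that
    by (simp add: et_def)
  have et_pm: "et u \<in> {1, -1}" if "u \<in> edges T" for u
    using e[OF that] sign_tuples_nth[OF t_st] by (simp add: et_def)
  define \<tau> where "\<tau> = (\<lambda>v \<in> verts T. (), \<lambda>e \<in> edges T. et e, \<lambda>x \<in> tiles T. t x)"
  have \<tau>: "\<tau> \<in> gon_maps m T (dir_presheaf A)"
    unfolding gon_maps_def
  proof (intro CollectI conjI)
    show "on_verts \<tau> \<in> verts T \<rightarrow>\<^sub>E verts (dir_presheaf A)" by (simp add: \<tau>_def dir_presheaf_def)
    show "on_edges \<tau> \<in> edges T \<rightarrow>\<^sub>E edges (dir_presheaf A)" using et_pm by (simp add: \<tau>_def dir_presheaf_def)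
    show "on_tiles \<tau> \<in> tiles T \<rightarrow>\<^sub>E tiles (dir_presheaf A)"
      using t_A A_sub(3) by (auto simp: \<tau>_def dir_presheaf_def)
    show "\<forall>i j. \<forall>f\<in>ghom m i j. \<forall>a\<in>cells T j.
        map_cell (on_verts \<tau>) (on_edges \<tau>) (on_tiles \<tau>) (restr T f a) =
        restr (dir_presheaf A) f (map_cell (on_verts \<tau>) (on_edges \<tau>) (on_tiles \<tau>) a)"
      unfolding all_gon_ob using et_side side_edges
      by (auto simp: ghom_simps \<tau>_def dir_presheaf_def)
  qed
  show ?thesis
  proof (intro ex1I[of _ \<tau>])
    show "\<tau> \<in> gon_maps m T (Lam_cat m c c') \<and> generated m c T \<phi> \<tau> \<and>
        on_tiles \<tau> x0 = tuple_mult (gon_dirs m c) (dihedral_act \<sigma> (gon_dirs m c'))"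
      unfolding Lam_A gen[OF \<tau>] using \<tau> t_across tile_across(1) x0 t_x0
      by (simp add: \<tau>_def start_def \<delta>_def act_def \<delta>'_def)
    fix \<tau>' assume "\<tau>' \<in> gon_maps m T (Lam_cat m c c') \<and> generated m c T \<phi> \<tau>' \<and>
        on_tiles \<tau>' x0 = tuple_mult (gon_dirs m c) (dihedral_act \<sigma> (gon_dirs m c'))"
    then have \<tau>': "\<tau>' \<in> gon_maps m T (dir_presheaf A)" "generated m c T \<phi> \<tau>'" "on_tiles \<tau>' x0 = start"
      by (simp_all add: Lam_A start_def \<delta>_def act_def \<delta>'_def)
    have \<tau>'_across: "on_tiles \<tau>' (tile_across m T i x) = tuple_mult (p i) (on_tiles \<tau>' x)"
      if "x \<in> tiles T" "i < m" for x i
      using gen[OF \<tau>'(1)] \<tau>'(2) that by blast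
    \<comment> \<open>Both reversals obey the same crossing rule, so agreement at \<open>x0\<close>
      spreads to all tiles; edges follow, as each lies on a tile.\<close>
    have tiles: "on_tiles \<tau>' x = on_tiles \<tau> x" if "x \<in> tiles T" for x
    proof -
      have "x \<in> {x. on_tiles \<tau>' x = on_tiles \<tau> x}"
        by (rule tiles_connected[OF _ x0 _ that])
          (use \<tau>'(3) \<tau>'_across x0 t_x0 t_across tile_across(1) in \<open>simp_all add: \<tau>_def\<close>)
      then show ?thesis by simp
    qed
    show "\<tau>' = \<tau>"
    proof (rule gon_maps_eqI[OF \<tau>'(1) \<tau>])
      fix u assume "u \<in> edges T"
      then obtain x i where x: "x \<in> tiles T" "i < m" "u = side T i x" using on_side by blast
      show "on_edges \<tau>' u = on_edges \<tau> u"
        using gon_maps_dir_side(1)[OF \<tau>'(1) x(1,2)] gon_maps_dir_side(1)[OF \<tau> x(1,2)] tiles[OF x(1)] x(3) by simp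
    qed (use tiles in auto)
  qed
qed

end

section \<open>Sphere and planes as tiled surfaces\<close>

lemma directed_tiling_tiled_surface:
  fixes T :: "('v, 'e, 't) gon_presheaf"
  assumes "m \<ge> 3" "n > 0" "4 dvd n" "mgon_category m c"
    and tiling: "directed_tiling m n c (tiling_space m n) T"
    and "reflective m T" "x0 \<in> tiles T"
  shows "\<exists>(S :: (real^3) set) P f k k' v0. tiled_surface m c T n S P f k k' v0"
proof -
  interpret mgon_presheaf m c T
    using assms by unfold_locales (auto simp: directed_tiling_def)
  \<comment> \<open>The given tile guarantees a vertex at which the sphere can be punctured.\<close>
  define v0 where "v0 = corner T 0 x0"
  have v0: "v0 \<in> verts T" unfolding v0_def using m3 assms by (intro corner_verts) auto
  have real: "realization m c T homeomorphic_space tiling_space m n"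
    using tiling by (simp add: directed_tiling_def)
  have surface: "\<exists>k k'. tiled_surface m c T n S P f k k' v0"
    if s: "realizes S f" "P \<subseteq> {f (VCell v0, 0)}" "(S - P) homeomorphic (UNIV :: complex set)"
    for S P :: "(real^3) set" and f
  proof -
    obtain k k' where "homeomorphism (UNIV :: complex set) (S - P) k k'"
      using s(3) homeomorphic_sym unfolding homeomorphic_def by blast
    then have "tiled_surface m c T n S P f k k' v0"
      using s(1,2) assms v0 unfolding directed_tiling_def
      by unfold_locales auto
    then show ?thesis by blast
  qed
  show ?thesis
  proof (rule tiling_space_chart[of m n])
    assume sph: "tiling_space m n = top_of_set (sphere 0 1)"
      "\<And>b. b \<in> sphere 0 1 \<Longrightarrow> (sphere 0 1 - {b} :: (real^3) set) homeomorphic (UNIV :: complex set)"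
    obtain f where f: "realizes (sphere 0 1 :: (real^3) set) f"
      using homeomorphic_realizes real sph(1) by metis
    have "f (VCell v0, 0) \<in> sphere 0 1"
    proof -
      have "(VCell v0, 0) \<in> pts" using v0 by (auto simp: pts_def all_cells_eq)
      then show ?thesis using f unfolding realizes_def by blast
    qed
    then show ?thesis using surface[OF f, of "{f (VCell v0, 0)}"] sph(2) by blast
  next
    fix S :: "(real^3) set" assume S: "tiling_space m n = top_of_set S" "S homeomorphic (UNIV :: complex set)"
    obtain f where f: "realizes S f" using homeomorphic_realizes real S(1) by metis
    then have "\<exists>k k'. tiled_surface m c T n S {} f k k' v0" using surface[OF f, of "{}"] S(2) by simp
    then show ?thesis by blast
  qed
qed

theorem theorem4p20:
  fixes m n :: nat
    and c c' :: gon_comp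
    and \<Gamma> :: "(nat \<times> bool) set"
    and \<phi> :: star_dir_map
    and T :: "('v, 'e, 't) gon_presheaf"
    and x0 :: 't
    and \<sigma> :: "nat \<times> bool"
  assumes "m \<ge> 3"
    and "n > 0"
    and "4 dvd n"
    and "mgon_category m c"
    and "mgon_category m c'"
    and "reversal_closed m (gon_dirs m c') \<Gamma>"
    and "reflection_scheme m n c c' \<Gamma> \<phi>"
    and "directed_tiling m n c (tiling_space m n) T"
    and "reflective m T"
    and "x0 \<in> tiles T"
    and "\<sigma> \<in> \<Gamma>"
  shows "\<exists>!\<tau>. \<tau> \<in> gon_maps m T (Lam_cat m c c') \<and> generated m c T \<phi> \<tau> \<and>
           on_tiles \<tau> x0 = tuple_mult (gon_dirs m c) (dihedral_act \<sigma> (gon_dirs m c'))"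
proof -
  obtain S :: "(real^3) set" and P f k k' v0 where "tiled_surface m c T n S P f k k' v0"
    using directed_tiling_tiled_surface[OF assms(1-4,8-10)] by blast
  then interpret tiled_surface m c T n S P f k k' v0 .
  show ?thesis using assms(6,7,10,11) by (rule generated_reversal_ex1)
qed

end
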